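(* Let $n\in\mathbb{N}$, $n\ge1$, let $\sigma\in(0,1)$ and let $\gamma_0\in(0,\operatorname{diam}(\Omega)/2)$. There exists $\delta_0>0$ (with $\delta_0<\gamma_0$) such that, if $z(0)\in\mathcal{D}_{n,\delta_0,\gamma_0}$, then there exists $T_{\mathrm{coll}}^{\partial\Omega}>0$ such that the evolution $z(t)$ of $$\dot z_i(t)=-\nabla_{z_i}\mathcal{E}_n(z_1(t),\dots,z_n(t)),\qquad i=1,\dots,n,$$ with initial datum $z(0)$ is defined for $t\in[0,T_{\mathrm{coll}}^{\partial\Omega}]$, $z(t)\in\Omega^n$ for $t\in[0,T_{\mathrm{coll}}^{\partial\Omega})$, $z_1(T_{\mathrm{coll}}^{\partial\Omega})\in\partial\Omega$ and $z'(T_{\mathrm{coll}}^{\partial\Omega})\in\Omega^{n-1}$. Furthermore, as $\delta_0\to0$, $$T_{\mathrm{coll}}^{\partial\Omega}\le 2\pi\delta_0^2+O(\delta_0^3);$$ that is, with $\Omega,n,\sigma,\gamma_0$ fixed, there is a constant $C$ such that for all sufficiently small $\delta_0>0$ and every $z(0)\in\mathcal{D}_{n,\delta_0,\gamma_0}$ there exists $T_{\mathrm{coll}}^{\partial\Omega}>0$ such that the evolution $z(t)$ with initial datum $z(0)$ is defined for $t\in[0,T_{\mathrm{coll}}^{\partial\Omega}]$, $z(t)\in\Omega^n$ for $t\in[0,T_{\mathrm{coll}}^{\partial\Omega})$, $z_1(T_{\mathrm{coll}}^{\partial\Omega})\in\partial\Omega$, $z'(T_{\mathrm{coll}}^{\partial\Omega})\in\Omega^{n-1}$,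 and $T_{\mathrm{coll}}^{\partial\Omega}\le2\pi\delta_0^2+C\delta_0^3$.
   Context: $\Omega\subset\mathbb{R}^2$ is a bounded open connected set with $C^2$ boundary. $\bar\rho>0$ is a fixed radius for which the uniform interior and exterior disk conditions hold: for every $x\in\partial\Omega$ there are unique points $x_{\mathrm{int}},x_{\mathrm{ext}}$ with $B_{\bar\rho}(x_{\mathrm{int}})\subseteq\Omega$, $B_{\bar\rho}(x_{\mathrm{ext}})\subset\Omega^c$ and $\partial B_{\bar\rho}(x_{\mathrm{int}})\cap\partial\Omega\cap\partial B_{\bar\rho}(x_{\mathrm{ext}})=\{x\}$, where $B_r(x)$ is the open disk of radius $r$ centred at $x$. The function $k_\Omega(x,y)$, for $x,y\in\Omega$, is the solution of $-\Delta_x k_\Omega(x,y)=0$ for $x\in\Omega$ and $k_\Omega(x,y)=\frac1{2\pi}\log|x-y|$ for $x\in\partial\Omega$; it is smooth and symmetric on $\Omega\times\Omega$. Set $h_\Omega(x):=k_\Omega(x,x)$. For $n$ dislocations at distinct positions $z_1,\dots,z_n\in\Omega$ with Burgers moduli $b_1,\dots,b_n\in\{-1,+1\}$ (constant in time) the renormalised energy is $$\mathcal{E}_n(z_1,\dots,z_n)=\sum_{i<j}b_ib_j\Big(k_\Omega(z_i,z_j)-\frac1{2\pi}\log|z_i-z_j|\Big)+\frac12\sum_{i=1}^n b_i^2h_\Omega(z_i).$$ Saying that the evolution is defined on $[0,T]$ means that $z$ is continuous on $[0,T]$ and solves the system on $[0,T)$ (with $z_i(t)\neq z_j(t)$ for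 $i\ne j$ there), its value at $T$ being the limit as $t\uparrow T$. Distances: $d_1(x)=\operatorname{dist}(x,\partial\Omega)$, and for $m\ge2$, $d_m(x_1,\dots,x_m)=\min\{\min_i\operatorname{dist}(x_i,\partial\Omega),\ \min_{i\ne j}|x_i-x_j|\}$. Write $z=(z_1,z')$ with $z'=(z_2,\dots,z_n)$. For $0<\delta<\gamma<\operatorname{diam}(\Omega)/2$, $$\mathcal{D}_{n,\delta,\gamma}:=\{(z_1,z')\in\Omega^n : d_1(z_1)<\delta,\ d_{n-1}(z')>\gamma\},$$ where for $n=1$ the conditions on $z'$ are void. *)

theory Defs
  imports "HOL-Analysis.Analysis"
begin

text \<open>Near each boundary point the set is, in a suitable orthonormal frame, the strict epigraph of
  a function of class \<open>C\<^sup>2\<close>. Taking that function to be defined on the whole line is no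
  restriction, since only its values near 0 matter.\<close>

definition C2_boundary :: "(real^2) set \<Rightarrow> bool" where
  "C2_boundary \<Omega> \<longleftrightarrow>
    (\<forall>x\<in>frontier \<Omega>. \<exists>r>0. \<exists>(e1::real^2) (e2::real^2) \<phi> \<phi>' \<phi>''.
       norm e1 = 1 \<and> norm e2 = 1 \<and> e1 \<bullet> e2 = 0 \<and>
       (\<forall>s::real. (\<phi> has_real_derivative \<phi>' s) (at s)) \<and>
       (\<forall>s. (\<phi>' has_real_derivative \<phi>'' s) (at s)) \<and> continuous_on UNIV \<phi>'' \<and>
       \<Omega> \<inter> ball x r = {y \<in> ball x r. \<phi> ((y - x) \<bullet> e1) < (y - x) \<bullet> e2})"

definition disk_conditions :: "(real^2) set \<Rightarrow> real \<Rightarrow> bool" where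
  "disk_conditions \<Omega> \<rho> \<longleftrightarrow>
    (\<forall>x\<in>frontier \<Omega>. \<exists>!c. case c of (x_int, x_ext) \<Rightarrow>
       ball x_int \<rho> \<subseteq> \<Omega> \<and> ball x_ext \<rho> \<subseteq> - \<Omega> \<and>
       sphere x_int \<rho> \<inter> frontier \<Omega> \<inter> sphere x_ext \<rho> = {x})"

text \<open>For open \<open>S\<close>: \<open>u\<close> is of class \<open>C\<^sup>2\<close> on \<open>S\<close> with gradient \<open>g\<close> and Hessian \<open>H\<close>, and
  its Laplacian, the trace of \<open>H\<close>, vanishes.\<close>

definition harmonic_on :: "(real^2) set \<Rightarrow> (real^2 \<Rightarrow> real) \<Rightarrow> bool" where
  "harmonic_on S u \<longleftrightarrow>
    (\<exists>g H. (\<forall>x\<in>S. GDERIV u x :> g x) \<and>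
           (\<forall>x\<in>S. (g has_derivative H x) (at x)) \<and>
           (\<forall>v. continuous_on S (\<lambda>x. H x v)) \<and>
           (\<forall>x\<in>S. (\<Sum>b\<in>Basis. H x b \<bullet> b) = 0))"

text \<open>The function \<open>k\<^sub>\<Omega>\<close>, determined by this predicate on \<open>closure \<Omega> \<times> \<Omega>\<close>
  when \<open>\<Omega>\<close> is open and bounded; its values elsewhere are irrelevant.\<close>

definition is_regular_part :: "(real^2) set \<Rightarrow> (real^2 \<Rightarrow> real^2 \<Rightarrow> real) \<Rightarrow> bool" where
  "is_regular_part \<Omega> k \<longleftrightarrow>
    (\<forall>y\<in>\<Omega>. harmonic_on \<Omega> (\<lambda>x. k x y) \<and> continuous_on (closure \<Omega>) (\<lambda>x. k x y) \<and>
       (\<forall>x\<in>frontier \<Omega>. k x y = 1 / (2 * pi) * ln (norm (x - y))))"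

text \<open>Configurations are functions on all of \<open>nat\<close>, of which only the values at \<open>1, \<dots>, n\<close> are used.\<close>

definition energy ::
    "(real^2 \<Rightarrow> real^2 \<Rightarrow> real) \<Rightarrow> nat \<Rightarrow> (nat \<Rightarrow> real) \<Rightarrow> (nat \<Rightarrow> real^2) \<Rightarrow> real" where
  "energy k n b z =
     (\<Sum>(i, j) | i \<in> {1..n} \<and> j \<in> {1..n} \<and> i < j.
        b i * b j * (k (z i) (z j) - 1 / (2 * pi) * ln (norm (z i - z j)))) +
     1 / 2 * (\<Sum>i\<in>{1..n}. (b i)\<^sup>2 * k (z i) (z i))"

text \<open>The evolution is defined on \<open>[0, T]\<close>: \<open>D\<close> is the gradient of the energy with respect to the
  \<open>i\<close>-th position, and the time derivative is one-sided at 0.\<close>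

definition evolution_on ::
    "(real^2 \<Rightarrow> real^2 \<Rightarrow> real) \<Rightarrow> nat \<Rightarrow> (nat \<Rightarrow> real) \<Rightarrow> real \<Rightarrow> (real \<Rightarrow> nat \<Rightarrow> real^2) \<Rightarrow> bool" where
  "evolution_on k n b T z \<longleftrightarrow>
     (\<forall>i\<in>{1..n}. continuous_on {0..T} (\<lambda>t. z t i)) \<and>
     (\<forall>t\<in>{0..<T}. inj_on (z t) {1..n} \<and>
        (\<forall>i\<in>{1..n}. \<exists>D. GDERIV (\<lambda>p. energy k n b ((z t)(i := p))) (z t i) :> D \<and>
           ((\<lambda>s. z s i) has_vector_derivative (- D)) (at t within {0..<T})))"

definition boundary_collision ::
    "(real^2) set \<Rightarrow> (real^2 \<Rightarrow> real^2 \<Rightarrow> real) \<Rightarrow> nat \<Rightarrow> (nat \<Rightarrow> real) \<Rightarrow> (nat \<Rightarrow> real^2) \<Rightarrow> real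
      \<Rightarrow> (real \<Rightarrow> nat \<Rightarrow> real^2) \<Rightarrow> bool" where
  "boundary_collision \<Omega> k n b z0 T z \<longleftrightarrow>
     evolution_on k n b T z \<and> (\<forall>i\<in>{1..n}. z 0 i = z0 i) \<and>
     (\<forall>t\<in>{0..<T}. \<forall>i\<in>{1..n}. z t i \<in> \<Omega>) \<and>
     z T 1 \<in> frontier \<Omega> \<and> (\<forall>i\<in>{2..n}. z T i \<in> \<Omega>)"

text \<open>The distance \<open>d\<^sub>m\<close> of the \<open>m = card I\<close> points \<open>x\<^sub>i\<close>, \<open>i \<in> I\<close>, for finite nonempty \<open>I\<close>;
  for \<open>m = 1\<close> there are no pairs and this is the distance to the boundary.\<close>

definition min_dist :: "(real^2) set \<Rightarrow> nat set \<Rightarrow> (nat \<Rightarrow> real^2) \<Rightarrow> real" where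
  "min_dist \<Omega> I x =
     Min ((\<lambda>i. infdist (x i) (frontier \<Omega>)) ` I \<union>
          {dist (x i) (x j) |i j. i \<in> I \<and> j \<in> I \<and> i \<noteq> j})"

definition near_boundary ::
    "(real^2) set \<Rightarrow> nat \<Rightarrow> real \<Rightarrow> real \<Rightarrow> (nat \<Rightarrow> real^2) set" where
  "near_boundary \<Omega> n \<delta> \<gamma> =
     {z. (\<forall>i\<in>{1..n}. z i \<in> \<Omega>) \<and> min_dist \<Omega> {1} z < \<delta> \<and>
         (n \<ge> 2 \<longrightarrow> min_dist \<Omega> {2..n} z > \<gamma>)}"

end

theory Submission
  imports Defs
begin

text \<open>The boundary condition creates an image dislocation: for \<open>y\<close> near the boundary, with nearest
  boundary point \<open>p\<close>, the function \<open>k(\<cdot>, y)\<close> is within \<open>O(dist y p)\<close> of the logarithmic potential of the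
  mirror image \<open>2p - y\<close>. This is the maximum principle, the boundary values being compared by means
  of the two disks touching at \<open>p\<close>. Interior gradient bounds turn it into
  \<open>\<nabla>h(y) = (y - p) / (2 \<pi> |y - p|\<^sup>2) + O(1)\<close>, while all other forces on \<open>z\<^sub>1\<close> stay bounded, since
  the Green function vanishes on the boundary. Hence the distance \<open>d\<close> of \<open>z\<^sub>1\<close> from the boundary
  satisfies \<open>d' \<le> - 1 / (4 \<pi> d) + O(1)\<close>, so that it vanishes within time \<open>2 \<pi> d(0)\<^sup>2 + O(d(0)\<^sup>3)\<close>,
  before the other dislocations have moved appreciably. In the rescaled time \<open>ds = dt / d\<close> the vector field is
  bounded up to the boundary, and a Peano type argument yields the whole trajectory at once.

  Harmonicity is used only through the five-point stencil. The advantage of this weak notion of the Laplacian is that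
  \<open>k(x, \<cdot>)\<close> inherits it from the boundary data by the maximum principle in \<open>x\<close>; this gives the
  symmetry of \<open>k\<close>.\<close>

section \<open>Harmonic functions and the maximum principle\<close>

text \<open>The hypotheses control \<open>k\<close> only in its first argument, with the second one
  frozen, whereas the energy differentiates it in both arguments and along the diagonal. Symmetry
  and joint continuity of the gradient therefore come first, and everything about the second
  argument is read off from the boundary data ln |q - y|. The number 1 / (4 \<pi>) arises because
  the energy carries h / 2, whose gradient is that of \<open>k\<close> in one argument, and because
  the image lies at distance 2d from y. The distance to the boundary is never differentiated: at
  each time the distance to one fixed nearest boundary point dominates it, with equality at that
  time. In rescaled time every dislocation has speed at most 1 and the collision occurs before 8
  \<pi> \<delta>. Displacements are thus bounded by durations, and a \<delta> small against \<gamma>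
  keeps the others in place. Only continuity of the field is established, hence Peano instead of
  Picard. The bound B on the regular forces is fixed before \<delta>, the moduli and the datum,
  which makes the final constant uniform.\<close>

definition stencil :: "(real^2 \<Rightarrow> real) \<Rightarrow> real^2 \<Rightarrow> real \<Rightarrow> real" where
  "stencil u x h = (\<Sum>i\<in>UNIV. u (x + h *\<^sub>R axis i 1) + u (x - h *\<^sub>R axis i 1) - 2 * u x)"

definition has_laplacian :: "(real^2 \<Rightarrow> real) \<Rightarrow> real^2 \<Rightarrow> real \<Rightarrow> bool" where
  "has_laplacian u x l \<longleftrightarrow> ((\<lambda>h. stencil u x h / h\<^sup>2) \<longlongrightarrow> l) (at_right 0)"

lemma stencil_add: "stencil (\<lambda>x. u x + v x) x h = stencil u x h + stencil v x h"
  by (simp add: stencil_def sum.distrib[symmetric] sum_subtractf[symmetric] algebra_simps)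

lemma stencil_cmult: "stencil (\<lambda>x. c * u x) x h = c * stencil u x h"
  by (simp add: stencil_def sum_distrib_left algebra_simps)

lemma has_laplacian_add:
  "has_laplacian u x a \<Longrightarrow> has_laplacian v x b \<Longrightarrow> has_laplacian (\<lambda>x. u x + v x) x (a + b)"
  unfolding has_laplacian_def by (simp add: stencil_add add_divide_distrib tendsto_add)

lemma has_laplacian_cmult: "has_laplacian u x a \<Longrightarrow> has_laplacian (\<lambda>x. c * u x) x (c * a)"
  unfolding has_laplacian_def
  by (simp add: stencil_cmult times_divide_eq_right[symmetric] tendsto_mult_left
      del: times_divide_eq_right)

lemma has_laplacian_uminus: "has_laplacian u x a \<Longrightarrow> has_laplacian (\<lambda>x. - u x) x (- a)"
  using has_laplacian_cmult[of u x a "-1"] by simp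

lemma has_laplacian_diff:
  "has_laplacian u x a \<Longrightarrow> has_laplacian v x b \<Longrightarrow> has_laplacian (\<lambda>x. u x - v x) x (a - b)"
  using has_laplacian_add[OF _ has_laplacian_uminus, of u x a v b] by simp

lemma norm_power2_vec2: "(norm (x::real^2))\<^sup>2 = (x$1)\<^sup>2 + (x$2)\<^sup>2"
  by (simp add: norm_vec_def L2_set_def sum_2 UNIV_2)

text \<open>The stencil is exact on quadratics. This one serves as the strictly subharmonic
  perturbation in the maximum principle.\<close>

lemma has_laplacian_norm_power2: "has_laplacian (\<lambda>x. (norm x)\<^sup>2) x 4"
proof -
  have "stencil (\<lambda>x. (norm x)\<^sup>2) x h = 4 * h\<^sup>2" for h
    by (simp add: stencil_def norm_power2_vec2 UNIV_2 axis_def) (simp add: power2_eq_square algebra_simps)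
  then have "eventually (\<lambda>h. 4 = stencil (\<lambda>x. (norm x)\<^sup>2) x h / h\<^sup>2) (at_right 0)"
    by (auto simp: eventually_at_right_field intro: exI[of _ 1])
  then show ?thesis
    unfolding has_laplacian_def by (rule Lim_transform_eventually[rotated]) simp
qed

text \<open>With \<open>m = x - y\<close> and \<open>c = |m|\<^sup>2\<close>, the product of the squared distances from \<open>y\<close> to the
  four neighbours of \<open>x\<close> is \<open>(c\<^sup>2 - h\<^sup>4)\<^sup>2 + 16 h\<^sup>4 m\<^sub>1\<^sup>2 m\<^sub>2\<^sup>2\<close>.\<close>

lemma stencil_ln_norm_bound:
  fixes x y :: "real^2" and h :: real
  assumes "x \<noteq> y" and h: "4 * \<bar>h\<bar> \<le> norm (x - y)"
  shows "\<bar>stencil (\<lambda>x. ln (norm (x - y))) x h\<bar> \<le> 7 * h ^ 4 / norm (x - y) ^ 4"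
proof -
  define m c where "m = x - y" and "c = (norm (x - y))\<^sup>2"
  have c: "c = (m$1)\<^sup>2 + (m$2)\<^sup>2"
    by (simp add: c_def m_def norm_power2_vec2)
  have "c > 0"
    using assms by (simp add: c_def)
  have "16 * h\<^sup>2 \<le> c"
    using power_mono[OF h, of 2] by (simp add: c_def power_mult_distrib)
  define q where "q a i = (norm (m + a *\<^sub>R axis i 1))\<^sup>2" for a :: real and i :: 2
  have pos: "norm (m + a *\<^sub>R axis i 1) > 0" if "\<bar>a\<bar> = \<bar>h\<bar>" for a i
  proof -
    have "norm m \<le> norm (m + a *\<^sub>R axis i 1) + \<bar>a\<bar>"
      using norm_triangle_ineq4[of "m + a *\<^sub>R axis i 1" "a *\<^sub>R axis i 1"]
      by (simp add: norm_axis_1)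
    moreover have "norm m > 0" using assms by (simp add: m_def)
    ultimately show ?thesis using h that unfolding m_def by linarith
  qed
  have q: "q a 1 = c + 2 * a * m$1 + a\<^sup>2" "q a 2 = c + 2 * a * m$2 + a\<^sup>2" for a
    unfolding q_def norm_power2_vec2 c by (simp_all add: axis_def power2_eq_square algebra_simps)
  have qpos: "q h i > 0" "q (-h) i > 0" for i
    using pos[of h i] pos[of "-h" i] by (auto simp: q_def)
  have lnq: "ln (norm (m + a *\<^sub>R axis i 1)) = ln (q a i) / 2" if "\<bar>a\<bar> = \<bar>h\<bar>" for a i
    unfolding q_def using pos[OF that] by (simp add: ln_realpow)
  \<comment> \<open>The stencil becomes the logarithm of a single ratio, so the cancellation of the
    terms below order four happens algebraically in the product.\<close>
  have eq: "stencil (\<lambda>x. ln (norm (x - y))) x h = ln (q h 1 * q (-h) 1 * q h 2 * q (-h) 2 / c ^ 4) / 2"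
  proof -
    have a: "x + h *\<^sub>R axis i 1 - y = m + h *\<^sub>R axis i 1" "x - h *\<^sub>R axis i 1 - y = m + (-h) *\<^sub>R axis i 1" for i
      by (simp_all add: m_def)
    have lc: "ln (norm (x - y)) = ln c / 2"
      using assms by (simp add: c_def ln_realpow)
    have "ln (q h 1 * q (-h) 1 * q h 2 * q (-h) 2 / c ^ 4)
        = ln (q h 1) + ln (q (-h) 1) + ln (q h 2) + ln (q (-h) 2) - 4 * ln c"
      using qpos[of 1] qpos[of 2] \<open>c > 0\<close>
      by (simp add: ln_div ln_mult ln_realpow less_imp_neq[THEN not_sym])
    then show ?thesis
      unfolding stencil_def a lc UNIV_2 by (simp add: lnq[of h] lnq[of "-h", simplified])
  qed
  define P where "P = (c\<^sup>2 - h^4)\<^sup>2 + 16 * h^4 * (m$1)\<^sup>2 * (m$2)\<^sup>2"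
  have P: "q h 1 * q (-h) 1 * q h 2 * q (-h) 2 = P"
    unfolding q P_def c by algebra
  \<comment> \<open>Arithmetic-geometric mean for the squared coordinates; it gives t \<le> 4
    below.\<close>
  have m: "4 * ((m$1)\<^sup>2 * (m$2)\<^sup>2) \<le> c\<^sup>2"
  proof -
    have "c\<^sup>2 - 4 * ((m$1)\<^sup>2 * (m$2)\<^sup>2) = ((m$1)\<^sup>2 - (m$2)\<^sup>2)\<^sup>2"
      unfolding c by algebra
    then show ?thesis by (metis diff_ge_0_iff_ge zero_le_power2)
  qed
  define e where "e = h^4 / c\<^sup>2"
  have "h^4 \<le> c\<^sup>2 / 256"
    using power_mono[OF \<open>16 * h\<^sup>2 \<le> c\<close>, of 2] by (simp add: power_mult_distrib flip: power_mult)
  then have e: "0 \<le> e" "e \<le> 1/256"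
    using \<open>c > 0\<close> by (auto simp: e_def field_simps)
  define t where "t = 16 * ((m$1)\<^sup>2 * (m$2)\<^sup>2) / c\<^sup>2"
  have t: "0 \<le> t" "t \<le> 4"
    using m \<open>c > 0\<close> by (auto simp: t_def field_simps)
  have Pe: "P / c^4 = 1 + (- 2 * e + e\<^sup>2 + t * e)"
    using \<open>c > 0\<close> unfolding P_def e_def t_def by (simp add: field_simps) algebra
  define d where "d = - 2 * e + e\<^sup>2 + t * e"
  have te: "0 \<le> t * e" "t * e \<le> 4 * e"
    using t e by (auto intro: mult_right_mono)
  have e2: "0 \<le> e\<^sup>2" "e\<^sup>2 \<le> e"
    using e by (auto simp: power2_eq_square intro: mult_left_le)
  have d: "\<bar>d\<bar> \<le> 3 * e"
    unfolding d_def using te e2 by linarith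
  \<comment> \<open>For |d| \<le> 1/2 the error |ln (1 + d) - d| is at most 2 d^2 \<le> |d|. After
    halving this leaves 3e, rounded up to 7e.\<close>
  have "\<bar>ln (1 + d)\<bar> \<le> 2 * \<bar>d\<bar>"
    using d e abs_ln_one_plus_x_minus_x_bound[of d]
      mult_right_mono[of "\<bar>d\<bar>" "1/2" "\<bar>d\<bar>"] by (simp add: power2_eq_square)
  then have "\<bar>ln (1 + d) / 2\<bar> \<le> 7 * e"
    using d e by simp
  moreover have "e = h ^ 4 / norm (x - y) ^ 4"
    by (simp add: e_def c_def)
  ultimately show ?thesis
    unfolding eq P Pe d_def by simp
qed

text \<open>Division by h^2 leaves O(h^2). Such a quantitative bound, unlike a bare limit, can be
  carried through the maximum principle in another variable.\<close>

lemma has_laplacian_zeroI: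
  assumes "d > 0" and "\<And>h. 0 < h \<Longrightarrow> h < d \<Longrightarrow> \<bar>stencil u x h\<bar> \<le> C * h ^ 4"
  shows "has_laplacian u x 0"
  unfolding has_laplacian_def
proof (rule tendsto_rabs_zero_cancel, rule tendsto_sandwich[where f = "\<lambda>_. 0" and h = "\<lambda>h. C * h\<^sup>2"])
  show "\<forall>\<^sub>F h in at_right 0. \<bar>stencil u x h / h\<^sup>2\<bar> \<le> C * h\<^sup>2"
    unfolding eventually_at_right_field
  proof (intro exI[of _ d] conjI allI impI)
    fix h :: real assume h: "0 < h" "h < d"
    show "\<bar>stencil u x h / h\<^sup>2\<bar> \<le> C * h\<^sup>2"
    proof -
      have "\<bar>stencil u x h / h\<^sup>2\<bar> \<le> C * h ^ 4 / h\<^sup>2"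
        using divide_right_mono[OF assms(2)[OF h], of "h\<^sup>2"] by (simp add: abs_divide)
      also have "\<dots> = C * h\<^sup>2"
        using h(1) by (simp add: power2_eq_square power4_eq_xxxx)
      finally show ?thesis .
    qed
  qed (use \<open>d > 0\<close> in simp)
  have "((\<lambda>h. C * h\<^sup>2) \<longlongrightarrow> C * 0\<^sup>2) (at_right 0)"
    by (intro tendsto_intros)
  then show "((\<lambda>h. C * h\<^sup>2) \<longlongrightarrow> 0) (at_right 0)" by simp
qed auto

lemma has_laplacian_ln_norm:
  assumes "x \<noteq> y" shows "has_laplacian (\<lambda>x. ln (norm (x - y))) x 0"
proof (rule has_laplacian_zeroI)
  show "norm (x - y) / 4 > 0" using assms by simp
  show "\<bar>stencil (\<lambda>x. ln (norm (x - y))) x h\<bar> \<le> (7 / norm (x - y) ^ 4) * h ^ 4"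
    if "0 < h" "h < norm (x - y) / 4" for h
    using stencil_ln_norm_bound[OF assms, of h] that by simp
qed

text \<open>One step of l'Hopital turns the quotient into the symmetric difference quotient of
  \<open>p\<close> at 0. A second step would ask for a derivative of \<open>p\<close> near
  0.\<close>

lemma second_difference_tendsto:
  fixes f p :: "real \<Rightarrow> real"
  assumes f: "\<forall>\<^sub>F t in nhds 0. (f has_real_derivative p t) (at t)"
    and p: "(p has_real_derivative A) (at 0)"
  shows "((\<lambda>h. (f h + f (- h) - 2 * f 0) / h\<^sup>2) \<longlongrightarrow> A) (at_right 0)"
proof (rule lhopital_right_0)
  have f0: "isCont f 0"
    using eventually_nhds_x_imp_x[OF f] DERIV_isCont by blast
  then have "((\<lambda>h. f h + f (- h) - 2 * f 0) \<longlongrightarrow> f 0 + f (- 0) - 2 * f 0) (at 0)"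
    by (intro tendsto_intros isCont_tendsto_compose[of _ f]) (auto intro!: tendsto_eq_intros simp: isCont_def)
  then show "((\<lambda>h. f h + f (- h) - 2 * f 0) \<longlongrightarrow> 0) (at_right 0)"
    by (simp add: filterlim_at_split)
  show "((\<lambda>h::real. h\<^sup>2) \<longlongrightarrow> 0) (at_right 0)"
    by (auto intro!: tendsto_eq_intros)
  obtain d where "d > 0" and d: "\<And>t. \<bar>t\<bar> < d \<Longrightarrow> (f has_real_derivative p t) (at t)"
    using f by (auto simp: eventually_nhds_metric dist_real_def)
  show "\<forall>\<^sub>F h in at_right 0. ((\<lambda>h. f h + f (- h) - 2 * f 0) has_real_derivative (p h - p (- h))) (at h)"
    unfolding eventually_at_right_field
  proof (intro exI[of _ d] conjI allI impI)
    fix h :: real assume h: "0 < h" "h < d"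
    have "((\<lambda>h. f (- h)) has_real_derivative p (- h) * (-1)) (at h)"
      by (rule DERIV_chain2[OF d]) (use h in \<open>auto intro!: derivative_eq_intros\<close>)
    then show "((\<lambda>h. f h + f (- h) - 2 * f 0) has_real_derivative (p h - p (- h))) (at h)"
      using d[of h] h by (auto intro!: derivative_eq_intros)
  qed (use \<open>d > 0\<close> in simp)
  show "\<forall>\<^sub>F h in at_right 0. ((\<lambda>h::real. h\<^sup>2) has_real_derivative 2 * h) (at h)"
    by (auto intro!: always_eventually derivative_eq_intros)
  have "((\<lambda>h. p h - p (- h)) has_real_derivative A - A * (-1)) (at 0)"
  proof (rule DERIV_diff[OF p])
    show "((\<lambda>h. p (- h)) has_real_derivative A * (-1)) (at 0)"
      by (rule DERIV_chain2[of p]) (use p in \<open>auto intro!: derivative_eq_intros\<close>)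
  qed
  then have "((\<lambda>h. (p h - p (- h)) / h) \<longlongrightarrow> 2 * A) (at 0)"
    by (simp add: has_field_derivative_iff)
  then have "((\<lambda>h. (p h - p (- h)) / h) \<longlongrightarrow> 2 * A) (at_right 0)"
    by (simp add: filterlim_at_split)
  then have "((\<lambda>h. (p h - p (- h)) / h / 2) \<longlongrightarrow> 2 * A / 2) (at_right 0)"
    by (intro tendsto_intros) auto
  then show "((\<lambda>h. (p h - p (- h)) / (2 * h)) \<longlongrightarrow> A) (at_right 0)"
    by (simp add: field_simps)
qed (auto simp: eventually_at_right_field intro: exI[of _ 1])

lemma harmonic_on_has_laplacian:
  assumes "open S" and "harmonic_on S u" and "x \<in> S"
  shows "has_laplacian u x 0"
proof -
  obtain g H where g: "\<And>x. x \<in> S \<Longrightarrow> GDERIV u x :> g x"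
    and H: "\<And>x. x \<in> S \<Longrightarrow> (g has_derivative H x) (at x)"
    and tr: "(\<Sum>b\<in>Basis. H x b \<bullet> b) = 0"
  proof -
    obtain g H where "\<forall>x\<in>S. GDERIV u x :> g x" "\<forall>x\<in>S. (g has_derivative H x) (at x)"
      "\<forall>x\<in>S. (\<Sum>b\<in>Basis. H x b \<bullet> b) = 0"
      using assms unfolding harmonic_on_def by blast
    then show ?thesis using that[of g H] \<open>x \<in> S\<close> by blast
  qed
  have ev: "\<forall>\<^sub>F t in nhds 0. x + t *\<^sub>R axis i 1 \<in> S" for i
  proof -
    have "((\<lambda>t. x + t *\<^sub>R axis i (1::real)) \<longlongrightarrow> x + 0 *\<^sub>R axis i 1) (nhds 0)"
      by (intro tendsto_intros filterlim_ident)
    then show ?thesis using topological_tendstoD[OF _ \<open>open S\<close>] \<open>x \<in> S\<close> by fastforce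
  qed
  have 1: "((\<lambda>h. (u (x + h *\<^sub>R axis i 1) + u (x + (- h) *\<^sub>R axis i 1) - 2 * u (x + 0 *\<^sub>R axis i 1)) / h\<^sup>2)
       \<longlongrightarrow> H x (axis i 1) \<bullet> axis i 1) (at_right 0)" for i
  proof (rule second_difference_tendsto[where p = "\<lambda>t. g (x + t *\<^sub>R axis i 1) \<bullet> axis i 1"])
    show "\<forall>\<^sub>F t in nhds 0. ((\<lambda>t. u (x + t *\<^sub>R axis i 1)) has_real_derivative
            g (x + t *\<^sub>R axis i 1) \<bullet> axis i 1) (at t)"
      using ev[of i]
    proof eventually_elim
      case (elim t)
      have "((\<lambda>t. x + t *\<^sub>R axis i (1::real)) has_derivative (\<lambda>t. t *\<^sub>R axis i 1)) (at t)"
        by (auto intro!: derivative_eq_intros)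
      from has_derivative_compose[OF this g[OF elim, unfolded gderiv_def]]
      show ?case
        unfolding has_field_derivative_def
        by (rule has_derivative_eq_rhs) (simp add: fun_eq_iff inner_commute[of "axis i 1"])
    qed
    have x: "x + 0 *\<^sub>R axis i 1 \<in> S" using \<open>x \<in> S\<close> by simp
    have "((\<lambda>t. x + t *\<^sub>R axis i (1::real)) has_derivative (\<lambda>t. t *\<^sub>R axis i 1)) (at 0)"
      by (auto intro!: derivative_eq_intros)
    from has_derivative_inner_left[OF has_derivative_compose[OF this H[OF x]], of "axis i 1"]
    show "((\<lambda>t. g (x + t *\<^sub>R axis i 1) \<bullet> axis i 1) has_real_derivative H x (axis i 1) \<bullet> axis i 1) (at 0)"
      unfolding has_field_derivative_def
      by (rule has_derivative_eq_rhs)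
        (simp add: fun_eq_iff linear_cmul[OF has_derivative_linear[OF H[OF \<open>x \<in> S\<close>]]])
  qed
  have "((\<lambda>h. \<Sum>i\<in>UNIV. (u (x + h *\<^sub>R axis i 1) + u (x + (- h) *\<^sub>R axis i 1) - 2 * u (x + 0 *\<^sub>R axis i 1)) / h\<^sup>2)
       \<longlongrightarrow> (\<Sum>i\<in>UNIV. H x (axis i 1) \<bullet> axis i 1)) (at_right 0)"
    by (intro tendsto_sum 1)
  moreover have "(\<Sum>i\<in>UNIV. H x (axis i 1) \<bullet> axis i 1) = 0"
    using tr by (simp add: Basis_vec_def UNION_singleton_eq_range sum.reindex inj_on_def axis_eq_axis)
  ultimately show ?thesis
    unfolding has_laplacian_def stencil_def by (simp add: sum_divide_distrib)
qed

section \<open>Maximum principle\<close>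

lemma has_laplacian_at_max:
  assumes "has_laplacian f x l" and "open S" and "x \<in> S" and max: "\<And>y. y \<in> S \<Longrightarrow> f y \<le> f x"
  shows "l \<le> 0"
proof -
  obtain e where "e > 0" and e: "ball x e \<subseteq> S"
    using assms(2,3) openE by blast
  have "\<forall>\<^sub>F h in at_right 0. stencil f x h / h\<^sup>2 \<le> 0"
    unfolding eventually_at_right_field
  proof (intro exI[of _ e] conjI allI impI)
    fix h :: real assume h: "0 < h" "h < e"
    have "f (x + h *\<^sub>R axis i 1) \<le> f x" "f (x - h *\<^sub>R axis i 1) \<le> f x" for i
      by (intro max subsetD[OF e]; use h in \<open>simp add: dist_norm norm_axis_1\<close>)+
    then have "stencil f x h \<le> 0"
      unfolding stencil_def by (intro sum_nonpos) (smt (verit))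
    then show "stencil f x h / h\<^sup>2 \<le> 0"
      by (simp add: divide_nonpos_nonneg)
  qed fact
  then show ?thesis
    using assms(1) unfolding has_laplacian_def by (intro tendsto_upperbound) auto
qed

lemma infdist_frontier_pos:
  fixes S :: "(real^2) set"
  assumes "open S" and "bounded S" and "x \<in> S"
  shows "infdist x (frontier S) > 0" and "frontier S \<noteq> {}"
proof -
  show ne: "frontier S \<noteq> {}"
    using assms frontier_eq_empty[of S] not_bounded_UNIV[where 'a = "real^2"] by auto
  have "x \<notin> frontier S"
    using assms by (simp add: frontier_def interior_open)
  then show "infdist x (frontier S) > 0"
    using in_closed_iff_infdist_zero[OF frontier_closed ne] infdist_nonneg[of x]
    by (metis less_eq_real_def)
qed

text \<open>Adding a small multiple of |y|^2 makes the Laplacian positive, which an interior maximum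
  forbids. The boundary condition is an upper limit at the frontier, because the function
  \<open>k x\<close> is controlled only inside the domain when the symmetry of \<open>k\<close> is
  proved.\<close>

lemma maximum_principle:
  fixes S :: "(real^2) set" and f :: "real^2 \<Rightarrow> real" and c :: real
  assumes "open S" and "bounded S" and cont: "continuous_on S f"
    and lap: "\<And>x. x \<in> S \<Longrightarrow> has_laplacian f x 0"
    and bdry: "\<And>e. e > 0 \<Longrightarrow> \<exists>d>0. \<forall>x\<in>S. infdist x (frontier S) < d \<longrightarrow> f x \<le> c + e"
    and "x \<in> S"
  shows "f x \<le> c"
proof (rule ccontr)
  assume "\<not> f x \<le> c"
  \<comment> \<open>The quadratic term costs at most e, so near the frontier the perturbed function
    is at most c + 2e, below its value at x, which is at least c + 3e.\<close>
  define e where "e = (f x - c) / 3"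
  have "e > 0" using \<open>\<not> f x \<le> c\<close> by (simp add: e_def)
  have fx: "f x = c + 3 * e" unfolding e_def by (simp add: field_simps)
  obtain d where "d > 0" and d: "\<And>y. y \<in> S \<Longrightarrow> infdist y (frontier S) < d \<Longrightarrow> f y \<le> c + e"
    using bdry[OF \<open>e > 0\<close>] by blast
  obtain R where "R > 0" and R: "\<And>y. y \<in> S \<Longrightarrow> norm y \<le> R"
    using \<open>bounded S\<close> bounded_pos by blast
  define q where "q y = f y + (e / R\<^sup>2) * (norm y)\<^sup>2" for y
  have q: "f y \<le> q y" "q y \<le> f y + e" if "y \<in> S" for y
  proof -
    have "(norm y)\<^sup>2 \<le> R\<^sup>2" using R[OF that] by (simp add: power_mono)
    then show "f y \<le> q y" "q y \<le> f y + e"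
      using \<open>e > 0\<close> \<open>R > 0\<close> by (auto simp: q_def field_simps)
  qed
  \<comment> \<open>A compact part of S containing x; a maximum over it is a maximum over S, since
    elsewhere the perturbed function is below its value at x.\<close>
  define K where "K = closure S \<inter> {y. d \<le> infdist y (frontier S)}"
  have "K \<subseteq> S"
  proof
    fix y assume "y \<in> K"
    moreover have "y \<notin> frontier S"
      using \<open>y \<in> K\<close> \<open>d > 0\<close> by (auto simp: K_def)
    ultimately show "y \<in> S"
      using \<open>open S\<close> by (auto simp: K_def frontier_def interior_open)
  qed
  have "compact K"
    unfolding K_def
    by (intro compact_Int_closed closed_Collect_le continuous_intros) (simp add: \<open>bounded S\<close> compact_closure)
  have "x \<in> K"
  proof -
    have "f x > c + e"
      using \<open>e > 0\<close> unfolding fx by simp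
    then have "\<not> infdist x (frontier S) < d"
      using d[OF \<open>x \<in> S\<close>] by auto
    then show ?thesis
      using \<open>x \<in> S\<close> closure_subset by (auto simp: K_def)
  qed
  have "continuous_on K q"
    unfolding q_def by (intro continuous_intros continuous_on_subset[OF cont \<open>K \<subseteq> S\<close>])
  then obtain z where "z \<in> K" and z: "\<And>y. y \<in> K \<Longrightarrow> q y \<le> q z"
    using continuous_attains_sup[OF \<open>compact K\<close>] \<open>x \<in> K\<close> by blast
  have "q y \<le> q z" if "y \<in> S" for y
  proof (cases "y \<in> K")
    case False
    then have "infdist y (frontier S) < d"
      using that closure_subset by (auto simp: K_def)
    then have "q y \<le> c + 2 * e"
      using d[OF that] q[OF that] by linarith
    also have "\<dots> \<le> q x"
      using q(1)[OF \<open>x \<in> S\<close>] \<open>e > 0\<close> unfolding fx by simp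
    finally show ?thesis using z[OF \<open>x \<in> K\<close>] by simp
  qed (use z in simp)
  moreover have "has_laplacian q z (0 + (e / R\<^sup>2) * 4)"
    unfolding q_def using \<open>z \<in> K\<close> \<open>K \<subseteq> S\<close>
    by (intro has_laplacian_add has_laplacian_cmult has_laplacian_norm_power2 lap) auto
  ultimately have "(e / R\<^sup>2) * 4 \<le> 0"
    using has_laplacian_at_max[OF _ \<open>open S\<close>] \<open>z \<in> K\<close> \<open>K \<subseteq> S\<close> by fastforce
  then show False
    using \<open>e > 0\<close> \<open>R > 0\<close> by (simp add: field_simps)
qed

lemma uniformly_close_at_frontier:
  fixes S :: "(real^2) set" and f :: "real^2 \<Rightarrow> real"
  assumes "bounded S" and "continuous_on (closure S) f" and "e > 0"
  obtains d where "d > 0"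
    and "\<And>x p. x \<in> S \<Longrightarrow> p \<in> frontier S \<Longrightarrow> dist x p < d \<Longrightarrow> \<bar>f x - f p\<bar> < e"
proof -
  have "uniformly_continuous_on (closure S) f"
    using assms compact_uniformly_continuous compact_closure by blast
  then obtain d where "d > 0" and "\<forall>x\<in>closure S. \<forall>x'\<in>closure S. dist x' x < d \<longrightarrow> dist (f x') (f x) < e"
    using \<open>e > 0\<close> unfolding uniformly_continuous_on_def by metis
  then show ?thesis
    using that[of d] closure_subset[of S] unfolding frontier_def dist_real_def by blast
qed

lemma nearest_frontier_point:
  fixes S :: "(real^2) set"
  assumes "open S" and "bounded S" and "x \<in> S"
  obtains p where "p \<in> frontier S" and "dist x p = infdist x (frontier S)"
  using infdist_attains_inf[OF frontier_closed infdist_frontier_pos(2)[OF assms]] by metis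

lemma maximum_principle_closure:
  fixes S :: "(real^2) set" and f :: "real^2 \<Rightarrow> real" and c :: real
  assumes "open S" and "bounded S" and cont: "continuous_on (closure S) f"
    and lap: "\<And>x. x \<in> S \<Longrightarrow> has_laplacian f x 0"
    and bdry: "\<And>x. x \<in> frontier S \<Longrightarrow> f x \<le> c"
    and "x \<in> S"
  shows "f x \<le> c"
proof (rule maximum_principle[OF \<open>open S\<close> \<open>bounded S\<close> _ lap _ \<open>x \<in> S\<close>])
  show "continuous_on S f"
    using cont closure_subset continuous_on_subset by blast
  fix e :: real assume "e > 0"
  obtain d where "d > 0"
    and d: "\<And>x p. x \<in> S \<Longrightarrow> p \<in> frontier S \<Longrightarrow> dist x p < d \<Longrightarrow> \<bar>f x - f p\<bar> < e"
    using uniformly_close_at_frontier[OF \<open>bounded S\<close> cont \<open>e > 0\<close>] by metis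
  have "f x \<le> c + e" if "x \<in> S" "infdist x (frontier S) < d" for x
  proof -
    obtain p where "p \<in> frontier S" "dist x p = infdist x (frontier S)"
      using nearest_frontier_point[OF \<open>open S\<close> \<open>bounded S\<close> \<open>x \<in> S\<close>] by metis
    then show ?thesis
      using d[of x p] bdry[of p] that by (auto simp: abs_less_iff)
  qed
  then show "\<exists>d>0. \<forall>x\<in>S. infdist x (frontier S) < d \<longrightarrow> f x \<le> c + e"
    using \<open>d > 0\<close> by blast
qed auto

lemma maximum_principle_abs:
  fixes S :: "(real^2) set" and f :: "real^2 \<Rightarrow> real" and c :: real
  assumes "open S" and "bounded S" and cont: "continuous_on (closure S) f"
    and lap: "\<And>x. x \<in> S \<Longrightarrow> has_laplacian f x 0"
    and bdry: "\<And>x. x \<in> frontier S \<Longrightarrow> \<bar>f x\<bar> \<le> c"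
    and "x \<in> closure S"
  shows "\<bar>f x\<bar> \<le> c"
proof (cases "x \<in> S")
  case True
  have "f x \<le> c"
    by (rule maximum_principle_closure[OF assms(1-3) lap]) (use bdry True in \<open>auto simp: abs_le_iff\<close>)
  moreover have "- f x \<le> c"
    by (rule maximum_principle_closure[OF assms(1,2) continuous_on_minus[OF cont]])
      (use bdry True has_laplacian_uminus[OF lap] in \<open>auto simp: abs_le_iff\<close>)
  ultimately show ?thesis by simp
next
  case False
  then show ?thesis
    using assms by (auto simp: frontier_def interior_open)
qed


section \<open>Interior gradient bound for harmonic functions\<close>

lemma sum_UNIV_2: "i \<noteq> j \<Longrightarrow> (\<Sum>l\<in>UNIV. f l) = f i + f (j::2)"
  using exhaust_2[of i] exhaust_2[of j] by (auto simp: UNIV_2 add.commute)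

text \<open>The odd part of \<open>u\<close> in the \<open>i\<close>-th coordinate vanishes on the line through \<open>x\<close> orthogonal
  to the \<open>i\<close>-th axis and is compared on half of a square with a harmonic quadratic polynomial.\<close>

lemma harmonic_partial_derivative_bound:
  fixes u :: "real^2 \<Rightarrow> real"
  assumes "R > 0" and cont: "continuous_on (ball x R) u"
    and lap: "\<And>z. z \<in> ball x R \<Longrightarrow> has_laplacian u z 0"
    and bd: "\<And>z. z \<in> ball x R \<Longrightarrow> \<bar>u z\<bar> \<le> M"
    and deriv: "GDERIV u x :> g"
  shows "g $ i \<le> 4 * M / R"
proof -
  obtain j :: 2 where "i \<noteq> j"
    using exhaust_2[of i] by (metis one_neq_zero zero_neq_one)
  \<comment> \<open>The square of half-width r lies in the ball because 2 r^2 < R^2.\<close>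
  define r where "r = R / 2"
  have "r > 0" using \<open>R > 0\<close> by (simp add: r_def)
  have "M \<ge> 0" using bd[of x] \<open>R > 0\<close> by force
  define rf where "rf z = z - (2 * (z $ i - x $ i)) *\<^sub>R axis i 1" for z
  define v where "v z = u z - u (rf z)" for z
  \<comment> \<open>The barrier 2M (b^2 + 2a - a^2) in coordinates a, b scaled by r. It is harmonic,
    nonnegative on the side a = 0 where \<open>v\<close> vanishes, and at least 2M \<ge>
    \<open>v\<close> on the sides a = 1 and b = 1, -1.\<close>
  define \<beta> where "\<beta> z = 2 * M * (((z $ j - x $ j) / r)\<^sup>2 + ((z $ i - x $ i) / r) * (2 - (z $ i - x $ i) / r))" for z
  define S where "S = {z. 0 < z $ i - x $ i} \<inter> {z. z $ i - x $ i < r} \<inter>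
    ({z. - r < z $ j - x $ j} \<inter> {z. z $ j - x $ j < r})"
  define Sc where "Sc = {z. 0 \<le> z $ i - x $ i} \<inter> {z. z $ i - x $ i \<le> r} \<inter>
    ({z. - r \<le> z $ j - x $ j} \<inter> {z. z $ j - x $ j \<le> r})"
  have "open S"
    unfolding S_def by (intro open_Int open_Collect_less continuous_intros)
  have "closed Sc"
    unfolding Sc_def by (intro closed_Int closed_Collect_le continuous_intros)
  have clS: "closure S \<subseteq> Sc"
    by (rule closure_minimal[OF _ \<open>closed Sc\<close>]) (auto simp: S_def Sc_def)
  have nrm: "(norm (z::real^2))\<^sup>2 = (z$i)\<^sup>2 + (z$j)\<^sup>2" for z
    using sum_UNIV_2[OF \<open>i \<noteq> j\<close>, of "\<lambda>l. (z$l)\<^sup>2"]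
    by (simp add: norm_power2_vec2 UNIV_2)
  have Scb: "Sc \<subseteq> ball x R"
  proof
    fix z assume "z \<in> Sc"
    then have "\<bar>z $ i - x $ i\<bar> \<le> r" "\<bar>z $ j - x $ j\<bar> \<le> r"
      by (auto simp: Sc_def)
    then have "(z $ i - x $ i)\<^sup>2 \<le> r\<^sup>2" "(z $ j - x $ j)\<^sup>2 \<le> r\<^sup>2"
      by (auto simp: abs_le_square_iff[symmetric] \<open>r > 0\<close> less_imp_le)
    then have "(norm (z - x))\<^sup>2 \<le> 2 * r\<^sup>2"
      by (simp add: nrm)
    also have "\<dots> < R\<^sup>2"
      using \<open>R > 0\<close> by (simp add: r_def power2_eq_square)
    finally show "z \<in> ball x R"
      using \<open>R > 0\<close> by (simp add: dist_norm norm_minus_commute power_less_imp_less_base)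
  qed
  have rf_ball: "rf z \<in> ball x R" if "z \<in> ball x R" for z
  proof -
    have "(norm (rf z - x))\<^sup>2 = (norm (z - x))\<^sup>2"
      unfolding nrm using \<open>i \<noteq> j\<close> by (simp add: rf_def axis_def power2_eq_square algebra_simps)
    then show ?thesis
      using that by (simp add: dist_norm norm_minus_commute)
  qed
  have rf_shift: "rf (z + h *\<^sub>R axis i 1) = rf z - h *\<^sub>R axis i 1" "rf (z - h *\<^sub>R axis i 1) = rf z + h *\<^sub>R axis i 1"
    "rf (z + h *\<^sub>R axis j 1) = rf z + h *\<^sub>R axis j 1" "rf (z - h *\<^sub>R axis j 1) = rf z - h *\<^sub>R axis j 1" for z h
    using \<open>i \<noteq> j\<close> by (simp_all add: rf_def axis_def vec_eq_iff algebra_simps)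
  \<comment> \<open>The reflection merely exchanges the two neighbours in direction i.\<close>
  have "stencil (\<lambda>z. u (rf z)) z h = stencil u (rf z) h" for z h
    unfolding stencil_def sum_UNIV_2[OF \<open>i \<noteq> j\<close>] rf_shift by simp
  then have lap_rf: "has_laplacian (\<lambda>z. u (rf z)) z 0" if "z \<in> ball x R" for z
    using lap[OF rf_ball[OF that]] by (simp add: has_laplacian_def)
  have "stencil \<beta> z h = 0" for z h
    using \<open>i \<noteq> j\<close> \<open>r > 0\<close>
    by (simp add: stencil_def sum_UNIV_2[OF \<open>i \<noteq> j\<close>] \<beta>_def axis_def field_simps power2_eq_square)
  then have lap_\<beta>: "has_laplacian \<beta> z 0" for z
    by (simp add: has_laplacian_def)
  have cont_rf: "continuous_on A rf" for A
    unfolding rf_def by (intro continuous_intros)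
  have le: "v z - \<beta> z \<le> 0" if "z \<in> S" for z
  proof (rule maximum_principle_closure[OF \<open>open S\<close> _ _ _ _ that])
    show "bounded S"
      using bounded_subset[OF bounded_ball] clS Scb closure_subset by (metis subset_trans)
    have "continuous_on (ball x R) (\<lambda>z. v z - \<beta> z)"
      unfolding v_def \<beta>_def
      by (intro continuous_intros cont continuous_on_compose2[OF cont cont_rf])
        (use rf_ball \<open>r > 0\<close> in auto)
    then show "continuous_on (closure S) (\<lambda>z. v z - \<beta> z)"
      using continuous_on_subset clS Scb by blast
    show "has_laplacian (\<lambda>z. v z - \<beta> z) z 0" if "z \<in> S" for z
    proof -
      have "z \<in> ball x R" using that clS Scb closure_subset by blast
      then have "has_laplacian (\<lambda>z. v z - \<beta> z) z (0 - 0 - 0)"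
        unfolding v_def by (intro has_laplacian_diff lap lap_rf lap_\<beta>)
      then show ?thesis by simp
    qed
    fix z assume "z \<in> frontier S"
    then have z: "z \<in> Sc" "z \<notin> S"
      using clS \<open>open S\<close> by (auto simp: frontier_def interior_open)
    then have zb: "z \<in> ball x R" using Scb by blast
    then have v2: "v z \<le> 2 * M"
      unfolding v_def using bd[OF zb] bd[OF rf_ball[OF zb]] by linarith
    define a b where "a = (z $ i - x $ i) / r" and "b = (z $ j - x $ j) / r"
    have a: "0 \<le> a" "a \<le> 1"
      using z \<open>r > 0\<close> by (auto simp: Sc_def a_def field_simps)
    have \<beta>: "\<beta> z = 2 * M * (b\<^sup>2 + a * (2 - a))"
      by (simp add: \<beta>_def a_def b_def)
    have "a = 0 \<or> a = 1 \<or> b = 1 \<or> b = -1"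
      using z \<open>r > 0\<close> by (auto simp: Sc_def S_def a_def b_def field_simps)
    then consider "a = 0" | "b\<^sup>2 + a * (2 - a) \<ge> 1"
      using a by fastforce
    then show "v z - \<beta> z \<le> 0"
    proof cases
      case 1
      then have "rf z = z"
        using \<open>r > 0\<close> by (simp add: a_def rf_def)
      then show ?thesis
        using \<open>M \<ge> 0\<close> by (simp add: v_def \<beta> 1)
    next
      case 2
      then have "2 * M * 1 \<le> \<beta> z"
        unfolding \<beta> using \<open>M \<ge> 0\<close> by (intro mult_left_mono) auto
      then show ?thesis using v2 by simp
    qed
  qed
  \<comment> \<open>On the axis through x the barrier is at most 4 M t / r, while the slope of
    \<phi> at 0 is twice the partial derivative.\<close>
  define \<phi> where "\<phi> t = u (x + t *\<^sub>R axis i 1) - u (x - t *\<^sub>R axis i 1)" for t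
  have "\<phi> t / t \<le> 4 * M / r" if "0 < t" "t < r" for t
  proof -
    have "x + t *\<^sub>R axis i 1 \<in> S"
      using that \<open>i \<noteq> j\<close> by (simp add: S_def axis_def)
    moreover have "rf (x + t *\<^sub>R axis i 1) = x - t *\<^sub>R axis i 1"
      by (simp add: rf_def axis_def vec_eq_iff algebra_simps)
    moreover have "\<beta> (x + t *\<^sub>R axis i 1) = 2 * M * ((t / r) * (2 - t / r))"
      using \<open>i \<noteq> j\<close> by (simp add: \<beta>_def axis_def)
    ultimately have "\<phi> t \<le> 2 * M * ((t / r) * (2 - t / r))"
      using le[of "x + t *\<^sub>R axis i 1"] by (simp add: v_def \<phi>_def)
    also have "\<dots> \<le> 2 * M * ((t / r) * 2)"
      using \<open>M \<ge> 0\<close> that \<open>r > 0\<close> by (intro mult_left_mono) auto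
    finally show ?thesis
      using that by (simp add: field_simps)
  qed
  then have ev: "\<forall>\<^sub>F t in at_right 0. \<phi> t / t \<le> 4 * M / r"
    using \<open>r > 0\<close> by (auto simp: eventually_at_right_field)
  have "((\<lambda>t. u (x + t *\<^sub>R axis i 1)) has_derivative (\<lambda>t. t * g $ i)) (at 0)"
    "((\<lambda>t. u (x - t *\<^sub>R axis i 1)) has_derivative (\<lambda>t. - t * g $ i)) (at 0)"
  proof -
    have d: "((\<lambda>t. x + t *\<^sub>R axis i (1::real)) has_derivative (\<lambda>t. t *\<^sub>R axis i 1)) (at 0)"
      "((\<lambda>t. x - t *\<^sub>R axis i (1::real)) has_derivative (\<lambda>t. - t *\<^sub>R axis i 1)) (at 0)"
      by (auto intro!: derivative_eq_intros)
    have "(u has_derivative (\<lambda>h. h \<bullet> g)) (at (x + 0 *\<^sub>R axis i 1))"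
      "(u has_derivative (\<lambda>h. h \<bullet> g)) (at (x - 0 *\<^sub>R axis i 1))"
      using deriv by (simp_all add: gderiv_def)
    from has_derivative_compose[OF d(1) this(1)] has_derivative_compose[OF d(2) this(2)]
    show "((\<lambda>t. u (x + t *\<^sub>R axis i 1)) has_derivative (\<lambda>t. t * g $ i)) (at 0)"
      "((\<lambda>t. u (x - t *\<^sub>R axis i 1)) has_derivative (\<lambda>t. - t * g $ i)) (at 0)"
      by (simp_all add: inner_axis')
  qed
  from has_derivative_diff[OF this]
  have "(\<phi> has_real_derivative 2 * g $ i) (at 0)"
    unfolding has_field_derivative_def \<phi>_def
    by (rule has_derivative_eq_rhs) (simp add: algebra_simps fun_eq_iff)
  then have "((\<lambda>t. \<phi> t / t) \<longlongrightarrow> 2 * g $ i) (at_right 0)"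
    by (simp add: has_field_derivative_iff \<phi>_def filterlim_at_split)
  then have "2 * g $ i \<le> 4 * M / r"
    using ev by (intro tendsto_upperbound) auto
  then show ?thesis by (simp add: r_def)
qed

text \<open>Applied to u and -u, the one-sided bound controls both components; their sum bounds the
  norm, which doubles the constant 4.\<close>

lemma harmonic_gradient_bound:
  fixes u :: "real^2 \<Rightarrow> real"
  assumes "R > 0" and cont: "continuous_on (ball x R) u"
    and lap: "\<And>z. z \<in> ball x R \<Longrightarrow> has_laplacian u z 0"
    and bd: "\<And>z. z \<in> ball x R \<Longrightarrow> \<bar>u z\<bar> \<le> M"
    and deriv: "GDERIV u x :> g"
  shows "norm g \<le> 8 * M / R"
proof -
  have "g $ i \<le> 4 * M / R" for i
    by (rule harmonic_partial_derivative_bound[OF assms])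
  moreover have "(- g) $ i \<le> 4 * M / R" for i
    using has_laplacian_uminus[OF lap] bd
    by (intro harmonic_partial_derivative_bound[OF \<open>R > 0\<close> continuous_on_minus[OF cont] _ _ GDERIV_minus[OF deriv]])
      auto
  ultimately have "\<bar>g $ i\<bar> \<le> 4 * M / R" for i
    by (simp add: abs_le_iff)
  then have "(\<Sum>i\<in>UNIV. \<bar>g $ i\<bar>) \<le> (\<Sum>i\<in>(UNIV::2 set). 4 * M / R)"
    by (intro sum_mono)
  then show ?thesis
    using norm_le_l1_cart[of g] by simp
qed

section \<open>The regular part of the Green function\<close>

lemma abs_ln_diff_le:
  fixes a b m :: real
  assumes "m > 0" "a \<ge> m" "b \<ge> m"
  shows "\<bar>ln a - ln b\<bar> \<le> \<bar>a - b\<bar> / m"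
proof -
  have *: "ln s - ln t \<le> \<bar>s - t\<bar> / m" if "s \<ge> m" "t \<ge> m" for s t
  proof -
    have "ln s - ln t \<le> (s - t) / t"
      using ln_diff_le that \<open>m > 0\<close> by simp
    also have "\<dots> \<le> \<bar>s - t\<bar> / m"
      using that \<open>m > 0\<close> by (intro frac_le) auto
    finally show ?thesis .
  qed
  show ?thesis
    using *[OF assms(2,3)] *[OF assms(3,2)] by (simp add: abs_le_iff abs_minus_commute)
qed

lemma abs_cmult_diff: "c \<ge> 0 \<Longrightarrow> \<bar>c * a - c * b\<bar> = c * \<bar>a - b\<bar>" for a b c :: real
  by (metis abs_mult abs_of_nonneg right_diff_distrib)

lemma norm_add_scaleR_unit:
  fixes w \<nu> :: "'a::real_inner"
  assumes "norm \<nu> = 1"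
  shows "(norm (w + t *\<^sub>R \<nu>))\<^sup>2 = (norm w)\<^sup>2 + 2 * t * (w \<bullet> \<nu>) + t\<^sup>2"
proof -
  have "(norm (w + t *\<^sub>R \<nu>))\<^sup>2 = (norm w)\<^sup>2 + 2 * t * (w \<bullet> \<nu>) + t * (t * (\<nu> \<bullet> \<nu>))"
    by (simp only: power2_norm_eq_inner) (simp add: algebra_simps inner_commute)
  then show ?thesis
    using assms by (simp add: dot_square_norm power2_eq_square)
qed

text \<open>The equality case of the triangle inequality: the square of |s a + r b| comes out
  nonpositive. It makes the centres of two touching disks collinear with the point of
  contact.\<close>

lemma opposite_directions:
  fixes a b :: "'a::real_inner"
  assumes "r \<ge> 0" "s \<ge> 0" "norm a = r" "norm b = s" "r + s \<le> norm (a - b)"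
  shows "s *\<^sub>R a = - (r *\<^sub>R b)"
proof -
  have "(r + s)\<^sup>2 \<le> (norm (a - b))\<^sup>2"
    using assms by (intro power_mono) auto
  also have "(norm (a - b))\<^sup>2 = (norm a)\<^sup>2 + (norm b)\<^sup>2 - 2 * (a \<bullet> b)"
    by (simp only: power2_norm_eq_inner) (simp add: algebra_simps inner_commute)
  finally have "a \<bullet> b \<le> - (r * s)"
    using assms(3,4) by (simp add: power2_eq_square algebra_simps)
  have "(norm (s *\<^sub>R a + r *\<^sub>R b))\<^sup>2 = s\<^sup>2 * (norm a)\<^sup>2 + 2 * r * s * (a \<bullet> b) + r\<^sup>2 * (norm b)\<^sup>2"
    by (simp only: power2_norm_eq_inner) (simp add: algebra_simps inner_commute power2_eq_square)
  also have "\<dots> = 2 * r * s * (r * s + a \<bullet> b)"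
    using assms(3,4) by (simp add: power2_eq_square algebra_simps)
  also have "\<dots> \<le> 0"
    using \<open>a \<bullet> b \<le> - (r * s)\<close> assms(1,2) by (intro mult_nonneg_nonpos) auto
  finally have "norm (s *\<^sub>R a + r *\<^sub>R b) = 0"
    by simp
  then show ?thesis by (simp add: eq_neg_iff_add_eq_0)
qed

lemma dist_ge_add_if_disjoint_balls:
  fixes x y :: "'a::real_normed_vector"
  assumes "r > 0" "s > 0" "ball x r \<inter> ball y s = {}"
  shows "r + s \<le> dist x y"
proof (rule ccontr)
  assume "\<not> r + s \<le> dist x y"
  then have lt: "norm (y - x) < r + s" by (simp add: dist_norm norm_minus_commute)
  \<comment> \<open>The point dividing the segment from x to y in the ratio r : s would lie in both
    balls.\<close>
  define z where "z = x + (r / (r + s)) *\<^sub>R (y - x)"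
  have "norm (z - x) = (r / (r + s)) * norm (y - x)"
    using assms by (simp add: z_def)
  also have "\<dots> < (r / (r + s)) * (r + s)"
    using lt assms by (intro mult_strict_left_mono) auto
  finally have "z \<in> ball x r"
    using assms by (simp add: dist_norm norm_minus_commute)
  have "y - z = (s / (r + s)) *\<^sub>R (y - x)"
  proof -
    have "y - z = (1 - r / (r + s)) *\<^sub>R (y - x)"
      by (simp add: z_def algebra_simps)
    also have "1 - r / (r + s) = s / (r + s)"
      using assms by (simp add: field_simps)
    finally show ?thesis .
  qed
  then have "norm (y - z) = (s / (r + s)) * norm (y - x)"
    using assms by simp
  also have "\<dots> < (s / (r + s)) * (r + s)"
    using lt assms by (intro mult_strict_left_mono) auto
  finally have "z \<in> ball y s"
    using assms by (simp add: dist_norm)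
  with \<open>z \<in> ball x r\<close> assms(3) show False by blast
qed

lemma infdist_le_add: "infdist x A \<le> infdist y A + dist x y"
  using infdist_triangle[of x A y] by simp

lemma GDERIV_ln_norm:
  fixes x a :: "'a::real_inner"
  assumes "x \<noteq> a"
  shows "GDERIV (\<lambda>x. ln (norm (x - a))) x :> (1 / (norm (x - a))\<^sup>2) *\<^sub>R (x - a)"
proof -
  have "((\<lambda>x. x - a) has_derivative (\<lambda>h. h)) (at x)"
    by (auto intro!: derivative_eq_intros)
  from has_derivative_compose[OF this GDERIV_norm[unfolded gderiv_def]]
  have "GDERIV (\<lambda>x. norm (x - a)) x :> sgn (x - a)"
    using assms by (simp add: gderiv_def)
  from GDERIV_DERIV_compose[OF this DERIV_ln]
  show ?thesis
    using assms by (simp add: sgn_div_norm power2_eq_square divide_inverse)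
qed

lemma GDERIV_unique: "GDERIV f x :> D \<Longrightarrow> GDERIV f x :> E \<Longrightarrow> D = E"
  unfolding gderiv_def
  by (drule (1) has_derivative_unique) (metis vector_eq_ldot)

lemma GDERIV_cmult: "GDERIV f x :> D \<Longrightarrow> GDERIV (\<lambda>x. c * f x) x :> c *\<^sub>R D"
  unfolding gderiv_def by (drule has_derivative_mult_right) simp

locale regular_part_domain =
  fixes \<Omega> :: "(real^2) set" and k :: "real^2 \<Rightarrow> real^2 \<Rightarrow> real" and \<rho> :: real
  assumes open_dom: "open \<Omega>" and bounded_dom: "bounded \<Omega>" and rho_pos: "\<rho> > 0"
    and disks: "disk_conditions \<Omega> \<rho>" and regular_part: "is_regular_part \<Omega> k"
begin

section \<open>Touching disks and the mirror image\<close>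

abbreviation bdist :: "real^2 \<Rightarrow> real" where "bdist x \<equiv> infdist x (frontier \<Omega>)"

text \<open>A relation rather than a function: any nearest boundary point serves.\<close>

definition foot :: "real^2 \<Rightarrow> real^2 \<Rightarrow> bool" where
  "foot y p \<longleftrightarrow> p \<in> frontier \<Omega> \<and> dist y p = bdist y"

lemma ex_foot: "y \<in> \<Omega> \<Longrightarrow> \<exists>p. foot y p"
  using nearest_frontier_point[OF open_dom bounded_dom] by (metis foot_def)

lemma bdist_pos: "y \<in> \<Omega> \<Longrightarrow> bdist y > 0"
  using infdist_frontier_pos[OF open_dom bounded_dom] by blast

lemma bdist_le: "p \<in> frontier \<Omega> \<Longrightarrow> bdist y \<le> norm (p - y)"
  by (metis dist_commute dist_norm infdist_le)

lemma frontier_not_dom: "p \<in> frontier \<Omega> \<Longrightarrow> p \<notin> \<Omega>"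
  using open_dom by (simp add: frontier_def interior_open)

lemma in_frontier: "x \<in> closure \<Omega> \<Longrightarrow> x \<notin> \<Omega> \<Longrightarrow> x \<in> frontier \<Omega>"
  using open_dom by (simp add: frontier_def interior_open)

lemma ball_bdist_subset:
  assumes "y \<in> \<Omega>" "r \<le> bdist y" shows "ball y r \<subseteq> \<Omega>"
proof (rule ccontr)
  assume "\<not> ball y r \<subseteq> \<Omega>"
  then obtain z where z: "z \<in> ball y r" "z \<notin> \<Omega>" by blast
  then have "r > 0" by (metis mem_ball order.strict_trans1 zero_le_dist)
  then have "y \<in> ball y r \<inter> \<Omega>" using assms by simp
  then have "ball y r \<inter> frontier \<Omega> \<noteq> {}"
    using z by (intro connected_Int_frontier) blast+
  then obtain p where "p \<in> frontier \<Omega>" "dist y p < r" by auto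
  then show False
    using infdist_le[of p "frontier \<Omega>" y] assms by simp
qed

text \<open>The ball of radius \<open>bdist y\<close> around y and the exterior disk at p are
  disjoint and touch at p, so y lies on the normal through the exterior centre; the same holds for
  the interior centre. Frontier points avoid both disks, and expanding the squared distances to the
  two centres shows that the frontier leaves its tangent only quadratically.\<close>

lemma foot_normal:
  assumes "y \<in> \<Omega>" "foot y p"
  obtains \<nu> where "norm \<nu> = 1" "y - p = bdist y *\<^sub>R \<nu>"
    "\<And>q. q \<in> frontier \<Omega> \<Longrightarrow> 2 * \<rho> * \<bar>(q - p) \<bullet> \<nu>\<bar> \<le> (norm (q - p))\<^sup>2"
    "\<And>t. 0 < t \<Longrightarrow> t < 2 * \<rho> \<Longrightarrow> p - t *\<^sub>R \<nu> \<notin> closure \<Omega>"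
proof -
  define d where "d = bdist y"
  have "d > 0" using bdist_pos assms(1) by (simp add: d_def)
  have p: "p \<in> frontier \<Omega>" "dist y p = d" using assms by (auto simp: foot_def d_def)
  then obtain a b where a: "ball a \<rho> \<subseteq> \<Omega>" and b: "ball b \<rho> \<subseteq> - \<Omega>"
    and ab: "sphere a \<rho> \<inter> frontier \<Omega> \<inter> sphere b \<rho> = {p}"
    using disks unfolding disk_conditions_def by fastforce
  have pa: "dist a p = \<rho>" and pb: "dist b p = \<rho>"
    using ab by (auto simp: set_eq_iff)
  define \<nu> where "\<nu> = (1 / \<rho>) *\<^sub>R (p - b)"
  have n\<nu>: "norm \<nu> = 1"
    using pb rho_pos by (simp add: \<nu>_def dist_norm norm_minus_commute)
  have b\<nu>: "b = p - \<rho> *\<^sub>R \<nu>"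
    using rho_pos by (simp add: \<nu>_def)
  \<comment> \<open>Used twice: for the ball around y and for the interior disk.\<close>
  have opp: "c - p = r *\<^sub>R \<nu>" if "r > 0" "ball c r \<subseteq> \<Omega>" "dist c p = r" for c r
  proof -
    have "r + \<rho> \<le> dist c b"
      using that b rho_pos by (intro dist_ge_add_if_disjoint_balls) auto
    then have "\<rho> *\<^sub>R (c - p) = - (r *\<^sub>R (b - p))"
      using that pb rho_pos by (intro opposite_directions) (auto simp: dist_norm)
    then have "\<rho> *\<^sub>R (c - p) = \<rho> *\<^sub>R (r *\<^sub>R \<nu>)"
      by (simp add: b\<nu>)
    then show ?thesis using rho_pos by (metis less_irrefl scaleR_left_imp_eq)
  qed
  have y: "y - p = d *\<^sub>R \<nu>"
    using opp[OF \<open>d > 0\<close>] ball_bdist_subset[OF assms(1)] p(2) by (simp add: d_def)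
  have a\<nu>: "a = p + \<rho> *\<^sub>R \<nu>"
    using opp[OF rho_pos a pa] by (simp add: algebra_simps)
  have b': "ball b \<rho> \<inter> closure \<Omega> = {}"
    using b open_Int_closure_eq_empty[of "ball b \<rho>" \<Omega>] by auto
  show ?thesis
  proof (rule that[OF n\<nu>])
    show "y - p = bdist y *\<^sub>R \<nu>" using y by (simp add: d_def)
    fix q assume q: "q \<in> frontier \<Omega>"
    have "q \<notin> ball a \<rho>" "q \<notin> ball b \<rho>"
      using frontier_not_dom[OF q] a b' q by (auto simp: frontier_def)
    then have "\<rho> \<le> norm ((q - p) - \<rho> *\<^sub>R \<nu>)" "\<rho> \<le> norm ((q - p) + \<rho> *\<^sub>R \<nu>)"
      by (simp_all add: a\<nu> b\<nu> dist_norm norm_minus_commute algebra_simps)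
    then have "\<rho>\<^sup>2 \<le> (norm ((q - p) - \<rho> *\<^sub>R \<nu>))\<^sup>2" "\<rho>\<^sup>2 \<le> (norm ((q - p) + \<rho> *\<^sub>R \<nu>))\<^sup>2"
      using rho_pos by (auto intro!: power_mono)
    with norm_add_scaleR_unit[OF n\<nu>, of "q - p" \<rho>] norm_add_scaleR_unit[OF n\<nu>, of "q - p" "-\<rho>"]
    have "2 * \<rho> * ((q - p) \<bullet> \<nu>) \<le> (norm (q - p))\<^sup>2" "- (2 * \<rho> * ((q - p) \<bullet> \<nu>)) \<le> (norm (q - p))\<^sup>2"
      by auto
    then show "2 * \<rho> * \<bar>(q - p) \<bullet> \<nu>\<bar> \<le> (norm (q - p))\<^sup>2"
      by (cases "(q - p) \<bullet> \<nu> \<ge> 0") auto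
  next
    fix t :: real assume t: "0 < t" "t < 2 * \<rho>"
    have "p - t *\<^sub>R \<nu> \<in> ball b \<rho>"
    proof -
      have "b - (p - t *\<^sub>R \<nu>) = (t - \<rho>) *\<^sub>R \<nu>"
        by (simp add: b\<nu> algebra_simps)
      then show ?thesis using t n\<nu> by (simp add: dist_norm)
    qed
    then show "p - t *\<^sub>R \<nu> \<notin> closure \<Omega>" using b' by blast
  qed
qed

text \<open>The mirror image of \<open>y\<close> in its foot point \<open>p\<close> is \<open>2p - y\<close>.\<close>

lemma mirror_image:
  assumes "y \<in> \<Omega>" "foot y p" "bdist y \<le> \<rho> / 2"
  shows "2 *\<^sub>R p - y \<notin> closure \<Omega>"
    and "q \<in> frontier \<Omega> \<Longrightarrow> \<bar>ln (norm (q - y)) - ln (norm (q - (2 *\<^sub>R p - y)))\<bar> \<le> 2 * bdist y / \<rho>"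
proof -
  define d where "d = bdist y"
  have d: "d > 0" "d \<le> \<rho> / 2" using bdist_pos assms by (auto simp: d_def)
  obtain \<nu> where \<nu>: "norm \<nu> = 1" "y - p = d *\<^sub>R \<nu>"
    "\<And>q. q \<in> frontier \<Omega> \<Longrightarrow> 2 * \<rho> * \<bar>(q - p) \<bullet> \<nu>\<bar> \<le> (norm (q - p))\<^sup>2"
    "\<And>t. 0 < t \<Longrightarrow> t < 2 * \<rho> \<Longrightarrow> p - t *\<^sub>R \<nu> \<notin> closure \<Omega>"
    using foot_normal[OF assms(1,2)] unfolding d_def by metis
  have y: "y = p + d *\<^sub>R \<nu>" using \<nu>(2) by (simp add: algebra_simps)
  have ys: "2 *\<^sub>R p - y = p - d *\<^sub>R \<nu>" by (simp add: y scaleR_2)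
  show "2 *\<^sub>R p - y \<notin> closure \<Omega>"
    unfolding ys using \<nu>(4) d rho_pos by simp
  assume q: "q \<in> frontier \<Omega>"
  define w where "w = q - p"
  define s where "s = w \<bullet> \<nu>"
  have s: "2 * \<rho> * \<bar>s\<bar> \<le> (norm w)\<^sup>2" using \<nu>(3)[OF q] by (simp add: s_def w_def)
  have sq: "(norm (w + t *\<^sub>R \<nu>))\<^sup>2 = (norm w)\<^sup>2 + 2 * t * s + t\<^sup>2" for t
    unfolding s_def by (rule norm_add_scaleR_unit[OF \<nu>(1)])
  \<comment> \<open>As d \<le> \<rho>/2, quadratic tangency bounds the mixed term by half of |w|^2.
    Both distances thus share a lower bound that does not degenerate at the foot point.\<close>
  have m: "(norm w)\<^sup>2 / 2 + d\<^sup>2 \<le> (norm (w + t *\<^sub>R \<nu>))\<^sup>2" if "\<bar>t\<bar> = d" for t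
  proof -
    have "4 * d * \<bar>s\<bar> \<le> 2 * \<rho> * \<bar>s\<bar>" using d by (intro mult_right_mono) auto
    then have "4 * d * \<bar>s\<bar> \<le> (norm w)\<^sup>2" using s by linarith
    moreover have "- (2 * t * s) \<le> 2 * d * \<bar>s\<bar>"
      using that abs_ge_minus_self[of "2 * t * s"] by (simp add: abs_mult)
    moreover have "t\<^sup>2 = d\<^sup>2" using that by (metis power2_abs)
    ultimately show ?thesis unfolding sq by linarith
  qed
  have pos: "(norm w)\<^sup>2 / 2 + d\<^sup>2 > 0" using d by (simp add: add_nonneg_pos)
  \<comment> \<open>The squared distances to y and to its image differ only by 4 d s, and \<rho> |s|
    is at most |w|^2 / 2; the quotient is O(d / \<rho>) uniformly in q.\<close>
  have "\<bar>ln ((norm (w + (-d) *\<^sub>R \<nu>))\<^sup>2) - ln ((norm (w + d *\<^sub>R \<nu>))\<^sup>2)\<bar>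
      \<le> \<bar>(norm (w + (-d) *\<^sub>R \<nu>))\<^sup>2 - (norm (w + d *\<^sub>R \<nu>))\<^sup>2\<bar> / ((norm w)\<^sup>2 / 2 + d\<^sup>2)"
    using m[of d] m[of "-d"] d pos by (intro abs_ln_diff_le) auto
  also have "\<dots> = 4 * d * \<bar>s\<bar> / ((norm w)\<^sup>2 / 2 + d\<^sup>2)"
    unfolding sq using d by (simp add: abs_mult)
  also have "\<dots> \<le> 4 * d / \<rho>"
  proof -
    have "\<rho> * \<bar>s\<bar> \<le> (norm w)\<^sup>2 / 2 + d\<^sup>2" using s by (simp add: add_increasing2)
    then have "4 * d * (\<rho> * \<bar>s\<bar>) \<le> 4 * d * ((norm w)\<^sup>2 / 2 + d\<^sup>2)"
      using d by (intro mult_left_mono) auto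
    then show ?thesis using pos rho_pos by (simp add: divide_simps mult_ac)
  qed
  finally have "\<bar>ln ((norm (q - y))\<^sup>2) - ln ((norm (q - (2 *\<^sub>R p - y)))\<^sup>2)\<bar> \<le> 4 * d / \<rho>"
    unfolding ys by (simp add: y w_def algebra_simps)
  moreover have "q \<noteq> y" "q \<noteq> 2 *\<^sub>R p - y"
    using frontier_not_dom[OF q] assms(1) \<open>2 *\<^sub>R p - y \<notin> closure \<Omega>\<close> q by (auto simp: frontier_def)
  ultimately show "\<bar>ln (norm (q - y)) - ln (norm (q - (2 *\<^sub>R p - y)))\<bar> \<le> 2 * bdist y / \<rho>"
    by (simp add: ln_realpow d_def)
qed

section \<open>Boundary comparison and symmetry of k\<close>

lemma k_continuous: "y \<in> \<Omega> \<Longrightarrow> continuous_on (closure \<Omega>) (\<lambda>x. k x y)"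
  and k_frontier: "y \<in> \<Omega> \<Longrightarrow> x \<in> frontier \<Omega> \<Longrightarrow> k x y = 1 / (2 * pi) * ln (norm (x - y))"
  and k_harmonic: "y \<in> \<Omega> \<Longrightarrow> harmonic_on \<Omega> (\<lambda>x. k x y)"
  using regular_part unfolding is_regular_part_def by blast+

lemma k_laplacian: "x \<in> \<Omega> \<Longrightarrow> y \<in> \<Omega> \<Longrightarrow> has_laplacian (\<lambda>x. k x y) x 0"
  using harmonic_on_has_laplacian[OF open_dom k_harmonic] .

lemma k_mirror_estimate:
  assumes "x \<in> closure \<Omega>" "y \<in> \<Omega>" "foot y p" "bdist y \<le> \<rho> / 2"
  shows "\<bar>k x y - 1 / (2 * pi) * ln (norm (x - (2 *\<^sub>R p - y)))\<bar> \<le> bdist y / (pi * \<rho>)"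
proof (rule maximum_principle_abs[OF open_dom bounded_dom _ _ _ assms(1)])
  note mi = mirror_image[OF assms(2-4)]
  show "continuous_on (closure \<Omega>) (\<lambda>x. k x y - 1 / (2 * pi) * ln (norm (x - (2 *\<^sub>R p - y))))"
    using mi(1) by (intro continuous_intros k_continuous assms) auto
  fix x assume "x \<in> \<Omega>"
  then have "x \<noteq> 2 *\<^sub>R p - y" using mi(1) closure_subset by blast
  then have "has_laplacian (\<lambda>x. k x y - 1 / (2 * pi) * ln (norm (x - (2 *\<^sub>R p - y)))) x (0 - 1 / (2 * pi) * 0)"
    using \<open>x \<in> \<Omega>\<close> assms(2)
    by (intro has_laplacian_diff has_laplacian_cmult has_laplacian_ln_norm k_laplacian)
  then show "has_laplacian (\<lambda>x. k x y - 1 / (2 * pi) * ln (norm (x - (2 *\<^sub>R p - y)))) x 0" by simp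
next
  note mi = mirror_image[OF assms(2-4)]
  fix q assume q: "q \<in> frontier \<Omega>"
  have "\<bar>k q y - 1 / (2 * pi) * ln (norm (q - (2 *\<^sub>R p - y)))\<bar>
      = 1 / (2 * pi) * \<bar>ln (norm (q - y)) - ln (norm (q - (2 *\<^sub>R p - y)))\<bar>"
    unfolding k_frontier[OF assms(2) q]
    by (intro abs_cmult_diff) simp
  also have "\<dots> \<le> 1 / (2 * pi) * (2 * bdist y / \<rho>)"
    using mi(2)[OF q] by (intro mult_left_mono) auto
  finally show "\<bar>k q y - 1 / (2 * pi) * ln (norm (q - (2 *\<^sub>R p - y)))\<bar> \<le> bdist y / (pi * \<rho>)"
    by simp
qed

text \<open>The second argument enters only through the boundary values ln |q - y|, which are
  1/m-Lipschitz in y at distance m from the frontier; the maximum principle in x moves this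
  inside.\<close>

lemma k_lipschitz_snd:
  assumes "x \<in> closure \<Omega>" "y \<in> \<Omega>" "z \<in> \<Omega>" "m > 0" "bdist y \<ge> m" "bdist z \<ge> m"
  shows "\<bar>k x y - k x z\<bar> \<le> dist y z / m"
proof (rule maximum_principle_abs[OF open_dom bounded_dom _ _ _ assms(1)])
  show "continuous_on (closure \<Omega>) (\<lambda>x. k x y - k x z)"
    by (intro continuous_intros k_continuous assms)
  show "has_laplacian (\<lambda>x. k x y - k x z) x 0" if "x \<in> \<Omega>" for x
    using has_laplacian_diff[OF k_laplacian[OF that assms(2)] k_laplacian[OF that assms(3)]] by simp
  fix q assume q: "q \<in> frontier \<Omega>"
  have "\<bar>ln (norm (q - y)) - ln (norm (q - z))\<bar> \<le> \<bar>norm (q - y) - norm (q - z)\<bar> / m"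
    using bdist_le[OF q, of y] bdist_le[OF q, of z] assms by (intro abs_ln_diff_le) auto
  also have "\<dots> \<le> dist y z / m"
    using norm_triangle_ineq3[of "q - y" "q - z"] assms(4)
    by (intro divide_right_mono) (auto simp: dist_norm norm_minus_commute)
  finally have *: "\<bar>ln (norm (q - y)) - ln (norm (q - z))\<bar> \<le> dist y z / m" .
  have "\<bar>k q y - k q z\<bar> = 1 / (2 * pi) * \<bar>ln (norm (q - y)) - ln (norm (q - z))\<bar>"
    unfolding k_frontier[OF assms(2) q] k_frontier[OF assms(3) q]
    by (intro abs_cmult_diff) simp
  also have "\<dots> \<le> 1 * (dist y z / m)"
    using * pi_gt3 by (intro mult_mono) (auto simp: divide_le_eq)
  finally show "\<bar>k q y - k q z\<bar> \<le> dist y z / m" by simp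
qed

lemma stencil_2:
  "stencil u x h = u (x + h *\<^sub>R axis 1 1) + u (x - h *\<^sub>R axis 1 1)
    + u (x + h *\<^sub>R axis 2 1) + u (x - h *\<^sub>R axis 2 1) - 4 * u x"
  by (simp add: stencil_def UNIV_2)

text \<open>For fixed h the stencil in y is a finite combination of functions harmonic in x. Its
  boundary values are stencils of the logarithm, of size O(h^4) uniformly in q, and the bound passes
  to interior x before h tends to 0.\<close>

lemma k_laplacian_snd:
  assumes "x \<in> \<Omega>" "y \<in> \<Omega>" shows "has_laplacian (k x) y 0"
proof (rule has_laplacian_zeroI)
  show "bdist y / 4 > 0" using bdist_pos[OF assms(2)] by simp
  fix h :: real assume h: "0 < h" "h < bdist y / 4"
  have y: "y + h *\<^sub>R axis i 1 \<in> \<Omega>" "y - h *\<^sub>R axis i 1 \<in> \<Omega>" for i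
    by (intro subsetD[OF ball_bdist_subset[OF assms(2) order_refl]];
        use h in \<open>simp add: dist_norm norm_axis_1\<close>)+
  have "\<bar>stencil (k x) y h\<bar> \<le> 7 / bdist y ^ 4 * h ^ 4"
  proof (rule maximum_principle_abs[OF open_dom bounded_dom, where f = "\<lambda>x. stencil (k x) y h"])
    show "continuous_on (closure \<Omega>) (\<lambda>x. stencil (k x) y h)"
      unfolding stencil_2 by (intro continuous_intros k_continuous y assms)
    show "x \<in> closure \<Omega>" using assms closure_subset by blast
    show "has_laplacian (\<lambda>x. stencil (k x) y h) x 0" if "x \<in> \<Omega>" for x
    proof -
      have "has_laplacian (\<lambda>x. stencil (k x) y h) x (0 + 0 + 0 + 0 - 4 * 0)"
        unfolding stencil_2
        by (intro has_laplacian_diff has_laplacian_add has_laplacian_cmult k_laplacian y that assms)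
      then show ?thesis by simp
    qed
    fix q assume q: "q \<in> frontier \<Omega>"
    have bq: "bdist y \<le> norm (y - q)"
      using bdist_le[OF q, of y] by (simp add: norm_minus_commute)
    have "stencil (k q) y h = 1 / (2 * pi) * stencil (\<lambda>y. ln (norm (y - q))) y h"
      unfolding stencil_cmult[symmetric] unfolding stencil_2
      by (simp only: k_frontier[OF y(1) q] k_frontier[OF y(2) q] k_frontier[OF assms(2) q]
          norm_minus_commute[of q])
    then have "\<bar>stencil (k q) y h\<bar> = 1 / (2 * pi) * \<bar>stencil (\<lambda>y. ln (norm (y - q))) y h\<bar>"
      by (simp add: abs_mult)
    also have "\<dots> \<le> 1 * (7 * h ^ 4 / norm (y - q) ^ 4)"
    proof (intro mult_mono)
      show "\<bar>stencil (\<lambda>y. ln (norm (y - q))) y h\<bar> \<le> 7 * h ^ 4 / norm (y - q) ^ 4"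
        using frontier_not_dom[OF q] assms h bq by (intro stencil_ln_norm_bound) auto
    qed (use pi_gt3 in \<open>auto simp: divide_le_eq\<close>)
    also have "\<dots> \<le> 7 * h ^ 4 / bdist y ^ 4"
      using bq bdist_pos[OF assms(2)] by (simp add: frac_le power_mono)
    finally show "\<bar>stencil (k q) y h\<bar> \<le> 7 / bdist y ^ 4 * h ^ 4" by simp
  qed
  then show "\<bar>stencil (k x) y h\<bar> \<le> 7 / bdist y ^ 4 * h ^ 4" .
qed

lemma k_snd_continuous:
  assumes "x \<in> \<Omega>" shows "continuous_on \<Omega> (k x)"
  unfolding continuous_on_def
proof
  fix y assume y: "y \<in> \<Omega>"
  define m where "m = bdist y / 2"
  have m: "m > 0" using bdist_pos[OF y] by (simp add: m_def)
  have "((\<lambda>z. dist z y / m) \<longlongrightarrow> dist y y / m) (at y within \<Omega>)"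
    using m by (intro tendsto_intros) auto
  moreover have "\<forall>\<^sub>F z in at y within \<Omega>. norm (k x z - k x y) \<le> dist z y / m"
    unfolding eventually_at
  proof (intro exI[of _ m] conjI m ballI impI)
    fix z assume z: "z \<in> \<Omega>" "z \<noteq> y \<and> dist z y < m"
    then have "bdist z \<ge> m"
      using infdist_le_add[of y "frontier \<Omega>" z] by (simp add: m_def dist_commute)
    then show "norm (k x z - k x y) \<le> dist z y / m"
      using k_lipschitz_snd[of x z y m] z y m assms closure_subset[of \<Omega>] by (auto simp: m_def)
  qed
  ultimately show "(k x \<longlongrightarrow> k x y) (at y within \<Omega>)"
    using Lim_null_comparison[of "\<lambda>z. k x z - k x y"] by (auto simp: LIM_zero_iff)
qed

text \<open>When y approaches p on the frontier, so does its image, and \<open>k x y\<close> is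
  close to the potential of the image at x. On the other side \<open>k y x\<close> tends to its
  boundary value at p. Both limits are ln |x - p| / (2 \<pi>).\<close>

lemma k_symmetric_at_frontier:
  assumes "x \<in> \<Omega>" "e > 0"
  shows "\<exists>d>0. \<forall>y\<in>\<Omega>. bdist y < d \<longrightarrow> \<bar>k x y - k y x\<bar> \<le> e"
proof -
  define c where "c = bdist x"
  have c: "c > 0" using bdist_pos assms by (simp add: c_def)
  obtain d1 where "d1 > 0"
    and d1: "\<And>y p. y \<in> \<Omega> \<Longrightarrow> p \<in> frontier \<Omega> \<Longrightarrow> dist y p < d1 \<Longrightarrow> \<bar>k y x - k p x\<bar> < e / 3"
    using uniformly_close_at_frontier[OF bounded_dom k_continuous[OF assms(1)], of "e / 3"] assms(2)
    by (metis divide_pos_pos zero_less_numeral)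
  \<comment> \<open>In order: continuity of \<open>k\<close> up to the frontier, admissibility of
    the image, an image at least c/2 away from x, and the last two make the two remaining errors at
    most e/3.\<close>
  define d where "d = Min {d1, \<rho> / 2, c / 2, e * \<rho> / 3, e * c / 6}"
  have d: "d > 0" "d \<le> d1" "d \<le> \<rho> / 2" "d \<le> c / 2" "d \<le> e * \<rho> / 3" "d \<le> e * c / 6"
    unfolding d_def using \<open>d1 > 0\<close> rho_pos c assms by (auto simp: Min_gr_iff)
  have "\<bar>k x y - k y x\<bar> \<le> e" if y: "y \<in> \<Omega>" "bdist y < d" for y
  proof -
    obtain p where p: "foot y p" using ex_foot y by blast
    then have pf: "p \<in> frontier \<Omega>" and pd: "dist y p = bdist y" by (auto simp: foot_def)
    define s where "s = 2 *\<^sub>R p - y"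
    have "x \<in> closure \<Omega>" using assms closure_subset by blast
    then have "\<bar>k x y - 1 / (2 * pi) * ln (norm (x - s))\<bar> \<le> bdist y / (pi * \<rho>)"
      unfolding s_def using y d p by (intro k_mirror_estimate) auto
    also have "\<dots> \<le> bdist y / \<rho>"
      using pi_gt3 rho_pos by (intro divide_left_mono) (auto simp: infdist_nonneg)
    also have "\<dots> \<le> e / 3"
      using y d rho_pos by (simp add: field_simps)
    finally have 1: "\<bar>k x y - 1 / (2 * pi) * ln (norm (x - s))\<bar> \<le> e / 3" .
    have sp: "norm (s - p) = bdist y"
      using pd by (simp add: s_def dist_norm scaleR_2 norm_minus_commute)
    have "c \<le> norm (x - p)"
      using bdist_le[OF pf, of x] by (simp add: c_def norm_minus_commute)
    moreover have "norm (x - p) \<le> norm (x - s) + norm (s - p)"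
      using norm_triangle_ineq[of "x - s" "s - p"] by simp
    ultimately have "\<bar>ln (norm (x - s)) - ln (norm (x - p))\<bar> \<le> \<bar>norm (x - s) - norm (x - p)\<bar> / (c / 2)"
      using sp y d c by (intro abs_ln_diff_le) auto
    also have "\<dots> \<le> bdist y / (c / 2)"
      using norm_triangle_ineq3[of "x - s" "x - p"] sp c
      by (intro divide_right_mono) (auto simp: norm_minus_commute)
    also have "\<dots> \<le> e / 3"
      using y d c by (simp add: field_simps)
    finally have "1 / (2 * pi) * \<bar>ln (norm (x - s)) - ln (norm (x - p))\<bar> \<le> 1 * (e / 3)"
      using pi_gt3 by (intro mult_mono) (auto simp: divide_le_eq)
    then have 2: "\<bar>1 / (2 * pi) * ln (norm (x - s)) - k p x\<bar> \<le> e / 3"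
      unfolding k_frontier[OF assms(1) pf] norm_minus_commute[of p] by (subst abs_cmult_diff) simp_all
    have 3: "\<bar>k y x - k p x\<bar> < e / 3"
      using d1[OF y(1) pf] pd y d by simp
    show ?thesis using 1 2 3 by linarith
  qed
  then show ?thesis using d by blast
qed

text \<open>The difference is harmonic in y by \<open>k_laplacian_snd\<close> and has boundary limit
  0, so the maximum principle applies to it and to its negative.\<close>

lemma k_symmetric:
  assumes "x \<in> \<Omega>" "y \<in> \<Omega>" shows "k x y = k y x"
proof -
  have c: "continuous_on \<Omega> (\<lambda>y. k x y - k y x)"
    by (intro continuous_intros k_snd_continuous assms continuous_on_subset[OF k_continuous] closure_subset)
  have l: "has_laplacian (\<lambda>y. k x y - k y x) y 0" if "y \<in> \<Omega>" for y
    using has_laplacian_diff[OF k_laplacian_snd[OF assms(1) that] k_laplacian[OF that assms(1)]] by simp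
  have "k x y - k y x \<le> 0"
    by (rule maximum_principle[OF open_dom bounded_dom c l _ assms(2)])
      (use k_symmetric_at_frontier[OF assms(1)] in \<open>force simp: abs_le_iff\<close>)+
  moreover have "- (k x y - k y x) \<le> 0"
  proof (rule maximum_principle[OF open_dom bounded_dom continuous_on_minus[OF c] _ _ assms(2)])
    show "has_laplacian (\<lambda>y. - (k x y - k y x)) y 0" if "y \<in> \<Omega>" for y
      using has_laplacian_uminus[OF l[OF that]] by simp
  qed (use k_symmetric_at_frontier[OF assms(1)] in \<open>force simp: abs_le_iff\<close>)
  ultimately show ?thesis by simp
qed


section \<open>Gradient of k\<close>

definition dk :: "real^2 \<Rightarrow> real^2 \<Rightarrow> real^2" where
  "dk x y = (SOME D. GDERIV (\<lambda>x. k x y) x :> D)"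

lemma GDERIV_k: "x \<in> \<Omega> \<Longrightarrow> y \<in> \<Omega> \<Longrightarrow> GDERIV (\<lambda>x. k x y) x :> dk x y"
proof -
  assume "x \<in> \<Omega>" "y \<in> \<Omega>"
  then have "\<exists>D. GDERIV (\<lambda>x. k x y) x :> D"
    using k_harmonic[of y] unfolding harmonic_on_def by blast
  then show ?thesis unfolding dk_def by (rule someI_ex)
qed

lemma GDERIV_k_snd:
  assumes "x \<in> \<Omega>" "y \<in> \<Omega>" shows "GDERIV (k x) y :> dk y x"
  using GDERIV_k[OF assms(2,1)] unfolding gderiv_def
  by (rule has_derivative_transform_within_open[OF _ open_dom assms(2)])
    (use k_symmetric assms(1) in auto)

lemma dk_continuous_fst: "y \<in> \<Omega> \<Longrightarrow> continuous_on \<Omega> (\<lambda>x. dk x y)"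
proof -
  assume y: "y \<in> \<Omega>"
  obtain g H where g: "\<And>x. x \<in> \<Omega> \<Longrightarrow> GDERIV (\<lambda>x. k x y) x :> g x"
    and H: "\<And>x. x \<in> \<Omega> \<Longrightarrow> (g has_derivative H x) (at x)"
    using k_harmonic[OF y] unfolding harmonic_on_def by metis
  have "continuous_on \<Omega> g"
    using H has_derivative_continuous continuous_at_imp_continuous_on by blast
  moreover have "g x = dk x y" if "x \<in> \<Omega>" for x
    using GDERIV_unique[OF g[OF that] GDERIV_k[OF that y]] .
  ultimately show ?thesis by (simp cong: continuous_on_cong)
qed

lemma k_fst_continuous: "y \<in> \<Omega> \<Longrightarrow> continuous_on \<Omega> (\<lambda>x. k x y)"
  by (rule continuous_on_subset[OF k_continuous closure_subset])

text \<open>The interior gradient bound for the harmonic difference, whose size is known from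
  \<open>k_lipschitz_snd\<close>.\<close>

lemma dk_lipschitz_snd:
  assumes "x \<in> \<Omega>" "y \<in> \<Omega>" "z \<in> \<Omega>" "m > 0" "bdist y \<ge> m" "bdist z \<ge> m"
  shows "norm (dk x y - dk x z) \<le> 8 * (dist y z / m) / bdist x"
proof (rule harmonic_gradient_bound[OF bdist_pos[OF assms(1)]])
  note sub = subsetD[OF ball_bdist_subset[OF assms(1) order_refl]]
  show "continuous_on (ball x (bdist x)) (\<lambda>x. k x y - k x z)"
    by (rule continuous_on_subset[OF _ ball_bdist_subset[OF assms(1) order_refl]])
      (intro continuous_intros k_fst_continuous assms)
  show "has_laplacian (\<lambda>x. k x y - k x z) w 0" if "w \<in> ball x (bdist x)" for w
    using has_laplacian_diff[OF k_laplacian[OF sub[OF that] assms(2)] k_laplacian[OF sub[OF that] assms(3)]]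
    by simp
  show "\<bar>k w y - k w z\<bar> \<le> dist y z / m" if "w \<in> ball x (bdist x)" for w
    using sub[OF that] assms closure_subset by (intro k_lipschitz_snd) auto
  show "GDERIV (\<lambda>x. k x y - k x z) x :> dk x y - dk x z"
    by (intro GDERIV_diff GDERIV_k assms)
qed

text \<open>Continuity in the first argument and a Lipschitz bound in the second, locally uniform in
  the first, combine to joint continuity. It is needed for the diagonal and for the flow.\<close>

lemma dk_continuous:
  assumes "x \<in> \<Omega>" "y \<in> \<Omega>"
  shows "((\<lambda>p. dk (fst p) (snd p)) \<longlongrightarrow> dk x y) (nhds (x, y))"
proof -
  define m where "m = bdist y / 2"
  have m: "m > 0" using bdist_pos[OF assms(2)] by (simp add: m_def)
  have fs: "(fst \<longlongrightarrow> x) (nhds (x, y))" "(snd \<longlongrightarrow> y) (nhds (x, y))"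
    by (auto intro!: tendsto_eq_intros filterlim_ident)
  have "isCont (\<lambda>x. dk x y) x"
    using dk_continuous_fst[OF assms(2)] open_dom assms(1) continuous_on_eq_continuous_at by blast
  then have "((\<lambda>p. dk (fst p) y) \<longlongrightarrow> dk x y) (nhds (x, y))"
    by (rule isCont_tendsto_compose[OF _ fs(1)])
  then have "((\<lambda>p. norm (dk (fst p) y - dk x y) + 8 * (dist (snd p) y / m) / bdist (fst p)) \<longlongrightarrow>
      norm (dk x y - dk x y) + 8 * (dist y y / m) / bdist x) (nhds (x, y))"
    using fs m bdist_pos[OF assms(1)] by (intro tendsto_intros) auto
  then have lim: "((\<lambda>p. norm (dk (fst p) y - dk x y) + 8 * (dist (snd p) y / m) / bdist (fst p)) \<longlongrightarrow> 0) (nhds (x, y))"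
    by simp
  have ev: "\<forall>\<^sub>F p in nhds (x, y). fst p \<in> \<Omega> \<and> snd p \<in> \<Omega> \<and> bdist (snd p) > m"
  proof -
    have "((\<lambda>p. bdist (snd p)) \<longlongrightarrow> bdist y) (nhds (x, y))"
      using fs by (intro tendsto_intros)
    moreover have "bdist y > m" using m by (simp add: m_def)
    ultimately have "\<forall>\<^sub>F p in nhds (x, y). bdist (snd p) > m"
      using order_tendstoD by blast
    then show ?thesis
      using topological_tendstoD[OF fs(1) open_dom assms(1)] topological_tendstoD[OF fs(2) open_dom assms(2)]
      by eventually_elim simp
  qed
  have "((\<lambda>p. dk (fst p) (snd p) - dk x y) \<longlongrightarrow> 0) (nhds (x, y))"
  proof (rule Lim_null_comparison[OF _ lim])
    show "\<forall>\<^sub>F p in nhds (x, y). norm (dk (fst p) (snd p) - dk x y)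
        \<le> norm (dk (fst p) y - dk x y) + 8 * (dist (snd p) y / m) / bdist (fst p)"
      using ev
    proof eventually_elim
      case (elim p)
      then have "norm (dk (fst p) (snd p) - dk (fst p) y) \<le> 8 * (dist (snd p) y / m) / bdist (fst p)"
        using m assms(2) by (intro dk_lipschitz_snd) (auto simp: m_def)
      then show ?case
        using norm_triangle_ineq[of "dk (fst p) (snd p) - dk (fst p) y" "dk (fst p) y - dk x y"] by simp
    qed
  qed
  then show ?thesis by (simp add: LIM_zero_iff)
qed

text \<open>Write k(z,z) as (k(z,z) - k(x,z)) + k(x,z). The last term is covered by symmetry; in the
  bracket only the first argument changes, but with moving parameter z, so joint continuity of
  \<open>dk\<close> is combined with the mean value inequality.\<close>

lemma GDERIV_k_diagonal:
  assumes x: "x \<in> \<Omega>" shows "GDERIV (\<lambda>x. k x x) x :> 2 *\<^sub>R dk x x"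
proof -
  have 1: "((\<lambda>z. k z z - k x z) has_derivative (\<lambda>h. h \<bullet> dk x x)) (at x)"
    unfolding has_derivative_at_alt
  proof (intro conjI allI impI)
    fix e :: real assume "e > 0"
    have "\<forall>\<^sub>F p in nhds (x, x). dist (dk (fst p) (snd p)) (dk x x) < e"
      using tendstoD[OF dk_continuous[OF x x] \<open>e > 0\<close>] .
    then obtain A where A: "open A" "(x, x) \<in> A" "\<And>p. p \<in> A \<Longrightarrow> dist (dk (fst p) (snd p)) (dk x x) < e"
      by (auto simp: eventually_nhds)
    then obtain B C where BC: "open B" "open C" "(x, x) \<in> B \<times> C" "B \<times> C \<subseteq> A"
      using open_prod_elim by metis
    have "open (B \<inter> C \<inter> \<Omega>)" "x \<in> B \<inter> C \<inter> \<Omega>" using BC open_dom x by auto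
    then obtain d where "d > 0" and d: "ball x d \<subseteq> B \<inter> C \<inter> \<Omega>"
      using openE by metis
    have "norm ((k z z - k x z) - (k x x - k x x) - (z - x) \<bullet> dk x x) \<le> e * norm (z - x)"
      if "norm (z - x) < d" for z
    proof -
      have z: "z \<in> ball x d" using that by (simp add: dist_norm norm_minus_commute)
      \<comment> \<open>Subtracting the linear function leaves a derivative of norm at most e on the
        whole ball.\<close>
      have "norm ((k z z - z \<bullet> dk x x) - (k x z - x \<bullet> dk x x)) \<le> e * norm (z - x)"
      proof (rule differentiable_bound[OF convex_ball])
        fix w assume w: "w \<in> ball x d"
        show "((\<lambda>w. k w z - w \<bullet> dk x x) has_derivative (\<lambda>h. h \<bullet> dk w z - h \<bullet> dk x x)) (at w within ball x d)"
        proof (rule has_derivative_at_withinI, rule has_derivative_diff)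
          show "((\<lambda>w. k w z) has_derivative (\<lambda>h. h \<bullet> dk w z)) (at w)"
            using GDERIV_k[of w z] w z d unfolding gderiv_def by blast
        qed (rule bounded_linear_imp_has_derivative[OF bounded_linear_inner_left])
        have "(w, z) \<in> A"
          using BC(4) d w z by blast
        then have "dist (dk w z) (dk x x) < e"
          using A(3)[of "(w, z)"] by simp
        then have le: "norm h * norm (dk w z - dk x x) \<le> norm h * e" for h
          by (intro mult_left_mono) (auto simp: dist_norm)
        have "norm (h \<bullet> dk w z - h \<bullet> dk x x) \<le> e * norm h" for h
          using order_trans[OF Cauchy_Schwarz_ineq2[of h "dk w z - dk x x"] le]
          by (simp add: inner_diff_right mult.commute)
        then show "onorm (\<lambda>h. h \<bullet> dk w z - h \<bullet> dk x x) \<le> e"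
          by (rule onorm_le)
      qed (use z \<open>d > 0\<close> in auto)
      then show ?thesis by (simp add: inner_diff_left algebra_simps)
    qed
    then show "\<exists>d>0. \<forall>z. norm (z - x) < d \<longrightarrow>
        norm ((k z z - k x z) - (k x x - k x x) - (z - x) \<bullet> dk x x) \<le> e * norm (z - x)"
      using \<open>d > 0\<close> by blast
  qed (rule bounded_linear_inner_left)
  have "((\<lambda>z. (k z z - k x z) + k x z) has_derivative (\<lambda>h. h \<bullet> dk x x + h \<bullet> dk x x)) (at x)"
    by (rule has_derivative_add[OF 1 GDERIV_k_snd[OF x x, unfolded gderiv_def]])
  then show ?thesis
    unfolding gderiv_def by (simp add: mult_2[symmetric])
qed

text \<open>On the ball of radius d around y the difference from the image potential is O(d), and
  the gradient bound divides by d, leaving a constant. As y - s = 2 (y - p), the gradient of the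
  image potential at y is (y - p) / (4 \<pi> d^2).\<close>

lemma dk_diagonal_estimate:
  assumes "y \<in> \<Omega>" "foot y p" "bdist y \<le> \<rho> / 2"
  shows "norm (dk y y - (1 / (4 * pi * (bdist y)\<^sup>2)) *\<^sub>R (y - p)) \<le> 8 / (pi * \<rho>)"
proof -
  define d s where "d = bdist y" and "s = 2 *\<^sub>R p - y"
  have d: "d > 0" using bdist_pos assms by (simp add: d_def)
  have s: "s \<notin> closure \<Omega>" unfolding s_def by (rule mirror_image(1)[OF assms])
  note sub = subsetD[OF ball_bdist_subset[OF assms(1) order_refl, folded d_def]]
  have ns: "w \<noteq> s" if "w \<in> \<Omega>" for w using s that closure_subset by blast
  have ys: "y - s = 2 *\<^sub>R (y - p)" by (simp add: s_def algebra_simps scaleR_2)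
  have "norm (y - p) = d" using assms(2) by (simp add: foot_def dist_norm d_def)
  then have "(1 / (2 * pi)) *\<^sub>R ((1 / (norm (y - s))\<^sup>2) *\<^sub>R (y - s)) = (1 / (4 * pi * d\<^sup>2)) *\<^sub>R (y - p)"
    unfolding ys by (simp del: scaleR_right_diff_distrib add: power_mult_distrib mult.commute)
  moreover have "norm (dk y y - (1 / (2 * pi)) *\<^sub>R ((1 / (norm (y - s))\<^sup>2) *\<^sub>R (y - s)))
      \<le> 8 * (d / (pi * \<rho>)) / d"
  proof (rule harmonic_gradient_bound[OF d])
    show "continuous_on (ball y d) (\<lambda>z. k z y - 1 / (2 * pi) * ln (norm (z - s)))"
      using sub ns
      by (intro continuous_intros continuous_on_subset[OF k_fst_continuous[OF assms(1)]]) auto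
    show "has_laplacian (\<lambda>z. k z y - 1 / (2 * pi) * ln (norm (z - s))) w 0" if "w \<in> ball y d" for w
    proof -
      have "has_laplacian (\<lambda>z. k z y - 1 / (2 * pi) * ln (norm (z - s))) w (0 - 1 / (2 * pi) * 0)"
        using sub[OF that] ns assms(1)
        by (intro has_laplacian_diff has_laplacian_cmult has_laplacian_ln_norm k_laplacian) auto
      then show ?thesis by simp
    qed
    show "\<bar>k w y - 1 / (2 * pi) * ln (norm (w - s))\<bar> \<le> d / (pi * \<rho>)" if "w \<in> ball y d" for w
      unfolding s_def d_def using sub[OF that] closure_subset assms by (intro k_mirror_estimate) auto
    show "GDERIV (\<lambda>z. k z y - 1 / (2 * pi) * ln (norm (z - s))) y :>
        dk y y - (1 / (2 * pi)) *\<^sub>R ((1 / (norm (y - s))\<^sup>2) *\<^sub>R (y - s))"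
      using ns assms(1) by (intro GDERIV_diff GDERIV_cmult GDERIV_ln_norm GDERIV_k) auto
  qed
  ultimately show ?thesis using d by (simp add: d_def)
qed

text \<open>The bound must survive when x, the other dislocation, approaches the frontier. By
  symmetry \<open>k\<close> near y is evaluated with its pole near y, where the boundary data lie
  between ln (m/2) and ln (2R).\<close>

lemma dk_bound_interior:
  assumes "m > 0"
  obtains B where "B \<ge> 0" "\<And>x y. x \<in> \<Omega> \<Longrightarrow> y \<in> \<Omega> \<Longrightarrow> bdist y \<ge> m \<Longrightarrow> norm (dk y x) \<le> B"
proof -
  obtain R where R: "R > 0" "\<And>x. x \<in> closure \<Omega> \<Longrightarrow> norm x \<le> R"
    using bounded_closure[OF bounded_dom] bounded_pos by blast
  define L where "L = \<bar>ln (m / 2)\<bar> + \<bar>ln (2 * R)\<bar>"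
  have kL: "\<bar>k x w\<bar> \<le> L" if "x \<in> closure \<Omega>" "w \<in> \<Omega>" "bdist w \<ge> m / 2" for x w
  proof (rule maximum_principle_abs[OF open_dom bounded_dom k_continuous[OF that(2)] _ _ that(1)])
    show "has_laplacian (\<lambda>x. k x w) x 0" if "x \<in> \<Omega>" for x
      using k_laplacian that \<open>w \<in> \<Omega>\<close> by blast
    fix q assume q: "q \<in> frontier \<Omega>"
    have a: "m / 2 \<le> norm (q - w)" using bdist_le[OF q, of w] that by linarith
    have "norm (q - w) \<le> norm q + norm w" by (rule norm_triangle_ineq4)
    also have "\<dots> \<le> 2 * R"
      using R(2)[of q] R(2)[of w] q that closure_subset[of \<Omega>] by (force simp: frontier_def)
    finally have b: "norm (q - w) \<le> 2 * R" .
    have "norm (q - w) > 0" using a assms by linarith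
    have "ln (m / 2) \<le> ln (norm (q - w))" "ln (norm (q - w)) \<le> ln (2 * R)"
      using a b assms \<open>norm (q - w) > 0\<close> by (intro ln_mono; linarith)+
    then have "\<bar>ln (norm (q - w))\<bar> \<le> L" unfolding L_def by linarith
    then have "1 / (2 * pi) * \<bar>ln (norm (q - w))\<bar> \<le> 1 * L"
      using pi_gt3 by (intro mult_mono) (auto simp: divide_le_eq)
    then show "\<bar>k q w\<bar> \<le> L"
      unfolding k_frontier[OF that(2) q] by (simp add: abs_mult)
  qed
  have "norm (dk y x) \<le> 8 * L / (m / 2)" if "x \<in> \<Omega>" "y \<in> \<Omega>" "bdist y \<ge> m" for x y
  proof (rule harmonic_gradient_bound)
    have sub: "w \<in> \<Omega>" if "w \<in> ball y (m / 2)" for w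
      using ball_bdist_subset[OF \<open>y \<in> \<Omega>\<close>, of "m / 2"] that \<open>bdist y \<ge> m\<close> assms by auto
    show "m / 2 > 0" using assms by simp
    show "continuous_on (ball y (m / 2)) (\<lambda>z. k z x)"
      using sub by (intro continuous_on_subset[OF k_fst_continuous[OF that(1)]]) auto
    show "has_laplacian (\<lambda>z. k z x) w 0" if "w \<in> ball y (m / 2)" for w
      using k_laplacian[OF sub[OF that] \<open>x \<in> \<Omega>\<close>] .
    show "\<bar>k w x\<bar> \<le> L" if "w \<in> ball y (m / 2)" for w
    proof -
      have "bdist w \<ge> m / 2"
        using infdist_le_add[of y "frontier \<Omega>" w] that \<open>bdist y \<ge> m\<close> by simp
      then have "\<bar>k x w\<bar> \<le> L"
        using kL[of x w] sub[OF that] \<open>x \<in> \<Omega>\<close> closure_subset by blast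
      then show ?thesis using k_symmetric[OF sub[OF that] \<open>x \<in> \<Omega>\<close>] by simp
    qed
    show "GDERIV (\<lambda>z. k z x) y :> dk y x" using GDERIV_k that by blast
  qed
  moreover have "8 * L / (m / 2) \<ge> 0" using assms by (simp add: L_def)
  ultimately show ?thesis using that by blast
qed

text \<open>By symmetry of \<open>k\<close> the function \<open>k(\<cdot>, y) - ln |\<cdot> - y| / (2 \<pi>)\<close> is \<open>O(bdist)\<close> near the
  boundary, so the interior gradient bound stays finite there.\<close>

lemma green_gradient_bound_near_frontier:
  assumes "x \<in> \<Omega>" "y \<in> \<Omega>" "m > 0" "bdist y \<ge> m" "bdist x \<le> \<rho> / 4" "bdist x \<le> m / 8"
  shows "norm (dk x y - (1 / (2 * pi)) *\<^sub>R ((1 / (norm (x - y))\<^sup>2) *\<^sub>R (x - y))) \<le> 16 * (1 / \<rho> + 4 / m)"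
proof -
  define d where "d = bdist x"
  have d: "d > 0" "d \<le> \<rho> / 4" "d \<le> m / 8" using bdist_pos assms by (auto simp: d_def)
  note sub = subsetD[OF ball_bdist_subset[OF assms(1) order_refl, folded d_def]]
  \<comment> \<open>The whole ball stays within 2d of the frontier: 2d \<le> \<rho>/2 admits the
    mirror image, and 2d \<le> m/4 keeps y away.\<close>
  have far: "m / 2 \<le> norm (w - y)" "bdist w \<le> 2 * d" if "w \<in> ball x d" for w
  proof -
    show *: "bdist w \<le> 2 * d"
      using infdist_le_add[of w "frontier \<Omega>" x] that by (simp add: d_def dist_commute)
    show "m / 2 \<le> norm (w - y)"
      using infdist_le_add[of y "frontier \<Omega>" w] * assms d by (simp add: dist_norm norm_minus_commute)
  qed
  have ny: "w \<noteq> y" if "w \<in> ball x d" for w using far(1)[OF that] assms(3) by auto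
  have "norm (dk x y - (1 / (2 * pi)) *\<^sub>R ((1 / (norm (x - y))\<^sup>2) *\<^sub>R (x - y)))
      \<le> 8 * (2 * d * (1 / \<rho> + 4 / m)) / d"
  proof (rule harmonic_gradient_bound[OF d(1)])
    show "continuous_on (ball x d) (\<lambda>z. k z y - 1 / (2 * pi) * ln (norm (z - y)))"
      using sub ny
      by (intro continuous_intros continuous_on_subset[OF k_fst_continuous[OF assms(2)]]) auto
    show "has_laplacian (\<lambda>z. k z y - 1 / (2 * pi) * ln (norm (z - y))) w 0" if "w \<in> ball x d" for w
    proof -
      have "has_laplacian (\<lambda>z. k z y - 1 / (2 * pi) * ln (norm (z - y))) w (0 - 1 / (2 * pi) * 0)"
        using sub[OF that] ny[OF that] assms(2)
        by (intro has_laplacian_diff has_laplacian_cmult has_laplacian_ln_norm k_laplacian) auto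
      then show ?thesis by simp
    qed
    show "GDERIV (\<lambda>z. k z y - 1 / (2 * pi) * ln (norm (z - y))) x :>
        dk x y - (1 / (2 * pi)) *\<^sub>R ((1 / (norm (x - y))\<^sup>2) *\<^sub>R (x - y))"
      using ny d assms by (intro GDERIV_diff GDERIV_cmult GDERIV_ln_norm GDERIV_k) auto
    fix w assume w: "w \<in> ball x d"
    obtain p where p: "foot w p" using ex_foot sub[OF w] by blast
    then have pf: "p \<in> frontier \<Omega>" and pd: "norm (w - p) = bdist w" by (auto simp: foot_def dist_norm)
    define s where "s = 2 *\<^sub>R p - w"
    have bw: "bdist w \<le> 2 * d" by (rule far(2)[OF w])
    \<comment> \<open>The variable point w, not y, is the pole that gets reflected. Its image is
      only 2 \<open>bdist w\<close> away from it, so ln |y - s| can be exchanged for ln |w -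
      y|.\<close>
    have "\<bar>k y w - 1 / (2 * pi) * ln (norm (y - s))\<bar> \<le> bdist w / (pi * \<rho>)"
      unfolding s_def using sub[OF w] assms(2) closure_subset p bw d by (intro k_mirror_estimate) auto
    also have "\<dots> \<le> bdist w / \<rho>"
      using pi_gt3 rho_pos by (intro divide_left_mono) (auto simp: infdist_nonneg)
    finally have 1: "\<bar>k w y - 1 / (2 * pi) * ln (norm (y - s))\<bar> \<le> bdist w / \<rho>"
      using k_symmetric[OF sub[OF w] assms(2)] by simp
    have ps: "norm (p - s) = bdist w"
      using pd by (simp add: s_def scaleR_2 norm_minus_commute)
    have ws: "norm (w - s) = 2 * bdist w"
    proof -
      have "w - s = 2 *\<^sub>R (w - p)" by (simp add: s_def algebra_simps scaleR_2)
      then show ?thesis using pd by simp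
    qed
    have "m \<le> norm (y - p)"
      using bdist_le[OF pf, of y] assms(4) by (simp add: norm_minus_commute)
    moreover have "norm (y - p) \<le> norm (y - s) + norm (p - s)"
      using norm_triangle_ineq4[of "y - s" "p - s"] by simp
    ultimately have "\<bar>ln (norm (y - s)) - ln (norm (w - y))\<bar> \<le> \<bar>norm (y - s) - norm (w - y)\<bar> / (m / 2)"
      using ps bw d far(1)[OF w] assms(3) by (intro abs_ln_diff_le) auto
    also have "\<dots> \<le> 2 * bdist w / (m / 2)"
    proof -
      have "\<bar>norm (y - s) - norm (y - w)\<bar> \<le> 2 * bdist w"
        using norm_triangle_ineq3[of "y - s" "y - w"] ws by simp
      then show ?thesis
        using assms(3) by (intro divide_right_mono) (auto simp: norm_minus_commute)
    qed
    finally have "1 / (2 * pi) * \<bar>ln (norm (y - s)) - ln (norm (w - y))\<bar> \<le> 1 * (2 * bdist w / (m / 2))"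
      using pi_gt3 by (intro mult_mono) (auto simp: divide_le_eq)
    then have 2: "\<bar>1 / (2 * pi) * ln (norm (y - s)) - 1 / (2 * pi) * ln (norm (w - y))\<bar> \<le> 4 * bdist w / m"
      by (subst abs_cmult_diff) simp_all
    have "\<bar>k w y - 1 / (2 * pi) * ln (norm (w - y))\<bar> \<le> bdist w * (1 / \<rho> + 4 / m)"
      using 1 2 by (simp add: distrib_left)
    also have "\<dots> \<le> 2 * d * (1 / \<rho> + 4 / m)"
      using bw rho_pos assms(3) by (intro mult_right_mono) auto
    finally show "\<bar>k w y - 1 / (2 * pi) * ln (norm (w - y))\<bar> \<le> 2 * d * (1 / \<rho> + 4 / m)" .
  qed
  then show ?thesis using d(1) by simp
qed

end

section \<open>Solutions of differential equations as limits of Euler polygons\<close>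

text \<open>Tychonoff's theorem for a family of closed balls.\<close>

lemma compact_Pi_cball:
  fixes c :: "'b \<Rightarrow> 'a::heine_borel"
  shows "compact {f. \<forall>x. f x \<in> cball (c x) (r x)}"
proof -
  have "{f. \<forall>x. f x \<in> cball (c x) (r x)} = PiE UNIV (\<lambda>x. cball (c x) (r x))"
    by (auto simp: PiE_def Pi_def)
  moreover have "compactin (product_topology (\<lambda>_. euclidean) UNIV) (PiE UNIV (\<lambda>x. cball (c x) (r x)))"
    unfolding compactin_PiE by (simp add: compact_cball)
  ultimately show ?thesis
    by (simp add: euclidean_product_topology)
qed

text \<open>The index x ranges over an arbitrary type, later over pairs of a time and a component,
  so a convergent subsequence need not exist. A cluster point of the product space yields instead a
  filter finer than \<open>sequentially\<close> along which all coordinates converge at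
  once.\<close>

lemma pointwise_cluster_function:
  fixes f :: "nat \<Rightarrow> 'b \<Rightarrow> 'a::heine_borel"
  assumes "\<And>m x. f m x \<in> cball (c x) (r x)"
  obtains G g where "G \<le> sequentially" "G \<noteq> bot" "\<And>x. ((\<lambda>m. f m x) \<longlongrightarrow> g x) G"
proof -
  let ?K = "{f. \<forall>x. f x \<in> cball (c x) (r x)}"
  have "eventually (\<lambda>z. z \<in> ?K) (filtermap f sequentially)"
    using assms by (simp add: eventually_filtermap)
  moreover have "filtermap f sequentially \<noteq> bot"
    by (simp add: filtermap_bot_iff)
  ultimately obtain g where g: "inf (nhds g) (filtermap f sequentially) \<noteq> bot"
    using compact_Pi_cball[of c r, unfolded compact_filter, rule_format, of "filtermap f sequentially"]
    by blast
  \<comment> \<open>Indices whose function is close to the cluster point, intersected with the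
    tails.\<close>
  define G where "G = inf (filtercomap f (nhds g)) sequentially"
  have "G \<noteq> bot"
  proof
    assume "G = bot"
    then have "eventually (\<lambda>_. False) G" by simp
    then obtain P Q where P: "eventually P (filtercomap f (nhds g))" and Q: "eventually Q sequentially"
      and PQ: "\<And>m. \<not> (P m \<and> Q m)"
      unfolding G_def eventually_inf by blast
    then obtain P' where P': "eventually P' (nhds g)" "\<And>m. P' (f m) \<Longrightarrow> P m"
      unfolding eventually_filtercomap by blast
    have "eventually (\<lambda>z. \<not> P' z) (filtermap f sequentially)"
      unfolding eventually_filtermap using Q by eventually_elim (use PQ P' in blast)
    then have "eventually (\<lambda>_. False) (inf (nhds g) (filtermap f sequentially))"
      unfolding eventually_inf using P'(1) by blast
    then show False using g trivial_limit_def by blast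
  qed
  moreover have "G \<le> sequentially" by (simp add: G_def)
  moreover have "((\<lambda>m. f m x) \<longlongrightarrow> g x) G" for x
  proof -
    have "filterlim f (nhds g) G"
      unfolding G_def by (rule filterlim_mono[OF filterlim_filtercomap order_refl inf_le1])
    then show ?thesis
      by (rule continuous_on_tendsto_compose[OF continuous_on_product_coordinates]) auto
  qed
  ultimately show ?thesis using that by blast
qed

section \<open>Euler polygons and Peano's theorem\<close>

context
  fixes \<Phi> :: "('i \<Rightarrow> 'a::euclidean_space) \<Rightarrow> 'i \<Rightarrow> 'a" and x0 :: "'i \<Rightarrow> 'a" and h :: real
begin

fun euler :: "nat \<Rightarrow> 'i \<Rightarrow> 'a" where
  "euler 0 i = x0 i"
| "euler (Suc l) i = euler l i + h *\<^sub>R \<Phi> (euler l) i"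

end

text \<open>With v = 0 this is the speed bound; with v the field at a limit point it gives the
  derivative of the limit curve.\<close>

lemma euler_increment_bound:
  assumes "h \<ge> 0" "l \<le> l'" and "\<And>j. l \<le> j \<Longrightarrow> j < l' \<Longrightarrow> norm (\<Phi> (euler \<Phi> x0 h j) i - v) \<le> e"
  shows "norm (euler \<Phi> x0 h l' i - euler \<Phi> x0 h l i - (h * (real l' - real l)) *\<^sub>R v) \<le> h * (real l' - real l) * e"
  using assms(2,3)
proof (induction l' rule: dec_induct)
  case (step n)
  have "euler \<Phi> x0 h (Suc n) i - euler \<Phi> x0 h l i - (h * (real (Suc n) - real l)) *\<^sub>R v
      = (euler \<Phi> x0 h n i - euler \<Phi> x0 h l i - (h * (real n - real l)) *\<^sub>R v)
        + h *\<^sub>R (\<Phi> (euler \<Phi> x0 h n) i - v)"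
    by (simp add: algebra_simps)
  also have "norm \<dots> \<le> h * (real n - real l) * e + h * e"
  proof (intro order_trans[OF norm_triangle_ineq] add_mono)
    show "norm (h *\<^sub>R (\<Phi> (euler \<Phi> x0 h n) i - v)) \<le> h * e"
      using step assms(1) by (simp add: mult_left_mono)
  qed (use step in auto)
  finally show ?case by (simp add: algebra_simps)
qed simp

text \<open>The curve is a cluster point, for pointwise convergence, of the Euler step functions with
  step \<open>1 / (m + 1)\<close>.\<close>

proposition peano_existence:
  fixes \<Phi> :: "('i \<Rightarrow> 'a::euclidean_space) \<Rightarrow> 'i \<Rightarrow> 'a" and x0 :: "'i \<Rightarrow> 'a"
  assumes bd: "\<And>z i. norm (\<Phi> z i) \<le> M" and "finite J"
    and cont: "\<And>z f i. z \<in> U \<Longrightarrow> (\<And>j. j \<in> J \<Longrightarrow> (\<lambda>q. f q j) \<longlonglongrightarrow> z j) \<Longrightarrow> (\<lambda>q. \<Phi> (f q) i) \<longlonglongrightarrow> \<Phi> z i"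
  obtains w where "w 0 = x0"
    "\<And>s t i. s \<ge> 0 \<Longrightarrow> t \<ge> 0 \<Longrightarrow> norm (w t i - w s i) \<le> M * \<bar>t - s\<bar>"
    "\<And>s i. s \<ge> 0 \<Longrightarrow> w s \<in> U \<Longrightarrow> ((\<lambda>s. w s i) has_vector_derivative \<Phi> (w s) i) (at s within {0..})"
proof -
  have M: "M \<ge> 0" using bd norm_ge_zero order_trans by blast
  define h where "h m = 1 / (real m + 1)" for m
  have h: "h m > 0" for m by (simp add: h_def)
  define p where "p m = euler \<Phi> x0 (h m)" for m
  \<comment> \<open>The last grid index not after t.\<close>
  define N where "N m t = nat \<lfloor>t * (real m + 1)\<rfloor>" for m t
  have N: "h m * real (N m t) \<le> t" "t \<le> h m * real (N m t) + h m" if "t \<ge> 0" for m t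
  proof -
    have "real (N m t) = of_int \<lfloor>t * (real m + 1)\<rfloor>"
      using that by (simp add: N_def)
    then have "real (N m t) \<le> t * (real m + 1)" "t * (real m + 1) \<le> real (N m t) + 1"
      by linarith+
    then show "h m * real (N m t) \<le> t" "t \<le> h m * real (N m t) + h m"
      by (simp_all add: h_def field_simps)
  qed
  have Nmono: "N m s \<le> N m t" if "s \<le> t" for m s t
    unfolding N_def using that by (intro nat_mono floor_mono mult_right_mono) auto
  have lip0: "norm (p m l' i - p m l i) \<le> M * \<bar>h m * real l' - h m * real l\<bar>" for m l l' i
  proof -
    have *: "norm (p m l' i - p m l i) \<le> M * (h m * real l' - h m * real l)" if "l \<le> l'" for l l'
      using euler_increment_bound[of "h m" l l' \<Phi> x0 i 0 M] h[of m] that bd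
      by (simp add: p_def algebra_simps)
    show ?thesis
    proof (cases "l \<le> l'")
      case True
      then show ?thesis using *[OF True] h[of m] by (simp add: abs_of_nonneg mult_left_mono)
    next
      case False
      then have "l' \<le> l" by simp
      then show ?thesis using *[OF \<open>l' \<le> l\<close>] h[of m]
        by (simp add: norm_minus_commute abs_of_nonpos mult_left_mono)
    qed
  qed
  \<comment> \<open>For negative times \<open>nat\<close> truncates the index to 0, so that the
    bound holds for all real times, as the cluster argument requires.\<close>
  have "p m (N m (fst x)) (snd x) \<in> cball (x0 (snd x)) (M * \<bar>fst x\<bar>)" for m x
  proof (cases "fst x \<ge> 0")
    case True
    have "norm (p m (N m (fst x)) (snd x) - p m 0 (snd x)) \<le> M * \<bar>h m * real (N m (fst x)) - h m * real 0\<bar>"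
      by (rule lip0)
    also have "\<dots> \<le> M * \<bar>fst x\<bar>"
      using N(1)[OF True, of m] h[of m] M True by (intro mult_left_mono) auto
    finally show ?thesis by (simp add: p_def dist_norm norm_minus_commute)
  next
    case False
    then have "N m (fst x) = 0"
      unfolding N_def by (simp add: floor_le_iff not_le mult_neg_pos order.strict_trans[OF mult_neg_pos])
    then show ?thesis using M by (simp add: p_def)
  qed
  then obtain G g where G: "G \<le> sequentially" "G \<noteq> bot"
    and g: "\<And>x. ((\<lambda>m. p m (N m (fst x)) (snd x)) \<longlongrightarrow> g x) G"
    by (rule pointwise_cluster_function[of "\<lambda>m x. p m (N m (fst x)) (snd x)"]) blast
  define w where "w t i = g (t, i)" for t i
  have w: "((\<lambda>m. p m (N m t) i) \<longlongrightarrow> w t i) G" for t i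
    using g[of "(t, i)"] by (simp add: w_def)
  have h0: "(h \<longlongrightarrow> 0) G"
  proof (rule tendsto_mono[OF G(1)])
    show "h \<longlonglongrightarrow> 0" unfolding h_def
      using LIMSEQ_inverse_real_of_nat by (simp add: inverse_eq_divide add.commute)
  qed
  have hN: "\<bar>h m * real (N m t) - h m * real (N m s)\<bar> \<le> \<bar>t - s\<bar> + h m" if "s \<ge> 0" "t \<ge> 0" for m s t
    using N[OF that(1), of m] N[OF that(2), of m] by linarith
  show ?thesis
  proof
    have "N m 0 = 0" for m by (simp add: N_def)
    then have "((\<lambda>m. x0 i) \<longlongrightarrow> w 0 i) G" for i
      using w[of 0 i] by (simp add: p_def)
    then show "w 0 = x0"
      using tendsto_unique[OF G(2)] tendsto_const by (metis ext)
  next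
    fix s t :: real and i assume st: "s \<ge> 0" "t \<ge> 0"
    have "norm (p m (N m t) i - p m (N m s) i) \<le> M * (\<bar>t - s\<bar> + h m)" for m
      by (rule order_trans[OF lip0]) (use hN[OF st] M in \<open>intro mult_left_mono\<close>)
    moreover have "((\<lambda>m. norm (p m (N m t) i - p m (N m s) i)) \<longlongrightarrow> norm (w t i - w s i)) G"
      by (intro tendsto_intros w)
    moreover have "((\<lambda>m. M * (\<bar>t - s\<bar> + h m)) \<longlongrightarrow> M * (\<bar>t - s\<bar> + 0)) G"
      by (intro tendsto_intros h0)
    ultimately have "norm (w t i - w s i) \<le> M * (\<bar>t - s\<bar> + 0)"
      using tendsto_le[OF G(2)] by (metis (no_types, lifting) always_eventually)
    then show "norm (w t i - w s i) \<le> M * \<bar>t - s\<bar>" by simp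
  next
    fix s :: real and i assume s: "s \<ge> 0" "w s \<in> U"
    define v where "v = \<Phi> (w s) i"
    \<comment> \<open>Continuity is given along sequences and in the coordinates of J only; a
      counterexample at each radius 1 / (q + 1) would form such a sequence.\<close>
    have local: "\<exists>d>0. \<forall>z. (\<forall>j\<in>J. dist (z j) (w s j) < d) \<longrightarrow> norm (\<Phi> z i - v) < e" if "e > 0" for e
    proof (rule ccontr)
      assume neg: "\<not> ?thesis"
      have "\<exists>z. (\<forall>j\<in>J. dist (z j) (w s j) < inverse (real (Suc q))) \<and> \<not> norm (\<Phi> z i - v) < e" for q
      proof -
        have "inverse (real (Suc q)) > 0" by simp
        then show ?thesis using neg by blast
      qed
      then obtain z where z: "\<And>q j. j \<in> J \<Longrightarrow> dist (z q j) (w s j) < inverse (real (Suc q))"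
        "\<And>q. \<not> norm (\<Phi> (z q) i - v) < e"
        by metis
      have "(\<lambda>q. z q j) \<longlonglongrightarrow> w s j" if "j \<in> J" for j
        by (rule metric_tendsto_imp_tendsto[OF LIMSEQ_inverse_real_of_nat])
          (use z(1)[OF that] less_imp_le in \<open>auto intro!: always_eventually simp: less_imp_le\<close>)
      then have "(\<lambda>q. \<Phi> (z q) i) \<longlonglongrightarrow> v"
        unfolding v_def by (rule cont[OF s(2)])
      from tendstoD[OF this \<open>e > 0\<close>] z(2) show False
        by (simp add: dist_norm)
    qed
    \<comment> \<open>Both end points vary near s: a = s and b = s then give the quotients from the
      right and from the left.\<close>
    have main: "\<exists>d>0. \<forall>a b. 0 \<le> a \<longrightarrow> a \<le> b \<longrightarrow> \<bar>a - s\<bar> < d \<longrightarrow> \<bar>b - s\<bar> < d \<longrightarrow>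
        norm (w b i - w a i - (b - a) *\<^sub>R v) \<le> e * (b - a)" if "e > 0" for e
    proof -
      obtain d where "d > 0" and d: "\<And>z. (\<And>j. j \<in> J \<Longrightarrow> dist (z j) (w s j) < d) \<Longrightarrow> norm (\<Phi> z i - v) < e"
        using local[OF \<open>e > 0\<close>] by metis
      \<comment> \<open>With speed M, grid points within time 2r of each other are at most d/2
        apart; the approximation error d/4 still leaves room below d.\<close>
      define r where "r = d / (4 * (M + 1))"
      have r: "r > 0" "M * r \<le> d / 4"
        using \<open>d > 0\<close> M by (auto simp: r_def field_simps)
      have "norm (w b i - w a i - (b - a) *\<^sub>R v) \<le> e * (b - a)"
        if ab: "0 \<le> a" "a \<le> b" "\<bar>a - s\<bar> < r" "\<bar>b - s\<bar> < r" for a b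
      proof -
        have ev1: "\<forall>\<^sub>F m in G. \<forall>j\<in>J. dist (p m (N m s) j) (w s j) < d / 4"
          by (intro eventually_ball_finite[OF \<open>finite J\<close>] ballI tendstoD[OF w])
            (use \<open>d > 0\<close> in simp)
        have ev2: "\<forall>\<^sub>F m in G. h m < r"
          using order_tendstoD(2)[OF h0 r(1)] .
        \<comment> \<open>The extra term is the cost of rounding a and b to the grid; it vanishes
          with the step size.\<close>
        have ev3: "\<forall>\<^sub>F m in G. norm (p m (N m b) i - p m (N m a) i - (b - a) *\<^sub>R v)
            \<le> e * (b - a) + h m * (e + norm v)"
          using ev1 ev2
        proof eventually_elim
          case (elim m)
          let ?D = "h m * (real (N m b) - real (N m a))"
          have Nab: "N m a \<le> N m b" by (rule Nmono[OF ab(2)])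
          have "norm (\<Phi> (p m l) i - v) \<le> e" if l: "N m a \<le> l" "l < N m b" for l
          proof -
            have "h m * real (N m a) \<le> h m * real l" "h m * real l \<le> h m * real (N m b)"
              using l h[of m] by (auto intro!: mult_left_mono)
            then have "\<bar>h m * real l - h m * real (N m s)\<bar> \<le> r + h m"
              using hN[of s a m] hN[of s b m] s ab by (simp add: abs_le_iff)
            then have "M * \<bar>h m * real l - h m * real (N m s)\<bar> \<le> M * (2 * r)"
              using elim(2) M by (intro mult_left_mono) auto
            then have "norm (p m l j - p m (N m s) j) \<le> d / 2" for j
              using lip0[of m l j "N m s"] r(2) by simp
            then have le: "dist (p m l j) (p m (N m s) j) \<le> d / 2" for j
              by (simp add: dist_norm)
            have "dist (p m l j) (w s j) < d" if "j \<in> J" for j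
            proof -
              have "dist (p m (N m s) j) (w s j) < d / 4" using elim(1) that by blast
              then show ?thesis
                using dist_triangle[of "p m l j" "w s j" "p m (N m s) j"] le[of j] \<open>d > 0\<close> by simp
            qed
            then show ?thesis using d less_imp_le by blast
          qed
          then have "norm (p m (N m b) i - p m (N m a) i - ?D *\<^sub>R v) \<le> ?D * e"
            unfolding p_def using h[of m] Nab by (intro euler_increment_bound) auto
          moreover have "norm ((?D - (b - a)) *\<^sub>R v) \<le> h m * norm v"
          proof -
            have "\<bar>?D - (b - a)\<bar> \<le> h m"
              using N[OF ab(1), of m] N[of b m] ab by (simp add: right_diff_distrib)
            then show ?thesis by (simp add: mult_right_mono)
          qed
          moreover have "?D * e \<le> (b - a + h m) * e"
            using N[OF ab(1), of m] N[of b m] ab \<open>e > 0\<close>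
            by (intro mult_right_mono) (auto simp: right_diff_distrib)
          moreover have "p m (N m b) i - p m (N m a) i - (b - a) *\<^sub>R v
              = (p m (N m b) i - p m (N m a) i - ?D *\<^sub>R v) + (?D - (b - a)) *\<^sub>R v"
            by (simp add: scaleR_diff_left)
          ultimately show ?case
            using norm_triangle_ineq[of "p m (N m b) i - p m (N m a) i - ?D *\<^sub>R v" "(?D - (b - a)) *\<^sub>R v"]
            by (simp add: algebra_simps)
        qed
        have "((\<lambda>m. norm (p m (N m b) i - p m (N m a) i - (b - a) *\<^sub>R v)) \<longlongrightarrow>
            norm (w b i - w a i - (b - a) *\<^sub>R v)) G"
          by (intro tendsto_intros w)
        moreover have "((\<lambda>m. e * (b - a) + h m * (e + norm v)) \<longlongrightarrow> e * (b - a) + 0 * (e + norm v)) G"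
          by (intro tendsto_intros h0)
        ultimately show ?thesis
          using tendsto_le[OF G(2) _ _ ev3] by simp
      qed
      then show ?thesis using r(1) by blast
    qed
    show "((\<lambda>s. w s i) has_vector_derivative \<Phi> (w s) i) (at s within {0..})"
      unfolding has_vector_derivative_def has_derivative_within_alt
    proof (intro conjI allI impI)
      fix e :: real assume "e > 0"
      then obtain d where "d > 0" and d: "\<And>a b. 0 \<le> a \<Longrightarrow> a \<le> b \<Longrightarrow> \<bar>a - s\<bar> < d \<Longrightarrow> \<bar>b - s\<bar> < d \<Longrightarrow>
        norm (w b i - w a i - (b - a) *\<^sub>R v) \<le> e * (b - a)"
        using main by metis
      have "norm (w y i - w s i - (y - s) *\<^sub>R v) \<le> e * norm (y - s)" if "y \<ge> 0" "norm (y - s) < d" for y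
      proof (cases "s \<le> y")
        case True
        then show ?thesis using d[of s y] that s \<open>d > 0\<close> by simp
      next
        case False
        then have "norm (w s i - w y i - (s - y) *\<^sub>R v) \<le> e * (s - y)"
          using d[of y s] that s \<open>d > 0\<close> by simp
        moreover have "w s i - w y i - (s - y) *\<^sub>R v = - (w y i - w s i - (y - s) *\<^sub>R v)"
          by (simp add: algebra_simps)
        ultimately show ?thesis using False by (simp only: norm_minus_cancel) simp
      qed
      then show "\<exists>d>0. \<forall>y\<in>{0..}. norm (y - s) < d \<longrightarrow>
          norm (w y i - w s i - (y - s) *\<^sub>R \<Phi> (w s) i) \<le> e * norm (y - s)"
        using \<open>d > 0\<close> by (auto simp: v_def)
    qed (rule bounded_linear_scaleR_left)
  qed
qed

section \<open>The gradient of the energy near the boundary\<close>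

text \<open>For functions such as a distance that may fail to be differentiable. After tilting by a
  slope slightly below c, consider the last time at which the initial level is not exceeded: the
  touching function strictly decreases there, and f lies below it, so a later such time
  exists.\<close>

lemma decreasing_by_upper_touching:
  fixes f :: "real \<Rightarrow> real"
  assumes "a \<le> b" and cont: "continuous_on {a..b} f"
    and touch: "\<And>t. a \<le> t \<Longrightarrow> t < b \<Longrightarrow>
      \<exists>g D. g t = f t \<and> (\<forall>s\<in>{t..b}. f s \<le> g s) \<and> D \<le> - c \<and> (g has_real_derivative D) (at t within {a..})"
  shows "f b \<le> f a - c * (b - a)"
proof (rule ccontr)
  assume neg: "\<not> ?thesis"
  then have "a < b" using \<open>a \<le> b\<close> by (cases "a = b") auto
  \<comment> \<open>Half the mean excess slope, so that the tilted function still rises by e (b - a)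
    over the interval.\<close>
  define e where "e = (f b - f a + c * (b - a)) / (2 * (b - a))"
  have "e > 0" using neg \<open>a < b\<close> by (simp add: e_def)
  have "2 * (b - a) \<noteq> 0" using \<open>a < b\<close> by simp
  from nonzero_eq_divide_eq[OF this] have eb: "e * (2 * (b - a)) = f b - f a + c * (b - a)"
    unfolding e_def by blast
  define \<phi> where "\<phi> t = f t + (c - e) * (t - a)" for t
  have "\<phi> b = f a + e * (b - a)"
    using eb by (simp add: \<phi>_def algebra_simps)
  then have \<phi>: "\<phi> a < \<phi> b"
    using \<open>e > 0\<close> \<open>a < b\<close> by (simp add: \<phi>_def)
  define A where "A = {t \<in> {a..b}. \<phi> t \<le> \<phi> a}"
  have "continuous_on {a..b} \<phi>"
    unfolding \<phi>_def by (intro continuous_intros cont)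
  then have "closed A"
    unfolding A_def by (intro continuous_on_closed_Collect_le continuous_intros) auto
  moreover have "bounded A"
    by (rule bounded_subset[OF bounded_closed_interval[of a b]]) (auto simp: A_def)
  ultimately have "compact A"
    using compact_eq_bounded_closed by blast
  moreover have "a \<in> A" using \<open>a \<le> b\<close> by (simp add: A_def)
  ultimately have "\<exists>t\<in>A. \<forall>s\<in>A. s \<le> t"
    by (intro compact_attains_sup) auto
  then obtain t where t: "t \<in> A" "\<And>s. s \<in> A \<Longrightarrow> s \<le> t"
    by blast
  then have "a \<le> t" "t < b" "\<phi> t \<le> \<phi> a"
    using \<phi> by (auto simp: A_def less_le)
  then obtain g D where g: "g t = f t" "\<And>s. s \<in> {t..b} \<Longrightarrow> f s \<le> g s" "D \<le> - c"
    "(g has_real_derivative D) (at t within {a..})"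
    using touch by meson
  have "((\<lambda>s. g s + (c - e) * (s - a)) has_real_derivative D + (c - e)) (at t within {a..})"
    using g(4) by (auto intro!: derivative_eq_intros)
  from has_real_derivative_neg_dec_right[OF this] g(3) \<open>e > 0\<close>
  obtain d where "d > 0" and d: "\<And>h. h > 0 \<Longrightarrow> t + h \<in> {a..} \<Longrightarrow> h < d \<Longrightarrow>
      g (t + h) + (c - e) * (t + h - a) < g t + (c - e) * (t - a)"
    by auto
  define h where "h = min (d / 2) (b - t)"
  have h: "h > 0" "h < d" "t + h \<le> b"
    using \<open>d > 0\<close> \<open>t < b\<close> by (auto simp: h_def)
  have "\<phi> (t + h) < \<phi> t"
    using d[of h] g(1) g(2)[of "t + h"] h \<open>a \<le> t\<close> by (simp add: \<phi>_def)
  then have "t + h \<in> A"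
    using \<open>\<phi> t \<le> \<phi> a\<close> h \<open>a \<le> t\<close> by (simp add: A_def)
  then show False using t(2) h by force
qed

text \<open>The original time is the integral of \<open>e\<close>, and \<tau> is its inverse. Since
  \<open>e\<close> may vanish at S, as it does at the collision, only continuity of \<tau> is
  claimed at the right end.\<close>

lemma time_change:
  fixes e :: "real \<Rightarrow> real"
  assumes "S > 0" and cont: "continuous_on {0..S} e" and pos: "\<And>s. 0 \<le> s \<Longrightarrow> s < S \<Longrightarrow> e s > 0"
  obtains \<tau> where "integral {0..S} e > 0" "\<tau> 0 = 0" "\<tau> (integral {0..S} e) = S"
    "continuous_on {0..integral {0..S} e} \<tau>" "\<tau> ` {0..integral {0..S} e} \<subseteq> {0..S}"
    "\<And>t. 0 \<le> t \<Longrightarrow> t < integral {0..S} e \<Longrightarrow> \<tau> t < S"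
    "\<And>t. 0 \<le> t \<Longrightarrow> t < integral {0..S} e \<Longrightarrow> (\<tau> has_real_derivative 1 / e (\<tau> t)) (at t)"
proof -
  \<comment> \<open>Prolonging \<open>e\<close> to the left of 0 makes the derivative of \<open>\<tau>\<close> at 0 two-sided.\<close>
  define E where "E s = e (max 0 s)" for s
  define \<theta> where "\<theta> s = integral {-1..s} E - integral {-1..0} E" for s
  have E: "continuous_on {-1..S} E"
    unfolding E_def using \<open>S > 0\<close>
    by (intro continuous_on_compose2[OF cont] continuous_intros) auto
  have d: "(\<theta> has_real_derivative E s) (at s within {-1..S})" if "s \<in> {-1..S}" for s
    using integral_has_real_derivative[OF E that] unfolding \<theta>_def by (auto intro!: derivative_eq_intros)
  have d': "(\<theta> has_real_derivative E s) (at s)" if "-1 < s" "s < S" for s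
    using d[of s] that by (simp add: at_within_Icc_at)
  have Epos: "E s > 0" if "s < S" for s
    using pos[of "max 0 s"] that \<open>S > 0\<close> by (auto simp: E_def max_def)
  have \<theta>c: "continuous_on {-1..S} \<theta>"
    using d by (meson DERIV_continuous continuous_on_eq_continuous_within)
  have less: "\<theta> s < \<theta> t" if "-1 \<le> s" "s < t" "t \<le> S" for s t
  proof (rule DERIV_pos_imp_increasing_open[OF that(2)])
    show "\<exists>y. (\<theta> has_real_derivative y) (at x) \<and> 0 < y" if "s < x" "x < t" for x
      using d'[of x] Epos[of x] that \<open>-1 \<le> s\<close> \<open>t \<le> S\<close> by force
    show "continuous_on {s..t} \<theta>"
      using that by (intro continuous_on_subset[OF \<theta>c]) auto
  qed
  have inj: "inj_on \<theta> {-1..S}"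
    using less by (intro linorder_inj_onI) force+
  define \<tau> where "\<tau> = inv_into {-1..S} \<theta>"
  have \<tau>\<theta>: "\<tau> (\<theta> s) = s" if "s \<in> {-1..S}" for s
    unfolding \<tau>_def using inj that by simp
  define T where "T = integral {0..S} e"
  have \<theta>0: "\<theta> 0 = 0" by (simp add: \<theta>_def)
  have \<theta>S: "\<theta> S = T"
  proof -
    have "E integrable_on {-1..S}" using E integrable_continuous_interval by blast
    then have "integral {-1..S} E = integral {-1..0} E + integral {0..S} E"
      using Henstock_Kurzweil_Integration.integral_combine[of "-1" 0 S E] \<open>S > 0\<close> by simp
    moreover have "integral {0..S} E = integral {0..S} e"
      by (rule integral_cong) (simp add: E_def)
    ultimately show ?thesis by (simp add: \<theta>_def T_def)
  qed
  have "T > 0" using less[of 0 S] \<open>S > 0\<close> by (simp add: \<theta>0 \<theta>S)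
  have m1: "\<theta> (-1) < 0" using less[of "-1" 0] \<open>S > 0\<close> by (simp add: \<theta>0)
  have img: "{\<theta> (-1)..T} \<subseteq> \<theta> ` {-1..S}"
  proof
    fix y assume y: "y \<in> {\<theta> (-1)..T}"
    have "\<exists>x\<ge>-1. x \<le> S \<and> \<theta> x = y"
      using y \<open>S > 0\<close> \<theta>S by (intro IVT' \<theta>c) auto
    then show "y \<in> \<theta> ` {-1..S}" by auto
  qed
  have \<tau>c: "continuous_on {\<theta> (-1)..T} \<tau>"
    by (rule continuous_on_subset[OF continuous_on_inv[OF \<theta>c] img]) (use \<tau>\<theta> in auto)
  have \<theta>\<tau>: "\<theta> (\<tau> t) = t" "\<tau> t \<in> {-1..S}" if "t \<in> {\<theta> (-1)..T}" for t
    using f_inv_into_f[of t \<theta> "{-1..S}"] inv_into_into[of t \<theta> "{-1..S}"] img that unfolding \<tau>_def by blast+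
  have \<tau>range: "0 \<le> \<tau> t" "t < T \<Longrightarrow> \<tau> t < S" if "0 \<le> t" "t \<le> T" for t
  proof -
    have t: "\<theta> (\<tau> t) = t" "\<tau> t \<in> {-1..S}" using \<theta>\<tau>[of t] that m1 by auto
    show "0 \<le> \<tau> t"
      using less[of "\<tau> t" 0] t that \<open>S > 0\<close> by (force simp: \<theta>0)
    show "\<tau> t < S" if "t < T" using t that \<theta>S by (cases "\<tau> t = S") auto
  qed
  show ?thesis
  proof (rule that[of \<tau>])
    show "integral {0..S} e > 0" using \<open>T > 0\<close> by (simp add: T_def)
    show "\<tau> 0 = 0" using \<tau>\<theta>[of 0] \<theta>0 \<open>S > 0\<close> by simp
    show "\<tau> (integral {0..S} e) = S" using \<tau>\<theta>[of S] \<theta>S \<open>S > 0\<close> by (simp add: T_def)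
    show "continuous_on {0..integral {0..S} e} \<tau>"
      using m1 by (intro continuous_on_subset[OF \<tau>c]) (auto simp: T_def)
    show "\<tau> ` {0..integral {0..S} e} \<subseteq> {0..S}"
      using \<tau>range(1) \<theta>\<tau>(2) m1 by (force simp: T_def[symmetric])
    fix t assume t: "0 \<le> t" "t < integral {0..S} e"
    then have t': "t \<in> {\<theta> (-1)<..<T}" using m1 by (auto simp: T_def)
    show "\<tau> t < S" using \<tau>range(2)[of t] t by (simp add: T_def)
    then have ts: "0 \<le> \<tau> t" "\<tau> t < S" using \<tau>range(1)[of t] t by (auto simp: T_def)
    have "(\<tau> has_real_derivative inverse (E (\<tau> t))) (at t)"
    proof (rule DERIV_inverse_function[where f = \<theta> and a = "\<theta> (-1)" and b = T])
      show "(\<theta> has_real_derivative E (\<tau> t)) (at (\<tau> t))" using d'[of "\<tau> t"] ts by simp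
      show "E (\<tau> t) \<noteq> 0" using Epos[of "\<tau> t"] ts by simp
      show "isCont \<tau> t"
        using continuous_on_interior[OF \<tau>c] t' by simp
    qed (use t' \<theta>\<tau> in auto)
    then show "(\<tau> has_real_derivative 1 / e (\<tau> t)) (at t)"
      using ts by (simp add: E_def inverse_eq_divide)
  qed
qed

section \<open>Gradient of the energy\<close>

lemma GDERIV_sum:
  assumes "\<And>a. a \<in> A \<Longrightarrow> GDERIV (f a) x :> D a"
  shows "GDERIV (\<lambda>x. \<Sum>a\<in>A. f a x) x :> (\<Sum>a\<in>A. D a)"
  using assms unfolding gderiv_def inner_sum_right by (rule has_derivative_sum)

context regular_part_domain
begin

definition pair_grad :: "real^2 \<Rightarrow> real^2 \<Rightarrow> real^2" where
  "pair_grad x y = dk x y - (1 / (2 * pi)) *\<^sub>R ((1 / (norm (x - y))\<^sup>2) *\<^sub>R (x - y))"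

text \<open>The self-term has coefficient 1: the squared modulus is 1, and the factor 2 from the
  diagonal cancels the 1/2 of the energy.\<close>

definition energy_grad :: "nat \<Rightarrow> (nat \<Rightarrow> real) \<Rightarrow> (nat \<Rightarrow> real^2) \<Rightarrow> nat \<Rightarrow> real^2" where
  "energy_grad n b z i = dk (z i) (z i) + (\<Sum>j\<in>{1..n} - {i}. (b i * b j) *\<^sub>R pair_grad (z i) (z j))"

lemma GDERIV_pair:
  assumes "x \<in> \<Omega>" "y \<in> \<Omega>" "x \<noteq> y"
  shows "GDERIV (\<lambda>p. c * (k p y - 1 / (2 * pi) * ln (norm (p - y)))) x :> c *\<^sub>R pair_grad x y"
    and "GDERIV (\<lambda>p. c * (k y p - 1 / (2 * pi) * ln (norm (y - p)))) x :> c *\<^sub>R pair_grad x y"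
proof -
  show "GDERIV (\<lambda>p. c * (k p y - 1 / (2 * pi) * ln (norm (p - y)))) x :> c *\<^sub>R pair_grad x y"
    unfolding pair_grad_def using assms
    by (intro GDERIV_cmult GDERIV_diff GDERIV_k GDERIV_ln_norm)
  show "GDERIV (\<lambda>p. c * (k y p - 1 / (2 * pi) * ln (norm (y - p)))) x :> c *\<^sub>R pair_grad x y"
    unfolding pair_grad_def norm_minus_commute[of y] using assms
    by (intro GDERIV_cmult GDERIV_diff GDERIV_k_snd GDERIV_ln_norm)
qed

lemma GDERIV_energy:
  assumes dom: "\<And>j. j \<in> {1..n} \<Longrightarrow> z j \<in> \<Omega>" and inj: "inj_on z {1..n}"
    and sgn: "\<And>j. j \<in> {1..n} \<Longrightarrow> b j \<in> {-1, 1}" and i: "i \<in> {1..n}"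
  shows "GDERIV (\<lambda>p. energy k n b (z(i := p))) (z i) :> energy_grad n b z i"
proof -
  let ?P = "{(a, c). a \<in> {1..n} \<and> c \<in> {1..n} \<and> a < c}"
  define Y where "Y j = (b i * b j) *\<^sub>R pair_grad (z i) (z j)" for j
  \<comment> \<open>The contribution of the pair (a, c), zero unless i is a member.\<close>
  define D where "D a c = (if a = i then Y c else if c = i then Y a else 0)" for a c
  have ne: "z i \<noteq> z j" if "j \<in> {1..n}" "j \<noteq> i" for j
    using inj_onD[OF inj, of i j] that i by blast
  have pairs: "GDERIV (\<lambda>p. \<Sum>x\<in>?P. (case x of (a, c) \<Rightarrow> b a * b c *
        (k ((z(i := p)) a) ((z(i := p)) c) - 1 / (2 * pi) * ln (norm ((z(i := p)) a - (z(i := p)) c))))) (z i)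
      :> (\<Sum>x\<in>?P. case x of (a, c) \<Rightarrow> D a c)"
  proof (rule GDERIV_sum)
    fix x assume "x \<in> ?P"
    then obtain a c where x: "x = (a, c)" and ac: "a \<in> {1..n}" "c \<in> {1..n}" "a < c" by auto
    consider "a = i" "c \<noteq> i" | "c = i" "a \<noteq> i" | "a \<noteq> i" "c \<noteq> i" using ac by force
    then show "GDERIV (\<lambda>p. (case x of (a, c) \<Rightarrow> b a * b c *
        (k ((z(i := p)) a) ((z(i := p)) c) - 1 / (2 * pi) * ln (norm ((z(i := p)) a - (z(i := p)) c))))) (z i)
      :> (case x of (a, c) \<Rightarrow> D a c)"
    proof cases
      case 1
      then show ?thesis
        using GDERIV_pair(1)[of "z i" "z c" "b i * b c"] dom ac ne by (simp add: x D_def Y_def)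
    next
      case 2
      then show ?thesis
        using GDERIV_pair(2)[of "z i" "z a" "b i * b a"] dom ac ne by (simp add: x D_def Y_def mult.commute)
    next
      case 3
      then show ?thesis by (simp add: x D_def GDERIV_const)
    qed
  qed
  \<comment> \<open>The ordered pairs containing i are indexed by their other member.\<close>
  have pair_sum: "(\<Sum>x\<in>?P. case x of (a, c) \<Rightarrow> D a c) = (\<Sum>j\<in>{1..n} - {i}. Y j)"
  proof -
    have "(\<Sum>x\<in>?P. case x of (a, c) \<Rightarrow> D a c)
        = (\<Sum>x\<in>{1..n} \<times> {1..n}. if fst x < snd x then D (fst x) (snd x) else 0)"
      by (subst sum.inter_filter[symmetric]) (auto intro!: sum.cong)
    also have "\<dots> = (\<Sum>a\<in>{1..n}. \<Sum>c\<in>{1..n}. if a < c then D a c else 0)"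
      by (simp add: sum.cartesian_product case_prod_beta)
    also have "\<dots> = (\<Sum>a\<in>{1..n}. \<Sum>c\<in>{1..n}. (if a = i then (if i < c then Y c else 0) else 0)
        + (if c = i then (if a < i then Y a else 0) else 0))"
      by (intro sum.cong refl) (auto simp: D_def)
    also have "\<dots> = (\<Sum>a\<in>{1..n}. (if a = i then (\<Sum>c\<in>{1..n}. if i < c then Y c else 0) else 0)
        + (if a < i then Y a else 0))"
      by (intro sum.cong refl) (use i in \<open>auto simp: sum.distrib\<close>)
    also have "\<dots> = (\<Sum>c\<in>{1..n}. (if i < c then Y c else 0) + (if c < i then Y c else 0))"
      using i by (simp add: sum.distrib)
    also have "\<dots> = (\<Sum>c\<in>{1..n}. if c \<noteq> i then Y c else 0)"
      by (intro sum.cong) auto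
    also have "\<dots> = (\<Sum>j\<in>{1..n} - {i}. Y j)"
      by (subst sum.inter_filter[symmetric]) (auto intro!: sum.cong)
    finally show ?thesis .
  qed
  have self: "GDERIV (\<lambda>p. 1 / 2 * (\<Sum>a\<in>{1..n}. (b a)\<^sup>2 * k ((z(i := p)) a) ((z(i := p)) a))) (z i)
      :> (1 / 2) *\<^sub>R (\<Sum>a\<in>{1..n}. (b a)\<^sup>2 *\<^sub>R (if a = i then 2 *\<^sub>R dk (z i) (z i) else 0))"
  proof (intro GDERIV_cmult GDERIV_sum)
    fix a assume "a \<in> {1..n}"
    show "GDERIV (\<lambda>p. k ((z(i := p)) a) ((z(i := p)) a)) (z i) :> (if a = i then 2 *\<^sub>R dk (z i) (z i) else 0)"
      using GDERIV_k_diagonal[OF dom[OF i]] by (simp add: GDERIV_const)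
  qed
  have self_sum: "(1 / 2) *\<^sub>R (\<Sum>a\<in>{1..n}. (b a)\<^sup>2 *\<^sub>R (if a = i then 2 *\<^sub>R dk (z i) (z i) else 0)) = dk (z i) (z i)"
  proof -
    have "(b i)\<^sup>2 = 1" using sgn[OF i] by auto
    have "(\<Sum>a\<in>{1..n}. (b a)\<^sup>2 *\<^sub>R (if a = i then 2 *\<^sub>R dk (z i) (z i) else 0))
      = (\<Sum>a\<in>{1..n}. if a = i then 2 *\<^sub>R dk (z i) (z i) else 0)"
      using \<open>(b i)\<^sup>2 = 1\<close> by (intro sum.cong) auto
    then show ?thesis using i by simp
  qed
  show ?thesis
    using GDERIV_add[OF pairs self] unfolding pair_sum self_sum
    by (simp add: energy_def energy_grad_def Y_def add.commute)
qed

text \<open>The minima of \<open>near_boundary\<close> resolved into strict inequalities, which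
  makes openness immediate and lets the thresholds for the flow differ from those for the
  datum.\<close>

definition region :: "nat \<Rightarrow> real \<Rightarrow> real \<Rightarrow> (nat \<Rightarrow> real^2) set" where
  "region n \<gamma> \<delta> = {z. (\<forall>i\<in>{1..n}. z i \<in> \<Omega>) \<and> bdist (z 1) < \<delta> \<and> (\<forall>i\<in>{2..n}. bdist (z i) > \<gamma>) \<and>
     (\<forall>i\<in>{2..n}. \<forall>j\<in>{2..n}. i \<noteq> j \<longrightarrow> dist (z i) (z j) > \<gamma>)}"

text \<open>The first dislocation is within \<gamma>/8 of the frontier and the others are farther
  than \<gamma> from it, so they cannot meet it either.\<close>

lemma region_distinct:
  assumes "z \<in> region n \<gamma> \<delta>" "\<gamma> > 0" "\<delta> \<le> \<gamma> / 8" "i \<in> {1..n}" "j \<in> {1..n}" "i \<noteq> j"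
  shows "norm (z i - z j) \<ge> \<gamma> / 2"
proof -
  have far: "dist (z 1) (z l) \<ge> \<gamma> / 2" if "l \<in> {2..n}" for l
  proof -
    have "bdist (z l) > \<gamma>" "bdist (z 1) < \<delta>"
      using that assms(1) by (auto simp: region_def)
    then show ?thesis
      using infdist_le_add[of "z l" "frontier \<Omega>" "z 1"] assms(2,3) dist_commute[of "z 1" "z l"]
      by linarith
  qed
  consider "i = 1" "j \<in> {2..n}" | "j = 1" "i \<in> {2..n}" | "i \<in> {2..n}" "j \<in> {2..n}"
    using assms(4-6) by (cases "i = 1"; cases "j = 1") auto
  then show ?thesis
  proof cases
    case 1
    then show ?thesis using far[of j] by (simp add: dist_norm)
  next
    case 2
    then show ?thesis using far[of i] by (simp add: dist_norm norm_minus_commute)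
  next
    case 3
    then have "dist (z i) (z j) > \<gamma>" using assms(1,6) by (simp add: region_def)
    then show ?thesis using \<open>\<gamma> > 0\<close> by (simp add: dist_norm)
  qed
qed

lemma region_eventually:
  assumes "z \<in> region n \<gamma> \<delta>" "n \<ge> 1" and lim: "\<And>j. j \<in> {1..n} \<Longrightarrow> ((\<lambda>q. f q j) \<longlongrightarrow> z j) F"
  shows "\<forall>\<^sub>F q in F. f q \<in> region n \<gamma> \<delta>"
proof -
  have 1: "\<forall>\<^sub>F q in F. \<forall>i\<in>{1..n}. f q i \<in> \<Omega>"
    using assms by (intro eventually_ball_finite ballI topological_tendstoD[OF lim open_dom]) (auto simp: region_def)
  have 2: "\<forall>\<^sub>F q in F. bdist (f q 1) < \<delta>"
    using assms by (intro order_tendstoD(2)[OF tendsto_infdist[OF lim]]) (auto simp: region_def)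
  have 3: "\<forall>\<^sub>F q in F. \<forall>i\<in>{2..n}. bdist (f q i) > \<gamma>"
    using assms by (intro eventually_ball_finite ballI order_tendstoD(1)[OF tendsto_infdist[OF lim]]) (auto simp: region_def)
  have 4: "\<forall>\<^sub>F q in F. \<forall>i\<in>{2..n}. \<forall>j\<in>{2..n}. i \<noteq> j \<longrightarrow> dist (f q i) (f q j) > \<gamma>"
  proof (intro eventually_ball_finite ballI finite_atLeastAtMost)
    fix i j assume ij: "i \<in> {2..n}" "j \<in> {2..n}"
    show "\<forall>\<^sub>F q in F. i \<noteq> j \<longrightarrow> dist (f q i) (f q j) > \<gamma>"
    proof (cases "i = j")
      case False
      have "\<forall>\<^sub>F q in F. dist (f q i) (f q j) > \<gamma>"
        using assms(1) ij False
        by (intro order_tendstoD(1)[OF tendsto_dist[OF lim lim]]) (auto simp: region_def)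
      then show ?thesis by eventually_elim simp
    qed simp
  qed
  show ?thesis
    using 1 2 3 4 by eventually_elim (simp add: region_def)
qed

lemma tendsto_dk:
  assumes "(f \<longlongrightarrow> x) F" "(g \<longlongrightarrow> y) F" "x \<in> \<Omega>" "y \<in> \<Omega>"
  shows "((\<lambda>q. dk (f q) (g q)) \<longlongrightarrow> dk x y) F"
  using filterlim_compose[OF dk_continuous[OF assms(3,4)] tendsto_Pair[OF assms(1,2)]] by simp

lemma tendsto_energy_grad:
  assumes z: "z \<in> region n \<gamma> \<delta>" "\<gamma> > 0" "\<delta> \<le> \<gamma> / 8" and i: "i \<in> {1..n}"
    and lim: "\<And>j. j \<in> {1..n} \<Longrightarrow> ((\<lambda>q. f q j) \<longlongrightarrow> z j) F"
  shows "((\<lambda>q. energy_grad n b (f q) i) \<longlongrightarrow> energy_grad n b z i) F"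
  unfolding energy_grad_def pair_grad_def
proof (intro tendsto_intros tendsto_dk lim i)
  have dom: "z j \<in> \<Omega>" if "j \<in> {1..n}" for j using z that by (simp add: region_def)
  show "z i \<in> \<Omega>" "z i \<in> \<Omega>" using dom i by auto
  fix j assume j: "j \<in> {1..n} - {i}"
  then show "j \<in> {1..n}" "j \<in> {1..n}" "j \<in> {1..n}" "z j \<in> \<Omega>" "z i \<in> \<Omega>" using dom i by auto
  show "(norm (z i - z j))\<^sup>2 \<noteq> 0"
    using region_distinct[OF z i, of j] j \<open>\<gamma> > 0\<close> by auto
qed

definition forces_bounded :: "nat \<Rightarrow> (nat \<Rightarrow> real) \<Rightarrow> real \<Rightarrow> real \<Rightarrow> real \<Rightarrow> bool" where
  "forces_bounded n b \<gamma> \<delta> B \<longleftrightarrow>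
     (\<forall>z\<in>region n \<gamma> \<delta>. (\<forall>i\<in>{2..n}. norm (energy_grad n b z i) \<le> B) \<and>
       (\<forall>p. foot (z 1) p \<longrightarrow>
          norm (energy_grad n b z 1 - (1 / (4 * pi * (bdist (z 1))\<^sup>2)) *\<^sub>R (z 1 - p)) \<le> B))"

text \<open>The far dislocations feel bounded forces by \<open>dk_bound_interior\<close>, however
  close the first one is to the frontier. The first feels its image up to a bounded error, and the
  others only through the Green function.\<close>

lemma ex_forces_bounded:
  assumes "\<gamma> > 0" "n \<ge> 1"
  obtains B where "B > 0"
    "\<And>\<delta> b. \<delta> \<le> \<gamma> / 8 \<Longrightarrow> \<delta> \<le> \<rho> / 4 \<Longrightarrow> \<forall>j\<in>{1..n}. b j \<in> {-1, 1} \<Longrightarrow> forces_bounded n b \<gamma> \<delta> B"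
proof -
  obtain B0 where B0: "B0 \<ge> 0" "\<And>x y. x \<in> \<Omega> \<Longrightarrow> y \<in> \<Omega> \<Longrightarrow> bdist y \<ge> \<gamma> \<Longrightarrow> norm (dk y x) \<le> B0"
    using dk_bound_interior[OF assms(1)] by metis
  define B1 where "B1 = B0 + 2 / \<gamma>"
  define B2 where "B2 = 16 * (1 / \<rho> + 4 / \<gamma>)"
  \<comment> \<open>B0 and n B1 bound the self-force and the pair forces on a far dislocation, the
    next two terms bound the errors for the first one; the 1 ensures positivity.\<close>
  define B where "B = B0 + real n * B1 + 8 / (pi * \<rho>) + real n * B2 + 1"
  have nn: "B1 \<ge> 0" "B2 \<ge> 0" "8 / (pi * \<rho>) \<ge> 0"
    using B0 assms rho_pos by (auto simp: B1_def B2_def)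
  have sum: "norm (\<Sum>j\<in>{1..n} - {i}. (b i * b j) *\<^sub>R v j) \<le> real n * c"
    if sgn: "\<And>j. j \<in> {1..n} \<Longrightarrow> b j \<in> {-1, 1}" and i: "i \<in> {1..n}"
      and le: "\<And>j. j \<in> {1..n} - {i} \<Longrightarrow> norm (v j) \<le> c" and "c \<ge> 0"
    for b :: "nat \<Rightarrow> real" and i and v :: "nat \<Rightarrow> real^2" and c
  proof -
    have "norm (\<Sum>j\<in>{1..n} - {i}. (b i * b j) *\<^sub>R v j) \<le> (\<Sum>j\<in>{1..n} - {i}. c)"
    proof (rule sum_norm_le)
      fix j assume j: "j \<in> {1..n} - {i}"
      have "\<bar>b i * b j\<bar> = 1" using sgn[of j] sgn[OF i] j by auto
      then show "norm ((b i * b j) *\<^sub>R v j) \<le> c" using le[OF j] by simp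
    qed
    also have "\<dots> = real (card ({1..n} - {i})) * c" by simp
    also have "\<dots> \<le> real n * c"
      using \<open>c \<ge> 0\<close> card_mono[of "{1..n}" "{1..n} - {i}"] by (intro mult_right_mono) auto
    finally show ?thesis .
  qed
  show ?thesis
  proof (rule that[of B])
    show "B > 0" using nn B0 by (simp add: B_def add_nonneg_pos)
    fix \<delta> and b :: "nat \<Rightarrow> real"
    assume \<delta>: "\<delta> \<le> \<gamma> / 8" "\<delta> \<le> \<rho> / 4" and sgn: "\<forall>j\<in>{1..n}. b j \<in> {-1, 1}"
    show "forces_bounded n b \<gamma> \<delta> B"
      unfolding forces_bounded_def
    proof (intro ballI conjI allI impI)
      fix z assume z: "z \<in> region n \<gamma> \<delta>"
      have dom: "z j \<in> \<Omega>" if "j \<in> {1..n}" for j using z that by (simp add: region_def)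
      fix i assume i: "i \<in> {2..n}"
      show "norm (energy_grad n b z i) \<le> B"
      proof -
        have i1: "i \<in> {1..n}" using i by auto
        have bi: "bdist (z i) \<ge> \<gamma>" using z i by (auto simp: region_def less_imp_le)
        have pg: "norm (pair_grad (z i) (z j)) \<le> B1" if j: "j \<in> {1..n} - {i}" for j
        proof -
          have far: "norm (z i - z j) \<ge> \<gamma> / 2"
            using region_distinct[OF z assms(1) \<delta>(1) i1, of j] j by auto
          have "norm ((1 / (norm (z i - z j))\<^sup>2) *\<^sub>R (z i - z j)) = 1 / norm (z i - z j)"
            by (simp add: power2_eq_square)
          also have "\<dots> \<le> 1 / (\<gamma> / 2)"
          proof (intro divide_left_mono far mult_pos_pos)
            show "norm (z i - z j) > 0" using far assms by linarith
          qed (use assms in auto)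
          finally have "norm ((1 / (2 * pi)) *\<^sub>R ((1 / (norm (z i - z j))\<^sup>2) *\<^sub>R (z i - z j))) \<le> 1 * (1 / (\<gamma> / 2))"
            unfolding norm_scaleR using pi_gt3 by (intro mult_mono) (auto simp: divide_le_eq)
          then show ?thesis
            using norm_triangle_ineq4[of "dk (z i) (z j)" "(1 / (2 * pi)) *\<^sub>R ((1 / (norm (z i - z j))\<^sup>2) *\<^sub>R (z i - z j))"]
              B0(2)[OF dom dom bi, of j] j i1
            unfolding pair_grad_def B1_def by simp
        qed
        have "norm (\<Sum>j\<in>{1..n} - {i}. (b i * b j) *\<^sub>R pair_grad (z i) (z j)) \<le> real n * B1"
          by (rule sum[OF _ i1 _ nn(1)]) (use sgn pg in blast)+
        then have "norm (energy_grad n b z i) \<le> B0 + real n * B1"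
          unfolding energy_grad_def
          by (intro order_trans[OF norm_triangle_ineq] add_mono B0(2)[OF dom[OF i1] dom[OF i1] bi])
        also have "\<dots> \<le> B" using nn by (simp add: B_def)
        finally show ?thesis .
      qed
    next
      fix z p assume z: "z \<in> region n \<gamma> \<delta>" and p: "foot (z 1) p"
      have dom: "z j \<in> \<Omega>" if "j \<in> {1..n}" for j using z that by (simp add: region_def)
      show "norm (energy_grad n b z 1 - (1 / (4 * pi * (bdist (z 1))\<^sup>2)) *\<^sub>R (z 1 - p)) \<le> B"
      proof -
        have n1: "1 \<in> {1..n}" using assms(2) by simp
        have b1: "bdist (z 1) \<le> \<rho> / 4" "bdist (z 1) \<le> \<gamma> / 8"
          using z \<delta> by (auto simp: region_def)
        have pg: "norm (pair_grad (z 1) (z j)) \<le> B2" if j: "j \<in> {1..n} - {1}" for j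
          unfolding pair_grad_def B2_def
          using z j assms b1 dom[OF n1] dom[of j]
          by (intro green_gradient_bound_near_frontier) (auto simp: region_def less_imp_le)
        have 1: "norm (\<Sum>j\<in>{1..n} - {1}. (b 1 * b j) *\<^sub>R pair_grad (z 1) (z j)) \<le> real n * B2"
          by (rule sum[OF _ n1 _ nn(2)]) (use sgn pg in blast)+
        have "norm (dk (z 1) (z 1) - (1 / (4 * pi * (bdist (z 1))\<^sup>2)) *\<^sub>R (z 1 - p)) \<le> 8 / (pi * \<rho>)"
          using dom[OF n1] p b1 rho_pos by (intro dk_diagonal_estimate) auto
        note 2 = this
        have "energy_grad n b z 1 - (1 / (4 * pi * (bdist (z 1))\<^sup>2)) *\<^sub>R (z 1 - p)
            = (dk (z 1) (z 1) - (1 / (4 * pi * (bdist (z 1))\<^sup>2)) *\<^sub>R (z 1 - p))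
              + (\<Sum>j\<in>{1..n} - {1}. (b 1 * b j) *\<^sub>R pair_grad (z 1) (z j))"
          unfolding energy_grad_def by (rule diff_add_eq[symmetric])
        then have "norm (energy_grad n b z 1 - (1 / (4 * pi * (bdist (z 1))\<^sup>2)) *\<^sub>R (z 1 - p))
            \<le> 8 / (pi * \<rho>) + real n * B2"
          using norm_triangle_le[OF add_mono[OF 2 1]] by (simp only:)
        also have "\<dots> \<le> B"
          using nn B0(1) mult_nonneg_nonneg[OF of_nat_0_le_iff nn(1), of n] unfolding B_def by linarith
        finally show ?thesis .
      qed
    qed
  qed
qed

end

section \<open>Collision with the boundary\<close>

text \<open>The line encloses at most the triangle cut off at its zero d / a, whatever S is; the
  difference is a perfect square.\<close>

lemma integral_le_of_linear_bound:
  fixes e :: "real \<Rightarrow> real"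
  assumes "S \<ge> 0" "a > 0" and cont: "continuous_on {0..S} e" and le: "\<And>s. s \<in> {0..S} \<Longrightarrow> e s \<le> d - a * s"
  shows "integral {0..S} e \<le> d\<^sup>2 / (2 * a)"
proof -
  have "((\<lambda>s. d - a * s) has_integral (d * S - a * S\<^sup>2 / 2) - (d * 0 - a * 0\<^sup>2 / 2)) {0..S}"
    using \<open>S \<ge> 0\<close>
    by (intro fundamental_theorem_of_calculus)
      (auto intro!: derivative_eq_intros simp flip: has_real_derivative_iff_has_vector_derivative)
  then have i: "((\<lambda>s. d - a * s) has_integral d * S - a * S\<^sup>2 / 2) {0..S}" by simp
  have "e integrable_on {0..S}" using cont integrable_continuous_interval by blast
  then have "integral {0..S} e \<le> d * S - a * S\<^sup>2 / 2"
    using has_integral_le[OF integrable_integral i] le by blast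
  also have "d\<^sup>2 / (2 * a) - (d * S - a * S\<^sup>2 / 2) = (d - a * S)\<^sup>2 / (2 * a)"
    using \<open>a > 0\<close> by (simp add: field_simps power2_eq_square)
  then have "d * S - a * S\<^sup>2 / 2 \<le> d\<^sup>2 / (2 * a)"
    using \<open>a > 0\<close> by (smt (verit) divide_nonneg_pos zero_le_power2)
  finally show ?thesis .
qed

context regular_part_domain
begin

lemma near_boundary_eq_region: "n \<ge> 1 \<Longrightarrow> near_boundary \<Omega> n \<delta> \<gamma> = region n \<gamma> \<delta>"
proof -
  assume n: "n \<ge> 1"
  have *: "{dist (z i) (z j) |i j. i \<in> {1::nat} \<and> j \<in> {1} \<and> i \<noteq> j} = {}" for z :: "nat \<Rightarrow> real^2"
    by auto
  have 1: "min_dist \<Omega> {1} z = bdist (z 1)" for z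
    unfolding min_dist_def * by simp
  have 2: "min_dist \<Omega> {2..n} z > \<gamma> \<longleftrightarrow> (\<forall>i\<in>{2..n}. bdist (z i) > \<gamma>) \<and>
     (\<forall>i\<in>{2..n}. \<forall>j\<in>{2..n}. i \<noteq> j \<longrightarrow> dist (z i) (z j) > \<gamma>)" if "n \<ge> 2" for z
  proof -
    let ?D = "{dist (z i) (z j) |i j. i \<in> {2..n} \<and> j \<in> {2..n} \<and> i \<noteq> j}"
    have "?D \<subseteq> (\<lambda>(i, j). dist (z i) (z j)) ` ({2..n} \<times> {2..n})" by auto
    then have "finite ?D" by (rule finite_subset) auto
    then have "min_dist \<Omega> {2..n} z > \<gamma> \<longleftrightarrow> (\<forall>x \<in> (\<lambda>i. bdist (z i)) ` {2..n} \<union> ?D. \<gamma> < x)"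
      unfolding min_dist_def using that by (intro Min_gr_iff) auto
    then show ?thesis by blast
  qed
  show ?thesis
  proof (cases "n \<ge> 2")
    case True
    then show ?thesis unfolding near_boundary_def region_def 1 using 2 by auto
  next
    case False
    then show ?thesis unfolding near_boundary_def region_def 1 by auto
  qed
qed

lemma region_mono: "\<delta> \<le> \<delta>' \<Longrightarrow> \<gamma>' \<le> \<gamma> \<Longrightarrow> region n \<gamma> \<delta> \<subseteq> region n \<gamma>' \<delta>'"
  unfolding region_def by force

text \<open>The gradient flow in the rescaled time \<open>s\<close> with \<open>dt = bdist (z\<^sub>1) ds\<close>: its vector field
  is bounded up to the boundary.\<close>

lemma rescaled_flow:
  fixes \<delta>' :: real
  assumes "\<gamma> > 0" "n \<ge> 1" "B > 0"
    and \<delta>': "\<delta>' \<le> \<gamma> / 8" "B * \<delta>' \<le> 1 / (8 * pi)" and \<delta>: "0 < \<delta>" "\<delta> \<le> \<delta>'" "16 * pi * \<delta> < \<gamma>"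
    and fb: "forces_bounded n b \<gamma> \<delta>' B"
    and z0: "z0 \<in> region n (2 * \<gamma>) \<delta>"
  obtains S w where "S > 0" "w 0 = z0" "\<And>i. continuous_on {0..} (\<lambda>s. w s i)"
    "\<And>s. 0 \<le> s \<Longrightarrow> s < S \<Longrightarrow> w s \<in> region n \<gamma> \<delta>'"
    "\<And>s i. 0 \<le> s \<Longrightarrow> s < S \<Longrightarrow> i \<in> {1..n} \<Longrightarrow>
      ((\<lambda>s. w s i) has_vector_derivative - (bdist (w s 1) *\<^sub>R energy_grad n b (w s) i)) (at s within {0..})"
    "w S 1 \<in> frontier \<Omega>" "\<And>i. i \<in> {2..n} \<Longrightarrow> w S i \<in> \<Omega>"
    "\<And>s. 0 \<le> s \<Longrightarrow> s \<le> S \<Longrightarrow> bdist (w s 1) \<le> \<delta> - (1 / (4 * pi) - B * \<delta>) * s"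
proof -
  have bd2: "norm (energy_grad n b z i) \<le> B" if "z \<in> region n \<gamma> \<delta>'" "i \<in> {2..n}" for z i
    using fb that unfolding forces_bounded_def by blast
  have bd1: "norm (energy_grad n b z 1 - (1 / (4 * pi * (bdist (z 1))\<^sup>2)) *\<^sub>R (z 1 - p)) \<le> B"
    if "z \<in> region n \<gamma> \<delta>'" "foot (z 1) p" for z p
    using fb that unfolding forces_bounded_def by blast
  have n1: "1 \<in> {1..n}" using \<open>n \<ge> 1\<close> by simp
  let ?R = "region n \<gamma> \<delta>'"
  \<comment> \<open>The field is cut off to 0 outside the region. This keeps it bounded everywhere,
    while continuity is required only at points of the region.\<close>
  define \<Phi> where "\<Phi> z i = (if z \<in> ?R \<and> i \<in> {1..n} then - (bdist (z 1) *\<^sub>R energy_grad n b z i) else 0)" for z i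
  \<comment> \<open>Multiplied by d, the image force contributes 1 / (4 \<pi>) and the remainder d
    B; each is at most 1/2.\<close>
  have \<Phi>_le: "norm (\<Phi> z i) \<le> 1" for z i
  proof (cases "z \<in> ?R \<and> i \<in> {1..n}")
    case True
    define d where "d = bdist (z 1)"
    have d: "0 < d" "d < \<delta>'"
      using True bdist_pos[of "z 1"] n1 by (auto simp: region_def d_def)
    have "d * B \<le> \<delta>' * B" using d \<open>B > 0\<close> by (intro mult_right_mono) auto
    also have "\<dots> \<le> 1 / (8 * pi)" using \<delta>'(2) by (simp add: mult.commute)
    also have "\<dots> \<le> 1 / 2" using pi_gt3 by (simp add: divide_simps)
    finally have dB: "d * B \<le> 1 / 2" .
    have "d * norm (energy_grad n b z i) \<le> 1"
    proof (cases "i = 1")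
      case i1: True
      obtain p where p: "foot (z 1) p" using ex_foot True n1 unfolding region_def by blast
      then have pd: "norm (z 1 - p) = d" by (simp add: foot_def dist_norm d_def)
      let ?v = "(1 / (4 * pi * d\<^sup>2)) *\<^sub>R (z 1 - p)"
      have "norm (energy_grad n b z 1) \<le> norm ?v + B"
        using norm_triangle_ineq2[of "energy_grad n b z 1" ?v] bd1[of z p] p True by (simp add: d_def)
      also have "norm ?v = 1 / (4 * pi * d)"
        using pd d by (simp add: power2_eq_square)
      finally have "d * norm (energy_grad n b z 1) \<le> d * (1 / (4 * pi * d) + B)"
        using d by (intro mult_left_mono) auto
      also have "\<dots> = 1 / (4 * pi) + d * B" using d by (simp add: distrib_left)
      also have "\<dots> \<le> 1 / 2 + 1 / 2"
        using dB pi_gt3 by (intro add_mono) (auto simp: divide_simps)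
      finally show ?thesis by (simp add: i1)
    next
      case False
      then have "norm (energy_grad n b z i) \<le> B" using True bd2 by auto
      then have "d * norm (energy_grad n b z i) \<le> d * B" using d by (intro mult_left_mono) auto
      then show ?thesis using dB by simp
    qed
    then show ?thesis using True d by (simp add: \<Phi>_def d_def)
  qed (auto simp: \<Phi>_def)
  have \<Phi>_cont: "(\<lambda>q. \<Phi> (f q) i) \<longlonglongrightarrow> \<Phi> z i"
    if "z \<in> ?R" "\<And>j. j \<in> {1..n} \<Longrightarrow> (\<lambda>q. f q j) \<longlonglongrightarrow> z j" for z f i
  proof (cases "i \<in> {1..n}")
    case True
    have "\<forall>\<^sub>F q in sequentially. f q \<in> ?R"
      by (rule region_eventually[OF that(1) \<open>n \<ge> 1\<close> that(2)])
    then have "\<forall>\<^sub>F q in sequentially. - (bdist (f q 1) *\<^sub>R energy_grad n b (f q) i) = \<Phi> (f q) i"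
      by eventually_elim (use True in \<open>simp add: \<Phi>_def\<close>)
    moreover have "(\<lambda>q. - (bdist (f q 1) *\<^sub>R energy_grad n b (f q) i)) \<longlonglongrightarrow> - (bdist (z 1) *\<^sub>R energy_grad n b z i)"
      by (intro tendsto_intros that(2) n1 tendsto_energy_grad[OF that(1) \<open>\<gamma> > 0\<close> \<delta>'(1) True])
    ultimately show ?thesis
      using that(1) True by (auto simp: \<Phi>_def intro: Lim_transform_eventually)
  next
    case False
    then have "\<Phi> y i = 0" for y
      unfolding \<Phi>_def by (simp only: simp_thms if_False)
    then show ?thesis by simp
  qed
  obtain w where w0: "w 0 = z0"
    and lip: "\<And>s t i. s \<ge> 0 \<Longrightarrow> t \<ge> 0 \<Longrightarrow> norm (w t i - w s i) \<le> 1 * \<bar>t - s\<bar>"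
    and wd: "\<And>s i. s \<ge> 0 \<Longrightarrow> w s \<in> ?R \<Longrightarrow> ((\<lambda>s. w s i) has_vector_derivative \<Phi> (w s) i) (at s within {0..})"
    by (rule peano_existence[where \<Phi> = \<Phi> and M = 1 and J = "{1..n}" and U = ?R and ?x0.0 = z0])
      (use \<Phi>_le \<Phi>_cont in auto)
  have wc: "continuous_on {0..} (\<lambda>s. w s i)" for i
    unfolding continuous_on_iff
  proof (intro ballI allI impI)
    fix s e :: real assume "s \<in> {0..}" "e > 0"
    then show "\<exists>d>0. \<forall>s'\<in>{0..}. dist s' s < d \<longrightarrow> dist (w s' i) (w s i) < e"
      using lip[of s _ i] by (intro exI[of _ e]) (force simp: dist_norm)
  qed
  define D where "D s = bdist (w s 1)" for s
  have Dc: "continuous_on {0..} D"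
    unfolding D_def by (intro continuous_intros wc)
  have D0: "D 0 < \<delta>" using z0 by (simp add: D_def w0 region_def)
  \<comment> \<open>The distance to the foot point at time t, kept fixed, dominates D and agrees
    with it at t; its derivative is the component of the field along the normal.\<close>
  have touch: "\<exists>g E. g t = D t \<and> (\<forall>s. D s \<le> g s) \<and> E \<le> - (1 / (4 * pi) - B * D t) \<and>
      (g has_real_derivative E) (at t within {0..})" if "t \<ge> 0" "w t \<in> ?R" for t
  proof -
    define d where "d = D t"
    have "w t 1 \<in> \<Omega>" using that n1 by (auto simp: region_def)
    then have d: "0 < d" using bdist_pos by (simp add: d_def D_def)
    obtain p where p: "foot (w t 1) p" using ex_foot \<open>w t 1 \<in> \<Omega>\<close> by blast
    then have pd: "norm (w t 1 - p) = d" by (simp add: foot_def dist_norm d_def D_def)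
    define G where "G = energy_grad n b (w t) 1"
    define \<nu> where "\<nu> = sgn (w t 1 - p)"
    have \<nu>: "w t 1 - p = d *\<^sub>R \<nu>" "norm \<nu> = 1" "\<nu> \<bullet> \<nu> = 1"
      using pd d by (auto simp: \<nu>_def sgn_div_norm norm_sgn dot_square_norm)
    have "((\<lambda>s. w s 1 - p) has_derivative (\<lambda>h. h *\<^sub>R \<Phi> (w t) 1)) (at t within {0..})"
      using wd[OF that, of 1] unfolding has_vector_derivative_def by (auto intro!: derivative_eq_intros)
    from has_derivative_compose[OF this GDERIV_norm[unfolded gderiv_def]] pd d
    have "((\<lambda>s. norm (w s 1 - p)) has_real_derivative \<Phi> (w t) 1 \<bullet> \<nu>) (at t within {0..})"
      unfolding has_field_derivative_def \<nu>_def
      by (force simp: mult.commute intro: has_derivative_eq_rhs)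
    moreover have "\<Phi> (w t) 1 \<bullet> \<nu> \<le> - (1 / (4 * pi) - B * d)"
    proof -
      let ?v = "(1 / (4 * pi * d\<^sup>2)) *\<^sub>R (w t 1 - p)"
      have "norm (G - ?v) \<le> B"
        using bd1[of "w t" p] that(2) p by (simp add: G_def d_def D_def)
      then have "- B \<le> (G - ?v) \<bullet> \<nu>"
        using Cauchy_Schwarz_ineq2[of "G - ?v" \<nu>] unfolding \<nu>(2) by linarith
      then have "d * (- B) \<le> d * ((G - ?v) \<bullet> \<nu>)"
        using d by (intro mult_left_mono) auto
      moreover have "d * (?v \<bullet> \<nu>) = 1 / (4 * pi)"
        unfolding \<nu>(1) using d \<nu>(3) by (simp add: power2_eq_square)
      moreover have "\<Phi> (w t) 1 \<bullet> \<nu> = - (d * (G \<bullet> \<nu>))"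
        using that n1 by (simp add: \<Phi>_def G_def d_def D_def)
      ultimately show ?thesis by (simp add: inner_diff_left right_diff_distrib mult.commute)
    qed
    moreover have "D s \<le> norm (w s 1 - p)" for s
      using p bdist_le[of p "w s 1"] by (simp add: foot_def D_def norm_minus_commute)
    ultimately show ?thesis
      using pd by (intro exI[of _ "\<lambda>s. norm (w s 1 - p)"] exI[of _ "\<Phi> (w t) 1 \<bullet> \<nu>"]) (simp add: d_def)
  qed
  have rate: "D t \<le> D 0 - c * t"
    if "t \<ge> 0" "\<And>s. 0 \<le> s \<Longrightarrow> s < t \<Longrightarrow> w s \<in> ?R \<and> c \<le> 1 / (4 * pi) - B * D s" for t c
  proof -
    have "D t \<le> D 0 - c * (t - 0)"
    proof (rule decreasing_by_upper_touching[OF that(1)])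
      show "continuous_on {0..t} D" by (rule continuous_on_subset[OF Dc]) auto
      show "\<exists>g E. g s = D s \<and> (\<forall>r\<in>{s..t}. D r \<le> g r) \<and> E \<le> - c \<and> (g has_real_derivative E) (at s within {0..})"
        if s: "0 \<le> s" "s < t" for s
        using touch[OF s(1)] \<open>\<And>s. 0 \<le> s \<Longrightarrow> s < t \<Longrightarrow> w s \<in> ?R \<and> c \<le> 1 / (4 * pi) - B * D s\<close>[OF s]
        by (smt (verit))
    qed
    then show ?thesis by simp
  qed
  \<comment> \<open>A crude rate first: half of 1 / (4 \<pi>) suffices to absorb the bounded forces.
    The sharp rate requires D < \<delta> along the whole path, which this one provides.\<close>
  have rate1: "D t \<le> D 0 - 1 / (8 * pi) * t" if "t \<ge> 0" "\<And>s. 0 \<le> s \<Longrightarrow> s < t \<Longrightarrow> w s \<in> ?R" for t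
  proof (rule rate[OF that(1)])
    fix s assume "0 \<le> s" "s < t"
    then have R: "w s \<in> ?R" using that by blast
    then have "D s \<le> \<delta>'" by (auto simp: region_def D_def)
    then have "B * D s \<le> B * \<delta>'" using \<open>B > 0\<close> by (intro mult_left_mono) auto
    then have "B * D s \<le> 1 / (8 * pi)" using \<delta>'(2) by linarith
    then show "w s \<in> ?R \<and> 1 / (8 * pi) \<le> 1 / (4 * pi) - B * D s" using R by (simp add: field_simps)
  qed
  have D_nonneg: "D s \<ge> 0" for s by (simp add: D_def infdist_nonneg)
  define X where "X = {s. s \<ge> 0 \<and> w s \<notin> ?R}"
  \<comment> \<open>Staying in the region until 8 \<pi> \<delta> would make the distance
    negative.\<close>
  have "X \<noteq> {}"
  proof
    assume "X = {}"
    then have "D (8 * pi * \<delta>) \<le> D 0 - 1 / (8 * pi) * (8 * pi * \<delta>)"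
      using \<delta> by (intro rate1) (auto simp: X_def)
    then show False using D_nonneg[of "8 * pi * \<delta>"] D0 by simp
  qed
  define S where "S = Inf X"
  have bdd: "bdd_below X" by (auto simp: X_def bdd_below_def)
  have S0: "S \<ge> 0" unfolding S_def using \<open>X \<noteq> {}\<close> by (intro cInf_greatest) (auto simp: X_def)
  have inR: "w s \<in> ?R" if "0 \<le> s" "s < S" for s
    using that cInf_lower[OF _ bdd, of s] unfolding S_def X_def by force
  \<comment> \<open>The region is open, so membership at S would persist beyond the infimum of the
    exit times.\<close>
  have SX: "w S \<notin> ?R"
  proof
    assume R: "w S \<in> ?R"
    have "\<forall>\<^sub>F s in at S within {0..}. w s \<in> ?R"
    proof (rule region_eventually[OF R \<open>n \<ge> 1\<close>])
      show "((\<lambda>s. w s j) \<longlongrightarrow> w S j) (at S within {0..})" for j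
        using wc[of j] S0 by (simp add: continuous_on_def)
    qed
    then obtain d where "d > 0" and d: "\<And>s. s \<ge> 0 \<Longrightarrow> s \<noteq> S \<Longrightarrow> dist s S < d \<Longrightarrow> w s \<in> ?R"
      unfolding eventually_at by auto
    have "s \<ge> S + d" if "s \<in> X" for s
    proof (rule ccontr)
      assume "\<not> s \<ge> S + d"
      moreover have "s \<ge> S" unfolding S_def using cInf_lower[OF that bdd] .
      ultimately show False
        using d[of s] R that by (cases "s = S") (auto simp: X_def dist_real_def)
    qed
    then have "S + d \<le> S" unfolding S_def using \<open>X \<noteq> {}\<close> by (intro cInf_greatest) (auto simp: S_def)
    then show False using \<open>d > 0\<close> by simp
  qed
  have "w 0 \<in> ?R"
    using z0 region_mono[of \<delta> \<delta>' \<gamma> "2 * \<gamma>" n] \<delta>(2) \<open>\<gamma> > 0\<close> by (auto simp: w0)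
  then have "S > 0" using SX S0 by (metis less_eq_real_def)
  have DS: "D s \<le> D 0 - 1 / (8 * pi) * s" if "0 \<le> s" "s \<le> S" for s
    using that inR by (intro rate1) auto
  \<comment> \<open>Hence S < \<gamma>/2. At unit speed each point moves less than \<gamma>/2, and
    the initial margins 2\<gamma> stay above \<gamma> even for pairs; the exit can only be due to
    the first dislocation leaving the domain.\<close>
  have "1 / (8 * pi) * S < \<delta>"
    using DS[of S] D_nonneg[of S] D0 S0 by linarith
  then have Sle: "S < \<gamma> / 2"
    using \<delta>(3) by (simp add: field_simps)
  have move: "norm (w S i - z0 i) < \<gamma> / 2" for i
    using lip[of 0 S i] S0 Sle by (simp add: w0)
  have D_less: "D s < \<delta>" if "0 \<le> s" "s \<le> S" for s
  proof -
    have "0 \<le> 1 / (8 * pi) * s" using that by simp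
    then show ?thesis using DS[OF that] D0 by linarith
  qed
  have far: "w S i \<in> \<Omega>" "bdist (w S i) > \<gamma>" if "i \<in> {2..n}" for i
  proof -
    have z: "z0 i \<in> \<Omega>" "bdist (z0 i) > 2 * \<gamma>" using z0 that by (auto simp: region_def)
    show "w S i \<in> \<Omega>"
      using ball_bdist_subset[OF z(1), of "2 * \<gamma>"] z(2) move[of i] \<open>\<gamma> > 0\<close>
      by (auto simp: subset_iff dist_norm norm_minus_commute)
    show "bdist (w S i) > \<gamma>"
      using infdist_le_add[of "z0 i" "frontier \<Omega>" "w S i"] move[of i] z(2) \<open>\<gamma> > 0\<close>
      by (simp add: dist_norm norm_minus_commute)
  qed
  have far2: "dist (w S i) (w S j) > \<gamma>" if "i \<in> {2..n}" "j \<in> {2..n}" "i \<noteq> j" for i j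
  proof -
    have "dist (z0 i) (z0 j) > 2 * \<gamma>" using z0 that by (auto simp: region_def)
    moreover have "dist (z0 i) (z0 j) \<le> dist (w S i) (z0 i) + dist (w S i) (w S j) + dist (w S j) (z0 j)"
      using dist_triangle[of "z0 i" "z0 j" "w S i"] dist_triangle[of "w S i" "z0 j" "w S j"]
        dist_commute[of "z0 i" "w S i"] by linarith
    ultimately show ?thesis using move[of i] move[of j] by (simp add: dist_norm)
  qed
  have "w S 1 \<in> closure \<Omega>"
  proof (rule Lim_in_closed_set[OF closed_closure])
    show "((\<lambda>s. w s 1) \<longlongrightarrow> w S 1) (at_left S)"
    proof -
      have "continuous_on {0..S} (\<lambda>s. w s 1)" by (rule continuous_on_subset[OF wc]) auto
      then have "((\<lambda>s. w s 1) \<longlongrightarrow> w S 1) (at S within {0..S})"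
        using S0 by (simp add: continuous_on_def)
      then show ?thesis using \<open>S > 0\<close> by (simp add: at_within_Icc_at_left)
    qed
    show "\<forall>\<^sub>F s in at_left S. w s 1 \<in> closure \<Omega>"
      unfolding eventually_at_left_field
    proof (intro exI[of _ 0] conjI allI impI)
      fix s assume s: "0 < s" "s < S"
      then have "w s 1 \<in> \<Omega>" using inR[of s] n1 by (simp add: region_def)
      then show "w s 1 \<in> closure \<Omega>" using closure_subset by blast
    qed fact
  qed simp
  moreover have "w S 1 \<notin> \<Omega>"
  proof
    assume 1: "w S 1 \<in> \<Omega>"
    have "w S i \<in> \<Omega>" if "i \<in> {1..n}" for i
      using 1 far(1)[of i] that by (cases "i = 1") auto
    then have "w S \<in> ?R"
      unfolding region_def using far far2 D_less[of S] S0 \<delta>(2) by (auto simp: D_def)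
    then show False using SX by blast
  qed
  ultimately have front: "w S 1 \<in> frontier \<Omega>" by (rule in_frontier)
  have final: "D s \<le> \<delta> - (1 / (4 * pi) - B * \<delta>) * s" if s: "0 \<le> s" "s \<le> S" for s
  proof -
    have "D s \<le> D 0 - (1 / (4 * pi) - B * \<delta>) * s"
    proof (rule rate[OF s(1)])
      fix r assume r: "0 \<le> r" "r < s"
      have "B * D r \<le> B * \<delta>"
        using D_less[of r] r s \<open>B > 0\<close> by (intro mult_left_mono) auto
      then show "w r \<in> ?R \<and> 1 / (4 * pi) - B * \<delta> \<le> 1 / (4 * pi) - B * D r"
        using inR[of r] r s by simp
    qed
    then show ?thesis using D0 by linarith
  qed
  show ?thesis
  proof (rule that[of S w])
    show "((\<lambda>s. w s i) has_vector_derivative - (bdist (w s 1) *\<^sub>R energy_grad n b (w s) i)) (at s within {0..})"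
      if "0 \<le> s" "s < S" "i \<in> {1..n}" for s i
      using wd[OF that(1) inR[OF that(1,2)], of i] inR[OF that(1,2)] that(3) by (simp add: \<Phi>_def)
  qed (use \<open>S > 0\<close> w0 wc inR front far(1) final in \<open>auto simp: D_def\<close>)
qed

text \<open>The collision time is the integral of the boundary distance over rescaled time, and the
  linear decay of this distance bounds the integral by \<delta>^2 / (2a) with a = 1 / (4 \<pi>) - B
  \<delta>.\<close>

lemma boundary_collision_exists:
  fixes \<delta>' :: real
  assumes "\<gamma> > 0" "n \<ge> 1" "B > 0" and sgn: "\<forall>j\<in>{1..n}. b j \<in> {-1, 1}"
    and \<delta>': "\<delta>' \<le> \<gamma> / 8" "B * \<delta>' \<le> 1 / (8 * pi)" and \<delta>: "0 < \<delta>" "\<delta> \<le> \<delta>'" "16 * pi * \<delta> < \<gamma>"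
    and fb: "forces_bounded n b \<gamma> \<delta>' B"
    and z0: "z0 \<in> region n (2 * \<gamma>) \<delta>"
  shows "\<exists>T>0. (\<exists>z. boundary_collision \<Omega> k n b z0 T z) \<and> T \<le> 2 * pi * \<delta>\<^sup>2 + 16 * pi\<^sup>2 * B * \<delta> ^ 3"
proof -
  obtain S w where "S > 0" and w0: "w 0 = z0" and wc: "\<And>i. continuous_on {0..} (\<lambda>s. w s i)"
    and inR: "\<And>s. 0 \<le> s \<Longrightarrow> s < S \<Longrightarrow> w s \<in> region n \<gamma> \<delta>'"
    and wd: "\<And>s i. 0 \<le> s \<Longrightarrow> s < S \<Longrightarrow> i \<in> {1..n} \<Longrightarrow>
      ((\<lambda>s. w s i) has_vector_derivative - (bdist (w s 1) *\<^sub>R energy_grad n b (w s) i)) (at s within {0..})"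
    and wS: "w S 1 \<in> frontier \<Omega>" "\<And>i. i \<in> {2..n} \<Longrightarrow> w S i \<in> \<Omega>"
    and rate: "\<And>s. 0 \<le> s \<Longrightarrow> s \<le> S \<Longrightarrow> bdist (w s 1) \<le> \<delta> - (1 / (4 * pi) - B * \<delta>) * s"
    using rescaled_flow[OF assms(1-3) \<delta>' \<delta> fb z0] by blast
  define e where "e s = bdist (w s 1)" for s
  define T where "T = integral {0..S} e"
  have ec: "continuous_on {0..S} e"
    unfolding e_def by (intro continuous_intros continuous_on_subset[OF wc]) auto
  have dom: "w s i \<in> \<Omega>" if "0 \<le> s" "s < S" "i \<in> {1..n}" for s i
    using inR[OF that(1,2)] that(3) by (simp add: region_def)
  have epos: "e s > 0" if "0 \<le> s" "s < S" for s
    using bdist_pos[OF dom[OF that]] \<open>n \<ge> 1\<close> by (simp add: e_def)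
  obtain \<tau> where "T > 0" and \<tau>: "\<tau> 0 = 0" "\<tau> T = S" "continuous_on {0..T} \<tau>" "\<tau> ` {0..T} \<subseteq> {0..S}"
    "\<And>t. 0 \<le> t \<Longrightarrow> t < T \<Longrightarrow> \<tau> t < S"
    "\<And>t. 0 \<le> t \<Longrightarrow> t < T \<Longrightarrow> (\<tau> has_real_derivative 1 / e (\<tau> t)) (at t)"
    unfolding T_def using time_change[OF \<open>S > 0\<close> ec epos] by metis
  have \<tau>0: "\<tau> t \<ge> 0" if "0 \<le> t" "t \<le> T" for t using \<tau>(4) that by force
  define z where "z t = w (\<tau> t)" for t
  have "boundary_collision \<Omega> k n b z0 T z"
    unfolding boundary_collision_def evolution_on_def
  proof (intro conjI ballI)
    show "continuous_on {0..T} (\<lambda>t. z t i)" for i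
      unfolding z_def by (rule continuous_on_compose2[OF wc \<tau>(3)]) (use \<tau>0 in auto)
    fix t assume "t \<in> {0..<T}"
    then have t: "0 \<le> t" "t < T" "0 \<le> \<tau> t" "\<tau> t < S" using \<tau>0 \<tau>(5) by auto
    have R: "z t \<in> region n \<gamma> \<delta>'" unfolding z_def by (rule inR[OF t(3,4)])
    show inj: "inj_on (z t) {1..n}"
    proof (rule inj_onI)
      fix i j assume ij: "i \<in> {1..n}" "j \<in> {1..n}" "z t i = z t j"
      then show "i = j"
        using region_distinct[OF R \<open>\<gamma> > 0\<close> \<delta>'(1) ij(1,2)] \<open>\<gamma> > 0\<close> by fastforce
    qed
    fix i assume i: "i \<in> {1..n}"
    show "z t i \<in> \<Omega>" using R i by (simp add: region_def)
    show "\<exists>D. GDERIV (\<lambda>p. energy k n b ((z t)(i := p))) (z t i) :> D \<and>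
           ((\<lambda>s. z s i) has_vector_derivative (- D)) (at t within {0..<T})"
    proof (intro exI conjI)
      show "GDERIV (\<lambda>p. energy k n b ((z t)(i := p))) (z t i) :> energy_grad n b (z t) i"
        using R by (intro GDERIV_energy inj i) (use sgn in \<open>auto simp: region_def\<close>)
      have "(\<tau> has_vector_derivative 1 / e (\<tau> t)) (at t within {0..<T})"
        using \<tau>(6)[OF t(1,2)] has_field_derivative_at_within
        by (auto simp flip: has_real_derivative_iff_has_vector_derivative)
      moreover have "((\<lambda>s. w s i) has_vector_derivative - (e (\<tau> t) *\<^sub>R energy_grad n b (z t) i)) (at (\<tau> t) within \<tau> ` {0..<T})"
        unfolding e_def z_def
        by (rule has_vector_derivative_within_subset[OF wd[OF t(3,4) i]]) (use \<tau>0 in auto)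
      ultimately have "((\<lambda>s. w s i) \<circ> \<tau> has_vector_derivative
          (1 / e (\<tau> t)) *\<^sub>R (- (e (\<tau> t) *\<^sub>R energy_grad n b (z t) i))) (at t within {0..<T})"
        by (rule vector_diff_chain_within)
      then show "((\<lambda>s. z s i) has_vector_derivative - energy_grad n b (z t) i) (at t within {0..<T})"
        using epos[OF t(3,4)] by (simp add: o_def z_def)
    qed
  next
    show "z 0 i = z0 i" for i by (simp add: z_def \<tau> w0)
    show "z T 1 \<in> frontier \<Omega>" "\<And>i. i \<in> {2..n} \<Longrightarrow> z T i \<in> \<Omega>"
      using wS by (simp_all add: z_def \<tau>)
  qed
  moreover have "T \<le> 2 * pi * \<delta>\<^sup>2 + 16 * pi\<^sup>2 * B * \<delta> ^ 3"
  proof -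
    \<comment> \<open>The relative loss of rate due to the bounded forces. As x \<le> 1/2, 1 / (1 -
      x) \<le> 1 + 2x, and the term 2x produces 16 \<pi>^2 B \<delta>^3.\<close>
    define x where "x = 4 * pi * (B * \<delta>)"
    have "B * \<delta> \<le> B * \<delta>'" using \<delta> \<open>B > 0\<close> by simp
    then have "B * \<delta> \<le> 1 / (8 * pi)" using \<delta>'(2) by linarith
    then have x: "0 \<le> x" "x \<le> 1 / 2"
      using \<delta>(1) \<open>B > 0\<close> by (auto simp: x_def field_simps)
    define a where "a = 1 / (4 * pi) - B * \<delta>"
    have a: "a = (1 - x) / (4 * pi)" by (simp add: a_def x_def field_simps)
    then have "a > 0" using x by simp
    have "T \<le> \<delta>\<^sup>2 / (2 * a)"
      unfolding T_def using \<open>S > 0\<close> \<open>a > 0\<close> ec rate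
      by (intro integral_le_of_linear_bound) (auto simp: e_def a_def)
    also have "\<delta>\<^sup>2 / (2 * a) = 2 * pi * \<delta>\<^sup>2 * (1 / (1 - x))"
      using x by (simp add: a field_simps)
    also have "\<dots> \<le> 2 * pi * \<delta>\<^sup>2 * (1 + 2 * x)"
    proof (rule mult_left_mono)
      have "x * (1 - 2 * x) \<ge> 0" using x by simp
      then show "1 / (1 - x) \<le> 1 + 2 * x" using x by (simp add: field_simps)
    qed simp
    also have "\<dots> = 2 * pi * \<delta>\<^sup>2 + 16 * pi\<^sup>2 * B * \<delta> ^ 3"
      by (simp add: x_def power2_eq_square power3_eq_cube algebra_simps)
    finally show ?thesis .
  qed
  ultimately show ?thesis using \<open>T > 0\<close> by blast
qed

lemma boundary_collision_small:
  assumes "\<gamma>\<^sub>0 > 0" "n \<ge> 1"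
  obtains \<delta>\<^sub>1 C where "\<delta>\<^sub>1 > 0"
    "\<And>\<delta> b z0. 0 < \<delta> \<Longrightarrow> \<delta> < \<delta>\<^sub>1 \<Longrightarrow> (\<forall>i\<in>{1..n}. b i \<in> {-1, 1}) \<Longrightarrow> z0 \<in> near_boundary \<Omega> n \<delta> \<gamma>\<^sub>0 \<Longrightarrow>
      \<exists>T>0. (\<exists>z. boundary_collision \<Omega> k n b z0 T z) \<and> T \<le> 2 * pi * \<delta>\<^sup>2 + C * \<delta> ^ 3"
proof -
  \<comment> \<open>The datum keeps margins 2\<gamma>, and the motion may use up half of
    them.\<close>
  define \<gamma> where "\<gamma> = \<gamma>\<^sub>0 / 2"
  have "\<gamma> > 0" using assms by (simp add: \<gamma>_def)
  obtain B where "B > 0" and B: "\<And>\<delta> b. \<delta> \<le> \<gamma> / 8 \<Longrightarrow> \<delta> \<le> \<rho> / 4 \<Longrightarrow> \<forall>j\<in>{1..n}. b j \<in> {-1, 1}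
      \<Longrightarrow> forces_bounded n b \<gamma> \<delta> B"
    by (rule ex_forces_bounded[OF \<open>\<gamma> > 0\<close> assms(2)]) blast
  \<comment> \<open>The bounds keep the dislocations separated, make the mirror image available, and
    hold the bounded forces below half of the image force.\<close>
  define \<delta>' where "\<delta>' = min (min (\<gamma> / 8) (\<rho> / 4)) (1 / (8 * pi * B))"
  have \<delta>': "\<delta>' > 0" "\<delta>' \<le> \<gamma> / 8" "\<delta>' \<le> \<rho> / 4"
    using \<open>\<gamma> > 0\<close> \<open>B > 0\<close> rho_pos by (auto simp: \<delta>'_def)
  have "B * \<delta>' \<le> B * (1 / (8 * pi * B))"
    using \<open>B > 0\<close> by (intro mult_left_mono) (auto simp: \<delta>'_def)
  then have B\<delta>': "B * \<delta>' \<le> 1 / (8 * pi)" using \<open>B > 0\<close> by simp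
  show ?thesis
  proof (rule that[of "min \<delta>' (\<gamma> / (16 * pi))" "16 * pi\<^sup>2 * B"])
    show "0 < min \<delta>' (\<gamma> / (16 * pi))" using \<delta>' \<open>\<gamma> > 0\<close> by simp
    fix \<delta> b z0
    assume \<delta>: "0 < \<delta>" "\<delta> < min \<delta>' (\<gamma> / (16 * pi))" and sgn: "\<forall>i\<in>{1..n}. b i \<in> {-1, 1::real}"
      and z0: "z0 \<in> near_boundary \<Omega> n \<delta> \<gamma>\<^sub>0"
    have "16 * pi * \<delta> < \<gamma>" using \<delta> by (simp add: field_simps)
    then show "\<exists>T>0. (\<exists>z. boundary_collision \<Omega> k n b z0 T z) \<and> T \<le> 2 * pi * \<delta>\<^sup>2 + 16 * pi\<^sup>2 * B * \<delta> ^ 3"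
      using \<delta> z0 near_boundary_eq_region[OF assms(2), of \<delta> \<gamma>\<^sub>0]
      by (intro boundary_collision_exists[OF \<open>\<gamma> > 0\<close> assms(2) \<open>B > 0\<close> sgn \<delta>'(2) B\<delta>' \<delta>(1) _ _ B[OF \<delta>'(2,3) sgn]])
        (auto simp: \<gamma>_def)
  qed
qed

end

theorem theorem3p2:
  fixes \<Omega> :: "(real^2) set" and \<rho> :: real and k :: "real^2 \<Rightarrow> real^2 \<Rightarrow> real"
    and n :: nat and \<sigma> \<gamma>\<^sub>0 :: real
  assumes "open \<Omega>" and "connected \<Omega>" and "bounded \<Omega>" and "C2_boundary \<Omega>"
    and "\<rho> > 0" and "disk_conditions \<Omega> \<rho>"
    and "is_regular_part \<Omega> k"
    and "n \<ge> 1" and "0 < \<sigma>" and "\<sigma> < 1"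
    and "0 < \<gamma>\<^sub>0" and "\<gamma>\<^sub>0 < diameter \<Omega> / 2"
  shows "(\<exists>\<delta>\<^sub>0. 0 < \<delta>\<^sub>0 \<and> \<delta>\<^sub>0 < \<gamma>\<^sub>0 \<and>
           (\<forall>b z0. (\<forall>i\<in>{1..n}. b i \<in> {-1, 1}) \<longrightarrow> z0 \<in> near_boundary \<Omega> n \<delta>\<^sub>0 \<gamma>\<^sub>0 \<longrightarrow>
              (\<exists>T>0. \<exists>z. boundary_collision \<Omega> k n b z0 T z)))
       \<and> (\<exists>C. \<forall>\<^sub>F \<delta>\<^sub>0 in at_right 0.
            \<forall>b z0. (\<forall>i\<in>{1..n}. b i \<in> {-1, 1}) \<longrightarrow> z0 \<in> near_boundary \<Omega> n \<delta>\<^sub>0 \<gamma>\<^sub>0 \<longrightarrow>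
              (\<exists>T>0. (\<exists>z. boundary_collision \<Omega> k n b z0 T z)
                     \<and> T \<le> 2 * pi * \<delta>\<^sub>0\<^sup>2 + C * \<delta>\<^sub>0 ^ 3))"
proof -
  interpret regular_part_domain \<Omega> k \<rho>
    using assms by unfold_locales
  obtain \<delta>\<^sub>1 C where "\<delta>\<^sub>1 > 0" and main:
    "\<And>\<delta> b z0. 0 < \<delta> \<Longrightarrow> \<delta> < \<delta>\<^sub>1 \<Longrightarrow> (\<forall>i\<in>{1..n}. b i \<in> {-1, 1}) \<Longrightarrow> z0 \<in> near_boundary \<Omega> n \<delta> \<gamma>\<^sub>0 \<Longrightarrow>
      \<exists>T>0. (\<exists>z. boundary_collision \<Omega> k n b z0 T z) \<and> T \<le> 2 * pi * \<delta>\<^sup>2 + C * \<delta> ^ 3"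
    using boundary_collision_small[OF \<open>0 < \<gamma>\<^sub>0\<close> \<open>n \<ge> 1\<close>] by blast
  show ?thesis
  \<comment> \<open>Halving keeps the witness strictly below both thresholds.\<close>
  proof (rule conjI[OF exI[of _ "min \<delta>\<^sub>1 \<gamma>\<^sub>0 / 2"] exI[of _ C]], intro conjI)
    show "0 < min \<delta>\<^sub>1 \<gamma>\<^sub>0 / 2" "min \<delta>\<^sub>1 \<gamma>\<^sub>0 / 2 < \<gamma>\<^sub>0"
      using \<open>\<delta>\<^sub>1 > 0\<close> \<open>0 < \<gamma>\<^sub>0\<close> by auto
    show "\<forall>b z0. (\<forall>i\<in>{1..n}. b i \<in> {-1, 1}) \<longrightarrow> z0 \<in> near_boundary \<Omega> n (min \<delta>\<^sub>1 \<gamma>\<^sub>0 / 2) \<gamma>\<^sub>0 \<longrightarrow>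
        (\<exists>T>0. \<exists>z. boundary_collision \<Omega> k n b z0 T z)"
      using main[of "min \<delta>\<^sub>1 \<gamma>\<^sub>0 / 2"] \<open>\<delta>\<^sub>1 > 0\<close> \<open>0 < \<gamma>\<^sub>0\<close> by (auto simp: min_def) metis+
    show "\<forall>\<^sub>F \<delta>\<^sub>0 in at_right 0.
        \<forall>b z0. (\<forall>i\<in>{1..n}. b i \<in> {-1, 1}) \<longrightarrow> z0 \<in> near_boundary \<Omega> n \<delta>\<^sub>0 \<gamma>\<^sub>0 \<longrightarrow>
          (\<exists>T>0. (\<exists>z. boundary_collision \<Omega> k n b z0 T z) \<and> T \<le> 2 * pi * \<delta>\<^sub>0\<^sup>2 + C * \<delta>\<^sub>0 ^ 3)"
      unfolding eventually_at_right_field using \<open>\<delta>\<^sub>1 > 0\<close> main by blast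
  qed
qed

end
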